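(* Let $R$ be a commutative Noetherian ring with non-zero identity and $\mathfrak a$ an ideal of $R$. Let $M$ be a non-zero $R$-module (not necessarily finitely generated) such that $\mathrm{cd}(\mathfrak a,M)=\mathrm{cd}(\mathfrak a,R/\mathrm{Ann}_R M)$ is finite. Then $$\mathrm{Att}_R(H^{\mathrm{cd}(\mathfrak a,M)}_{\mathfrak a}(M))\subseteq\{\mathfrak p\in V(\mathrm{Ann}_R M)\mid \mathrm{cd}(\mathfrak a,R/\mathfrak p)=\mathrm{cd}(\mathfrak a,M)\}.$$
   Context: $H^i_{\mathfrak a}(M)=\varinjlim_{n\ge 1}\mathrm{Ext}^i_R(R/\mathfrak a^n,M)$ is the $i$-th local cohomology module. $\mathrm{cd}(\mathfrak a,L)=\sup\{i\in\mathbb Z\mid H^i_{\mathfrak a}(L)\neq0\}$ (with $\sup\emptyset=-\infty$). $V(\mathfrak b)$ is the set of primes of $R$ containing $\mathfrak b$. A prime $\mathfrak p$ of $R$ is attached to an $R$-module $A$ if $\mathfrak p=\mathrm{Ann}_R(A/B)$ for some submodule $B$ of $A$ (equivalently $\mathfrak p=\mathrm{Ann}_R(A/\mathfrak pA)$); $\mathrm{Att}_R A$ is the set of attached primes of $A$. *)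

theory Defs
  imports "HOL-Library.Extended_Real" "HOL-Algebra.Ring_Divisibility" "HOL-Algebra.Ideal_Product" "HOL-Algebra.Module"
begin

section \<open>Modules over a commutative ring\<close>

text \<open>
  The record type of modules extends that of rings. The multiplicative fields of a module carry no
  meaning and are left undefined in the constructions below.
\<close>

definition self_module :: "('a, 'r) ring_scheme \<Rightarrow> ('a, 'a) module" where
  "self_module R =
     \<lparr>carrier = carrier R, monoid.mult = undefined, one = undefined,
      ring.zero = \<zero>\<^bsub>R\<^esub>, add = add R, smult = monoid.mult R\<rparr>"

definition quot_module :: "('a, 'b, 'm) module_scheme \<Rightarrow> 'b set \<Rightarrow> ('a, 'b set) module" where
  "quot_module M N =
     \<lparr>carrier = a_rcosets\<^bsub>M\<^esub> N, monoid.mult = undefined, one = undefined,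
      ring.zero = N, add = set_add M, smult = (\<lambda>r X. \<Union>x\<in>X. N +>\<^bsub>M\<^esub> (r \<odot>\<^bsub>M\<^esub> x))\<rparr>"

abbreviation cyclic_module :: "('a, 'r) ring_scheme \<Rightarrow> 'a set \<Rightarrow> ('a, 'a set) module" where
  "cyclic_module R I \<equiv> quot_module (self_module R) I"

text \<open>Homomorphisms are taken extensional, so that equal maps are equal functions.\<close>

definition mod_hom ::
  "('a, 'r) ring_scheme \<Rightarrow> ('a, 'b, 'm) module_scheme \<Rightarrow> ('a, 'c, 'n) module_scheme \<Rightarrow> ('b \<Rightarrow> 'c) set"
  where
  "mod_hom R M N = {h \<in> carrier M \<rightarrow>\<^sub>E carrier N.
     (\<forall>x\<in>carrier M. \<forall>y\<in>carrier M. h (x \<oplus>\<^bsub>M\<^esub> y) = h x \<oplus>\<^bsub>N\<^esub> h y) \<and>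
     (\<forall>r\<in>carrier R. \<forall>x\<in>carrier M. h (r \<odot>\<^bsub>M\<^esub> x) = r \<odot>\<^bsub>N\<^esub> h x)}"

definition Hom_module ::
  "('a, 'r) ring_scheme \<Rightarrow> ('a, 'b, 'm) module_scheme \<Rightarrow> ('a, 'c, 'n) module_scheme
     \<Rightarrow> ('a, 'b \<Rightarrow> 'c) module"
  where
  "Hom_module R M N =
     \<lparr>carrier = mod_hom R M N, monoid.mult = undefined, one = undefined,
      ring.zero = (\<lambda>x\<in>carrier M. \<zero>\<^bsub>N\<^esub>),
      add = (\<lambda>g h. \<lambda>x\<in>carrier M. g x \<oplus>\<^bsub>N\<^esub> h x),
      smult = (\<lambda>r h. \<lambda>x\<in>carrier M. r \<odot>\<^bsub>N\<^esub> h x)\<rparr>"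

text \<open>The free module \<open>R\<^sup>n\<close>, with elements the functions on \<open>{..<n}\<close>.\<close>

definition free_module :: "('a, 'r) ring_scheme \<Rightarrow> nat \<Rightarrow> ('a, nat \<Rightarrow> 'a) module" where
  "free_module R n =
     \<lparr>carrier = {..<n} \<rightarrow>\<^sub>E carrier R, monoid.mult = undefined, one = undefined,
      ring.zero = (\<lambda>j\<in>{..<n}. \<zero>\<^bsub>R\<^esub>),
      add = (\<lambda>u v. \<lambda>j\<in>{..<n}. u j \<oplus>\<^bsub>R\<^esub> v j),
      smult = (\<lambda>r u. \<lambda>j\<in>{..<n}. r \<otimes>\<^bsub>R\<^esub> u j)\<rparr>"

definition annihilator :: "('a, 'r) ring_scheme \<Rightarrow> ('a, 'b, 'm) module_scheme \<Rightarrow> 'a set" where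
  "annihilator R M = {r \<in> carrier R. \<forall>x\<in>carrier M. r \<odot>\<^bsub>M\<^esub> x = \<zero>\<^bsub>M\<^esub>}"

definition primes_containing :: "('a, 'r) ring_scheme \<Rightarrow> 'a set \<Rightarrow> 'a set set" where
  "primes_containing R \<bb> = {\<pp>. primeideal \<pp> R \<and> \<bb> \<subseteq> \<pp>}"

definition attached_primes ::
  "('a, 'r) ring_scheme \<Rightarrow> ('a, 'b, 'm) module_scheme \<Rightarrow> 'a set set" where
  "attached_primes R A =
     {\<pp>. primeideal \<pp> R \<and> (\<exists>B. submodule B R A \<and> \<pp> = annihilator R (quot_module A B))}"


section \<open>Ext\<close>

text \<open>
  A resolution \<open>\<dots> \<rightarrow> R\<^bsup>rk 1\<^esup> \<rightarrow> R\<^bsup>rk 0\<^esup> \<rightarrow> N \<rightarrow> 0\<close> by free modules of finite rank, with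
  \<open>bdry i : R\<^bsup>rk (i+1)\<^esup> \<rightarrow> R\<^bsup>rk i\<^esup>\<close>. Every finitely generated module over a Noetherian ring has
  one, and \<open>Ext\<close> is only applied to such modules in the first argument.
\<close>

record ('a, 'c) resolution =
  rk :: "nat \<Rightarrow> nat"
  bdry :: "nat \<Rightarrow> (nat \<Rightarrow> 'a) \<Rightarrow> (nat \<Rightarrow> 'a)"
  augm :: "(nat \<Rightarrow> 'a) \<Rightarrow> 'c"

definition term_module ::
  "('a, 'r) ring_scheme \<Rightarrow> ('a, 'c) resolution \<Rightarrow> nat \<Rightarrow> ('a, nat \<Rightarrow> 'a) module" where
  "term_module R F i = free_module R (rk F i)"

definition is_free_resolution ::
  "('a, 'r) ring_scheme \<Rightarrow> ('a, 'c, 'n) module_scheme \<Rightarrow> ('a, 'c) resolution \<Rightarrow> bool" where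
  "is_free_resolution R N F \<longleftrightarrow>
     (\<forall>i. bdry F i \<in> mod_hom R (term_module R F (Suc i)) (term_module R F i)) \<and>
     augm F \<in> mod_hom R (term_module R F 0) N \<and>
     augm F ` carrier (term_module R F 0) = carrier N \<and>
     bdry F 0 ` carrier (term_module R F 1) = a_kernel (term_module R F 0) N (augm F) \<and>
     (\<forall>i. bdry F (Suc i) ` carrier (term_module R F (Suc (Suc i))) =
          a_kernel (term_module R F (Suc i)) (term_module R F i) (bdry F i))"

text \<open>
  \<open>Ext\<close> is computed from one chosen resolution, and the maps induced on it from one chosen lift to
  a chain map; up to natural isomorphism, respectively on the nose, it does not depend on these
  choices.
\<close>

definition chosen_resolution ::
  "('a, 'r) ring_scheme \<Rightarrow> ('a, 'c, 'n) module_scheme \<Rightarrow> ('a, 'c) resolution" where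
  "chosen_resolution R N = (SOME F. is_free_resolution R N F)"

definition cochain_module ::
  "('a, 'r) ring_scheme \<Rightarrow> ('a, 'c) resolution \<Rightarrow> nat \<Rightarrow> ('a, 'b, 'm) module_scheme
     \<Rightarrow> ('a, (nat \<Rightarrow> 'a) \<Rightarrow> 'b) module" where
  "cochain_module R F i M = Hom_module R (term_module R F i) M"

definition cobdry ::
  "('a, 'r) ring_scheme \<Rightarrow> ('a, 'c) resolution \<Rightarrow> nat \<Rightarrow> ((nat \<Rightarrow> 'a) \<Rightarrow> 'b) \<Rightarrow> (nat \<Rightarrow> 'a) \<Rightarrow> 'b" where
  "cobdry R F i g = compose (carrier (term_module R F (Suc i))) g (bdry F i)"

definition cocycles ::
  "('a, 'r) ring_scheme \<Rightarrow> ('a, 'c) resolution \<Rightarrow> nat \<Rightarrow> ('a, 'b, 'm) module_scheme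
     \<Rightarrow> ((nat \<Rightarrow> 'a) \<Rightarrow> 'b) set" where
  "cocycles R F i M =
     a_kernel (cochain_module R F i M) (cochain_module R F (Suc i) M) (cobdry R F i)"

primrec coboundaries ::
  "('a, 'r) ring_scheme \<Rightarrow> ('a, 'c) resolution \<Rightarrow> nat \<Rightarrow> ('a, 'b, 'm) module_scheme
     \<Rightarrow> ((nat \<Rightarrow> 'a) \<Rightarrow> 'b) set" where
  "coboundaries R F 0 M = {\<zero>\<^bsub>cochain_module R F 0 M\<^esub>}"
| "coboundaries R F (Suc i) M = cobdry R F i ` carrier (cochain_module R F i M)"

definition Ext ::
  "('a, 'r) ring_scheme \<Rightarrow> nat \<Rightarrow> ('a, 'c, 'n) module_scheme \<Rightarrow> ('a, 'b, 'm) module_scheme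
     \<Rightarrow> ('a, ((nat \<Rightarrow> 'a) \<Rightarrow> 'b) set) module" where
  "Ext R i N M =
     (let F = chosen_resolution R N in
      quot_module ((cochain_module R F i M)\<lparr>carrier := cocycles R F i M\<rparr>) (coboundaries R F i M))"

definition is_chain_lift ::
  "('a, 'r) ring_scheme \<Rightarrow> ('a, 'c) resolution \<Rightarrow> ('a, 'd) resolution \<Rightarrow> ('c \<Rightarrow> 'd)
     \<Rightarrow> (nat \<Rightarrow> (nat \<Rightarrow> 'a) \<Rightarrow> (nat \<Rightarrow> 'a)) \<Rightarrow> bool" where
  "is_chain_lift R F G f \<phi> \<longleftrightarrow>
     (\<forall>i. \<phi> i \<in> mod_hom R (term_module R F i) (term_module R G i)) \<and>
     (\<forall>x\<in>carrier (term_module R F 0). augm G (\<phi> 0 x) = f (augm F x)) \<and>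
     (\<forall>i. \<forall>x\<in>carrier (term_module R F (Suc i)). bdry G i (\<phi> (Suc i) x) = \<phi> i (bdry F i x))"

text \<open>
  The map \<open>Ext\<^sup>i(N', M) \<rightarrow> Ext\<^sup>i(N, M)\<close> induced by \<open>f : N \<rightarrow> N'\<close>. It takes the class of a cocycle \<open>g\<close>
  to that of \<open>g \<circ> \<phi> i\<close>; the union is over representatives of one class.
\<close>

definition Ext_map ::
  "('a, 'r) ring_scheme \<Rightarrow> nat \<Rightarrow> ('a, 'c, 'n) module_scheme \<Rightarrow> ('a, 'd, 'p) module_scheme
     \<Rightarrow> ('c \<Rightarrow> 'd) \<Rightarrow> ('a, 'b, 'm) module_scheme
     \<Rightarrow> ((nat \<Rightarrow> 'a) \<Rightarrow> 'b) set \<Rightarrow> ((nat \<Rightarrow> 'a) \<Rightarrow> 'b) set" where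
  "Ext_map R i N N' f M =
     (let F = chosen_resolution R N; G = chosen_resolution R N';
          \<phi> = (SOME \<phi>. is_chain_lift R F G f \<phi>)
      in (\<lambda>X\<in>carrier (Ext R i N' M).
           \<Union>g\<in>X. coboundaries R F i M +>\<^bsub>cochain_module R F i M\<^esub>
                    compose (carrier (term_module R F i)) g (\<phi> i)))"


section \<open>Direct limits of sequences of modules\<close>

text \<open>For maps \<open>f n : A n \<rightarrow> A (n+1)\<close>, the composite \<open>A n \<rightarrow> A (n+k)\<close>.\<close>

primrec iter_map :: "(nat \<Rightarrow> 'b \<Rightarrow> 'b) \<Rightarrow> nat \<Rightarrow> nat \<Rightarrow> 'b \<Rightarrow> 'b" where
  "iter_map f n 0 x = x"
| "iter_map f n (Suc k) x = f (n + k) (iter_map f n k x)"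

definition limit_class ::
  "(nat \<Rightarrow> ('a, 'b, 'm) module_scheme) \<Rightarrow> (nat \<Rightarrow> 'b \<Rightarrow> 'b) \<Rightarrow> nat \<Rightarrow> 'b \<Rightarrow> (nat \<times> 'b) set" where
  "limit_class A f n x =
     {(m, y). y \<in> carrier (A m) \<and> (\<exists>k l. n + k = m + l \<and> iter_map f n k x = iter_map f m l y)}"

definition direct_limit ::
  "(nat \<Rightarrow> ('a, 'b, 'm) module_scheme) \<Rightarrow> (nat \<Rightarrow> 'b \<Rightarrow> 'b) \<Rightarrow> ('a, (nat \<times> 'b) set) module" where
  "direct_limit A f =
     \<lparr>carrier = {limit_class A f n x | n x. x \<in> carrier (A n)},
      monoid.mult = undefined, one = undefined,
      ring.zero = limit_class A f 0 \<zero>\<^bsub>A 0\<^esub>,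
      add = (\<lambda>X Y. \<Union>(n, x)\<in>X. \<Union>(m, y)\<in>Y.
               limit_class A f (n + m) (iter_map f n m x \<oplus>\<^bsub>A (n + m)\<^esub> iter_map f m n y)),
      smult = (\<lambda>r X. \<Union>(n, x)\<in>X. limit_class A f n (r \<odot>\<^bsub>A n\<^esub> x))\<rparr>"


section \<open>Local cohomology and cohomological dimension\<close>

text \<open>The index is shifted so that the system is \<open>R/\<aa>\<^sup>n\<close> for \<open>n \<ge> 1\<close>.\<close>

definition power_quot :: "('a, 'r) ring_scheme \<Rightarrow> 'a set \<Rightarrow> nat \<Rightarrow> ('a, 'a set) module" where
  "power_quot R \<aa> n = cyclic_module R (\<aa> [^]\<^bsub>ideals_set R\<^esub> Suc n)"

text \<open>The projection \<open>R/\<aa>\<^bsup>n+2\<^esup> \<rightarrow> R/\<aa>\<^bsup>n+1\<^esup>\<close>: it takes \<open>\<aa>\<^bsup>n+2\<^esup> + x\<close> to \<open>\<aa>\<^bsup>n+1\<^esup> + x\<close>.\<close>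

definition power_quot_proj :: "('a, 'r) ring_scheme \<Rightarrow> 'a set \<Rightarrow> nat \<Rightarrow> 'a set \<Rightarrow> 'a set" where
  "power_quot_proj R \<aa> n =
     (\<lambda>X\<in>carrier (power_quot R \<aa> (Suc n)). \<Union>x\<in>X. (\<aa> [^]\<^bsub>ideals_set R\<^esub> Suc n) +>\<^bsub>R\<^esub> x)"

definition local_cohomology ::
  "('a, 'r) ring_scheme \<Rightarrow> 'a set \<Rightarrow> nat \<Rightarrow> ('a, 'b, 'm) module_scheme
     \<Rightarrow> ('a, (nat \<times> ((nat \<Rightarrow> 'a) \<Rightarrow> 'b) set) set) module" where
  "local_cohomology R \<aa> i M =
     direct_limit
       (\<lambda>n. Ext R i (power_quot R \<aa> n) M)
       (\<lambda>n. Ext_map R i (power_quot R \<aa> (Suc n)) (power_quot R \<aa> n) (power_quot_proj R \<aa> n) M)"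

text \<open>
  Local cohomology vanishes in negative degrees, so the supremum over integers is one over
  naturals. In the extended reals the supremum of the empty set is \<open>-\<infinity>\<close>.
\<close>

definition cd :: "('a, 'r) ring_scheme \<Rightarrow> 'a set \<Rightarrow> ('a, 'b, 'm) module_scheme \<Rightarrow> ereal" where
  "cd R \<aa> L =
     (SUP i\<in>{i. carrier (local_cohomology R \<aa> i L) \<noteq> {\<zero>\<^bsub>local_cohomology R \<aa> i L\<^esub>}}. ereal (real i))"

end

theory Submission
  imports Defs
begin

text \<open>
  Write \<open>J\<close> for the annihilator of \<open>M\<close> and \<open>c\<close> for the common value of the two cohomological
  dimensions. The proof rests on one principle: if local cohomology of \<open>R/J\<close> vanishes in all degrees
  from \<open>s\<close> on, then so does that of every module killed by \<open>J\<close> (\<open>vanishes_of_cyclic\<close>).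

  Granting it, all modules killed by \<open>J\<close> have no local cohomology above degree \<open>c\<close>, so on these
  modules the functor \<open>H\<^sup>c\<close> is right exact. Let \<open>\<pp>\<close> be attached to \<open>H\<^sup>c(M)\<close>, say as the annihilator of
  \<open>H\<^sup>c(M)/D\<close>. It contains \<open>J\<close>, hence \<open>R/\<pp>\<close> is killed by \<open>J\<close> and has cohomological dimension at most
  \<open>c\<close>. If it were smaller than \<open>c\<close>, the principle for \<open>\<pp>\<close> in place of \<open>J\<close> would give
  \<open>H\<^sup>c(M/\<pp>M) = 0\<close>; by right exactness \<open>H\<^sup>c(M) = \<pp>H\<^sup>c(M)\<close>, which lies in \<open>D\<close>. Then the unit would
  annihilate \<open>H\<^sup>c(M)/D\<close> and lie in the prime \<open>\<pp>\<close> (\<open>H_subset_submodule\<close>).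

  The principle is a descending induction on the degree along \<open>0 \<rightarrow> K \<rightarrow> (R/J)\<^sup>r \<rightarrow> X \<rightarrow> 0\<close>, and it needs a
  degree above which everything vanishes. The number of generators of \<open>\<aa>\<close> is one
  (\<open>universal_cocycle_dies_bound\<close>). For modules on which a power of every generator acts as zero,
  all positive degrees vanish (\<open>torsion_universal_cocycle_dies\<close>): such a module embeds in a larger one
  of the same kind that kills a given class, because an essential extension of a finitely generated
  torsion module is torsion. Giving up the torsion condition for one generator \<open>x\<close> costs one degree:
  every class is killed by a power \<open>y\<close> of \<open>x\<close>, and multiplication by \<open>y\<close> has torsion kernel and
  cokernel (\<open>dies_by_multiplication\<close>).

  Local cohomology is treated on the level of cochains. An \<open>i\<close>-cochain is a linear map from the \<open>i\<close>-th
  term of the resolution of some \<open>R/\<aa>\<^sup>n\<close>, and \<open>H\<^sup>i(X) = 0\<close> says that every cocycle becomes a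
  coboundary further down the tower of resolutions. Coefficients \<open>X = W/N\<close> are carried along as a
  module \<open>W\<close> with a submodule \<open>N\<close>, cocycle conditions being read modulo \<open>N\<close>; then the exact sequences
  needed are \<open>0 \<rightarrow> L/N \<rightarrow> W/N \<rightarrow> W/L \<rightarrow> 0\<close>, and liftings along \<open>W \<rightarrow> W/N\<close> exist since the terms
  are free (\<open>free_module_linear_choice\<close>). A cocycle \<open>g\<close> on a term \<open>T\<close> with values in \<open>W/N\<close> is the image of
  the identity of \<open>T\<close> taken modulo the preimage of \<open>N\<close>. So it is enough to treat the universal cocycles
  (\<open>vanishes_by_universal\<close>), whose coefficients are finitely generated and all of one type,
  whatever \<open>W\<close> is.
\<close>

section \<open>Linear maps and congruence modulo a submodule\<close>

text \<open>
  Unlike the elements of \<open>mod_hom\<close>, these maps are not required to be extensional, so that they can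
  be composed and added pointwise.
\<close>

definition linear_map ::
  "('a, 'r) ring_scheme \<Rightarrow> ('a, 'b, 'm) module_scheme \<Rightarrow> ('a, 'c, 'n) module_scheme \<Rightarrow> ('b \<Rightarrow> 'c) \<Rightarrow> bool"
  where
  "linear_map R A B g \<longleftrightarrow>
     (\<forall>x\<in>carrier A. g x \<in> carrier B) \<and>
     (\<forall>x\<in>carrier A. \<forall>y\<in>carrier A. g (x \<oplus>\<^bsub>A\<^esub> y) = g x \<oplus>\<^bsub>B\<^esub> g y) \<and>
     (\<forall>r\<in>carrier R. \<forall>x\<in>carrier A. g (r \<odot>\<^bsub>A\<^esub> x) = r \<odot>\<^bsub>B\<^esub> g x)"

lemma linear_map_closed: "linear_map R A B g \<Longrightarrow> x \<in> carrier A \<Longrightarrow> g x \<in> carrier B"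
  and linear_map_add: "linear_map R A B g \<Longrightarrow> x \<in> carrier A \<Longrightarrow> y \<in> carrier A \<Longrightarrow>
         g (x \<oplus>\<^bsub>A\<^esub> y) = g x \<oplus>\<^bsub>B\<^esub> g y"
  and linear_map_smult: "linear_map R A B g \<Longrightarrow> r \<in> carrier R \<Longrightarrow> x \<in> carrier A \<Longrightarrow>
         g (r \<odot>\<^bsub>A\<^esub> x) = r \<odot>\<^bsub>B\<^esub> g x"
  by (auto simp: linear_map_def)

lemma linear_map_zero:
  assumes "module R A" "module R B" "linear_map R A B g"
  shows "g \<zero>\<^bsub>A\<^esub> = \<zero>\<^bsub>B\<^esub>"
proof -
  interpret A: module R A by fact
  interpret B: module R B by fact
  have "g (\<zero>\<^bsub>R\<^esub> \<odot>\<^bsub>A\<^esub> \<zero>\<^bsub>A\<^esub>) = \<zero>\<^bsub>R\<^esub> \<odot>\<^bsub>B\<^esub> g \<zero>\<^bsub>A\<^esub>"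
    using assms(3) by (intro linear_map_smult) auto
  then show ?thesis using linear_map_closed[OF assms(3)] by simp
qed

lemma linear_map_minus:
  assumes "module R A" "module R B" "linear_map R A B g" "x \<in> carrier A"
  shows "g (\<ominus>\<^bsub>A\<^esub> x) = \<ominus>\<^bsub>B\<^esub> g x"
proof -
  interpret A: module R A by fact
  interpret B: module R B by fact
  have "g (\<ominus>\<^bsub>A\<^esub> x) = g ((\<ominus>\<^bsub>R\<^esub> \<one>\<^bsub>R\<^esub>) \<odot>\<^bsub>A\<^esub> x)"
    using assms(4) by (simp add: A.smult_l_minus)
  also have "\<dots> = \<ominus>\<^bsub>B\<^esub> g x"
    using assms(3,4) by (simp add: linear_map_smult B.smult_l_minus linear_map_closed)
  finally show ?thesis .
qed

lemma linear_map_diff: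
  assumes "module R A" "module R B" "linear_map R A B g" "x \<in> carrier A" "y \<in> carrier A"
  shows "g (x \<ominus>\<^bsub>A\<^esub> y) = g x \<ominus>\<^bsub>B\<^esub> g y"
proof -
  interpret A: module R A by fact
  show ?thesis using assms
    by (simp add: a_minus_def linear_map_add linear_map_minus[OF assms(1-3)])
qed

lemma linear_map_compose:
  assumes "linear_map R A B f" "linear_map R B C g"
  shows "linear_map R A C (\<lambda>x. g (f x))"
  using assms by (auto simp: linear_map_def)

lemma linear_map_ident: "linear_map R A A (\<lambda>x. x)"
  by (auto simp: linear_map_def)

lemma linear_map_restrict_codomain:
  assumes "linear_map R A B g" "\<And>x. x \<in> carrier A \<Longrightarrow> g x \<in> N"
  shows "linear_map R A (B\<lparr>carrier := N\<rparr>) g"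
  using assms by (auto simp: linear_map_def)

lemma linear_map_extend_codomain:
  assumes "linear_map R A (B\<lparr>carrier := N\<rparr>) g" "N \<subseteq> carrier B"
  shows "linear_map R A B g"
  using assms by (auto simp: linear_map_def)

context module
begin

lemma submodule_subset: "submodule N R M \<Longrightarrow> N \<subseteq> carrier M"
  and submodule_closed: "submodule N R M \<Longrightarrow> x \<in> N \<Longrightarrow> x \<in> carrier M"
  and submodule_add: "submodule N R M \<Longrightarrow> x \<in> N \<Longrightarrow> y \<in> N \<Longrightarrow> x \<oplus>\<^bsub>M\<^esub> y \<in> N"
  and submodule_smult: "submodule N R M \<Longrightarrow> r \<in> carrier R \<Longrightarrow> x \<in> N \<Longrightarrow> r \<odot>\<^bsub>M\<^esub> x \<in> N"
  and submodule_minus: "submodule N R M \<Longrightarrow> x \<in> N \<Longrightarrow> \<ominus>\<^bsub>M\<^esub> x \<in> N"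
  using submoduleE[of N] by auto

lemma submodule_zero: "submodule N R M \<Longrightarrow> \<zero>\<^bsub>M\<^esub> \<in> N"
  by (metis submoduleE(1,2,4) equals0I in_mono smult_l_null R.zero_closed)

lemma submodule_diff: "submodule N R M \<Longrightarrow> x \<in> N \<Longrightarrow> y \<in> N \<Longrightarrow> x \<ominus>\<^bsub>M\<^esub> y \<in> N"
  by (simp add: a_minus_def submodule_add submodule_minus)

lemma submodule_by_smult:
  assumes "N \<subseteq> carrier M" "\<zero>\<^bsub>M\<^esub> \<in> N" "\<And>x y. x \<in> N \<Longrightarrow> y \<in> N \<Longrightarrow> x \<oplus>\<^bsub>M\<^esub> y \<in> N"
    "\<And>r x. r \<in> carrier R \<Longrightarrow> x \<in> N \<Longrightarrow> r \<odot>\<^bsub>M\<^esub> x \<in> N"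
  shows "submodule N R M"
proof (rule submoduleI)
  fix a assume a: "a \<in> N"
  then have "(\<ominus>\<^bsub>R\<^esub> \<one>\<^bsub>R\<^esub>) \<odot>\<^bsub>M\<^esub> a \<in> N" using assms(4) by simp
  then show "\<ominus>\<^bsub>M\<^esub> a \<in> N" using a assms(1) smult_l_minus[of \<one> a] by auto
qed (use assms in auto)

lemma zero_submodule: "submodule {\<zero>\<^bsub>M\<^esub>} R M"
  by (rule submodule_by_smult) auto

lemma diff_add_diff:
  assumes "x \<in> carrier M" "y \<in> carrier M" "z \<in> carrier M"
  shows "(x \<ominus>\<^bsub>M\<^esub> y) \<oplus>\<^bsub>M\<^esub> (y \<ominus>\<^bsub>M\<^esub> z) = x \<ominus>\<^bsub>M\<^esub> z"
  using assms by (simp add: a_minus_def M.a_assoc M.r_neg1)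

lemma minus_diff:
  assumes "x \<in> carrier M" "y \<in> carrier M"
  shows "\<ominus>\<^bsub>M\<^esub> (x \<ominus>\<^bsub>M\<^esub> y) = y \<ominus>\<^bsub>M\<^esub> x"
  using assms by (simp add: a_minus_def M.minus_add M.a_comm)

lemma add_diff_add:
  assumes "x \<in> carrier M" "y \<in> carrier M" "u \<in> carrier M" "v \<in> carrier M"
  shows "(x \<oplus>\<^bsub>M\<^esub> u) \<ominus>\<^bsub>M\<^esub> (y \<oplus>\<^bsub>M\<^esub> v) = (x \<ominus>\<^bsub>M\<^esub> y) \<oplus>\<^bsub>M\<^esub> (u \<ominus>\<^bsub>M\<^esub> v)"
  using assms by (simp add: a_minus_def M.minus_add M.a_ac)

lemma smult_diff:
  assumes "r \<in> carrier R" "x \<in> carrier M" "y \<in> carrier M"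
  shows "r \<odot>\<^bsub>M\<^esub> (x \<ominus>\<^bsub>M\<^esub> y) = r \<odot>\<^bsub>M\<^esub> x \<ominus>\<^bsub>M\<^esub> r \<odot>\<^bsub>M\<^esub> y"
  using assms by (simp add: a_minus_def smult_r_distr smult_r_minus)

lemma add_diff_cancel':
  assumes "x \<in> carrier M" "y \<in> carrier M"
  shows "(x \<ominus>\<^bsub>M\<^esub> y) \<oplus>\<^bsub>M\<^esub> y = x" and "y \<oplus>\<^bsub>M\<^esub> (x \<ominus>\<^bsub>M\<^esub> y) = x" and "(x \<oplus>\<^bsub>M\<^esub> y) \<ominus>\<^bsub>M\<^esub> y = x"
  using assms by (simp_all add: a_minus_def M.a_assoc M.l_neg M.r_neg M.a_comm[of x] M.r_neg2 M.r_neg1)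

lemma diff_self: "x \<in> carrier M \<Longrightarrow> x \<ominus>\<^bsub>M\<^esub> x = \<zero>\<^bsub>M\<^esub>"
  by (simp add: a_minus_def M.r_neg)

lemma diff_zero: "x \<in> carrier M \<Longrightarrow> x \<ominus>\<^bsub>M\<^esub> \<zero>\<^bsub>M\<^esub> = x"
  by (simp add: a_minus_def)

lemma diff_eq_zero: "x \<in> carrier M \<Longrightarrow> y \<in> carrier M \<Longrightarrow> x \<ominus>\<^bsub>M\<^esub> y = \<zero>\<^bsub>M\<^esub> \<Longrightarrow> x = y"
  by (metis add_diff_cancel'(1) M.l_zero)

end

text \<open>
  Working with congruences in \<open>M\<close> rather than with equations between cosets keeps the quotient
  \<open>M/N\<close> implicit.
\<close>

definition cong_mod :: "('a, 'b, 'm) module_scheme \<Rightarrow> 'b set \<Rightarrow> 'b \<Rightarrow> 'b \<Rightarrow> bool" where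
  "cong_mod M N x y \<longleftrightarrow> x \<in> carrier M \<and> y \<in> carrier M \<and> x \<ominus>\<^bsub>M\<^esub> y \<in> N"

abbreviation sum_of :: "('a, 'b, 'm) module_scheme \<Rightarrow> 'b set \<Rightarrow> 'b set \<Rightarrow> 'b set" where
  "sum_of M N L \<equiv> {x \<oplus>\<^bsub>M\<^esub> y | x y. x \<in> N \<and> y \<in> L}"

context module
begin

lemma cong_mod_refl: "submodule N R M \<Longrightarrow> x \<in> carrier M \<Longrightarrow> cong_mod M N x x"
  by (simp add: cong_mod_def diff_self submodule_zero)

lemma cong_mod_sym: "submodule N R M \<Longrightarrow> cong_mod M N x y \<Longrightarrow> cong_mod M N y x"
  unfolding cong_mod_def by (metis minus_diff submodule_minus)

lemma cong_mod_trans [trans]: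
  "submodule N R M \<Longrightarrow> cong_mod M N x y \<Longrightarrow> cong_mod M N y z \<Longrightarrow> cong_mod M N x z"
  unfolding cong_mod_def by (metis diff_add_diff submodule_add)

lemma cong_mod_add:
  "submodule N R M \<Longrightarrow> cong_mod M N x y \<Longrightarrow> cong_mod M N u v
     \<Longrightarrow> cong_mod M N (x \<oplus>\<^bsub>M\<^esub> u) (y \<oplus>\<^bsub>M\<^esub> v)"
  unfolding cong_mod_def by (simp add: add_diff_add submodule_add)

lemma cong_mod_smult:
  "submodule N R M \<Longrightarrow> r \<in> carrier R \<Longrightarrow> cong_mod M N x y \<Longrightarrow> cong_mod M N (r \<odot>\<^bsub>M\<^esub> x) (r \<odot>\<^bsub>M\<^esub> y)"
  unfolding cong_mod_def by (metis smult_diff submodule_smult smult_closed)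

lemma cong_mod_minus:
  "submodule N R M \<Longrightarrow> cong_mod M N x y \<Longrightarrow> cong_mod M N (\<ominus>\<^bsub>M\<^esub> x) (\<ominus>\<^bsub>M\<^esub> y)"
  unfolding cong_mod_def a_minus_def
  by (metis M.add.inv_closed M.minus_add submodule_minus)

lemma cong_mod_diff:
  "submodule N R M \<Longrightarrow> cong_mod M N x y \<Longrightarrow> cong_mod M N u v
     \<Longrightarrow> cong_mod M N (x \<ominus>\<^bsub>M\<^esub> u) (y \<ominus>\<^bsub>M\<^esub> v)"
  unfolding a_minus_def by (intro cong_mod_add cong_mod_minus)

lemma cong_mod_zero: "x \<in> carrier M \<Longrightarrow> cong_mod M N x \<zero>\<^bsub>M\<^esub> \<longleftrightarrow> x \<in> N"
  by (simp add: cong_mod_def diff_zero)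

lemma cong_mod_mem: "submodule N R M \<Longrightarrow> cong_mod M N x y \<Longrightarrow> x \<in> N \<longleftrightarrow> y \<in> N"
  by (metis cong_mod_def cong_mod_sym cong_mod_trans cong_mod_zero M.zero_closed)

lemma cong_mod_mono: "cong_mod M N x y \<Longrightarrow> N \<subseteq> L \<Longrightarrow> cong_mod M L x y"
  by (auto simp: cong_mod_def)

lemma cong_mod_restrict:
  assumes "submodule L R M"
  shows "cong_mod (M\<lparr>carrier := L\<rparr>) N x y \<longleftrightarrow> x \<in> L \<and> y \<in> L \<and> cong_mod M N x y"
proof -
  have L: "module R (M\<lparr>carrier := L\<rparr>)"
    using assms module_axioms by (rule submodule.submodule_is_module)
  \<comment> \<open>Negation in a record refers to its carrier; linearity of the inclusion shows that it does not change.\<close>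
  have incl: "linear_map R (M\<lparr>carrier := L\<rparr>) M (\<lambda>x. x)"
    using submodule_closed[OF assms] by (auto simp: linear_map_def)
  show ?thesis
    using linear_map_diff[OF L module_axioms incl, of x y] submodule_closed[OF assms]
    by (auto simp: cong_mod_def)
qed

lemma submodule_preimage:
  assumes "module R B" "linear_map R M B g" "submodule N R B"
  shows "submodule {x \<in> carrier M. g x \<in> N} R M"
proof -
  interpret B: module R B by fact
  show ?thesis
    using assms by (intro submodule_by_smult)
      (auto simp: linear_map_add linear_map_smult B.submodule_add B.submodule_smult
        B.submodule_zero linear_map_zero[OF module_axioms])
qed

lemma submodule_image:
  assumes "module R B" "linear_map R M B g" "submodule N R M"
  shows "submodule (g ` N) R B"
proof -
  interpret B: module R B by fact
  show ?thesis
  proof (rule B.submodule_by_smult)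
    show "g ` N \<subseteq> carrier B" using assms by (auto dest: submodule_closed linear_map_closed)
    show "\<zero>\<^bsub>B\<^esub> \<in> g ` N"
      using linear_map_zero[OF module_axioms assms(1,2)] submodule_zero[OF assms(3)] by force
    fix x y assume "x \<in> g ` N" "y \<in> g ` N"
    then obtain u v where "u \<in> N" "v \<in> N" "x = g u" "y = g v" by auto
    then show "x \<oplus>\<^bsub>B\<^esub> y \<in> g ` N"
      using assms linear_map_add[OF assms(2), of u v] submodule_add[OF assms(3), of u v]
        submodule_closed[OF assms(3)] by (metis imageI)
  next
    fix r x assume "r \<in> carrier R" "x \<in> g ` N"
    then obtain u where "u \<in> N" "x = g u" by auto
    then show "r \<odot>\<^bsub>B\<^esub> x \<in> g ` N"
      using assms linear_map_smult[OF assms(2), of r u] submodule_smult[OF assms(3), of r u]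
        submodule_closed[OF assms(3)] \<open>r \<in> carrier R\<close> by (metis imageI)
  qed
qed

lemma submodule_sum:
  assumes "submodule N R M" "submodule L R M"
  shows "submodule (sum_of M N L) R M"
proof (rule submodule_by_smult)
  show "(sum_of M N L) \<subseteq> carrier M"
    using assms by (auto dest: submodule_closed)
  show "\<zero>\<^bsub>M\<^esub> \<in> (sum_of M N L)"
    using submodule_zero[OF assms(1)] submodule_zero[OF assms(2)] by force
  fix a b assume "a \<in> (sum_of M N L)" "b \<in> (sum_of M N L)"
  then obtain x y u v where *: "a = x \<oplus>\<^bsub>M\<^esub> y" "b = u \<oplus>\<^bsub>M\<^esub> v" "x \<in> N" "u \<in> N" "y \<in> L" "v \<in> L" by auto
  then have "a \<oplus>\<^bsub>M\<^esub> b = (x \<oplus>\<^bsub>M\<^esub> u) \<oplus>\<^bsub>M\<^esub> (y \<oplus>\<^bsub>M\<^esub> v)"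
    using assms by (simp add: M.a_ac submodule_closed)
  then show "a \<oplus>\<^bsub>M\<^esub> b \<in> (sum_of M N L)"
    using * assms by (blast intro: submodule_add)
next
  fix r a assume r: "r \<in> carrier R" and "a \<in> (sum_of M N L)"
  then obtain x y where *: "a = x \<oplus>\<^bsub>M\<^esub> y" "x \<in> N" "y \<in> L" by auto
  then have "r \<odot>\<^bsub>M\<^esub> a = r \<odot>\<^bsub>M\<^esub> x \<oplus>\<^bsub>M\<^esub> r \<odot>\<^bsub>M\<^esub> y"
    using assms r by (simp add: smult_r_distr submodule_closed)
  then show "r \<odot>\<^bsub>M\<^esub> a \<in> (sum_of M N L)"
    using * assms r by (blast intro: submodule_smult)
qed

lemma submodule_sum_upper:
  assumes "submodule N R M" "submodule L R M"
  shows "N \<subseteq> (sum_of M N L)" and "L \<subseteq> (sum_of M N L)"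
proof -
  show "N \<subseteq> (sum_of M N L)"
  proof
    fix x assume "x \<in> N"
    then have "x = x \<oplus>\<^bsub>M\<^esub> \<zero>\<^bsub>M\<^esub>" using submodule_closed[OF assms(1)] by simp
    then show "x \<in> (sum_of M N L)"
      using \<open>x \<in> N\<close> submodule_zero[OF assms(2)] by blast
  qed
  show "L \<subseteq> (sum_of M N L)"
  proof
    fix x assume "x \<in> L"
    then have "x = \<zero>\<^bsub>M\<^esub> \<oplus>\<^bsub>M\<^esub> x" using submodule_closed[OF assms(2)] by simp
    then show "x \<in> (sum_of M N L)"
      using \<open>x \<in> L\<close> submodule_zero[OF assms(1)] by blast
  qed
qed

lemma submodule_of_submodule:
  assumes "submodule L R M" "submodule N R M" "N \<subseteq> L"
  shows "submodule N R (M\<lparr>carrier := L\<rparr>)"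
proof -
  interpret L: module R "M\<lparr>carrier := L\<rparr>"
    using assms(1) module_axioms by (rule submodule.submodule_is_module)
  show ?thesis
    using assms by (intro L.submodule_by_smult)
      (auto simp: submodule_add submodule_smult submodule_zero)
qed

end

lemma linear_map_add_maps:
  assumes "module R B" "linear_map R A B f" "linear_map R A B g"
  shows "linear_map R A B (\<lambda>x. f x \<oplus>\<^bsub>B\<^esub> g x)"
proof -
  interpret B: module R B by fact
  show ?thesis using assms(2,3)
    by (auto simp: linear_map_def B.a_ac B.smult_r_distr)
qed

lemma linear_map_smult_map:
  assumes "module R B" "linear_map R A B f" "r \<in> carrier R"
  shows "linear_map R A B (\<lambda>x. r \<odot>\<^bsub>B\<^esub> f x)"
proof -
  interpret B: module R B by fact
  show ?thesis using assms(2,3)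
    by (auto simp: linear_map_def B.smult_r_distr B.smult_assoc1[symmetric] B.R.m_comm)
qed

lemma linear_map_diff_maps:
  assumes "module R B" "linear_map R A B f" "linear_map R A B g"
  shows "linear_map R A B (\<lambda>x. f x \<ominus>\<^bsub>B\<^esub> g x)"
proof -
  interpret B: module R B by fact
  show ?thesis using assms(2,3)
    by (auto simp: linear_map_def B.add_diff_add B.smult_diff)
qed

section \<open>Quotient and free modules\<close>

text \<open>
  The module axioms pass along a map that respects all operations; this spares checking them on
  cosets.
\<close>

lemma module_of_surjection:
  assumes "module R M" "carrier Q = f ` carrier M" "\<zero>\<^bsub>Q\<^esub> = f \<zero>\<^bsub>M\<^esub>"
    and add: "\<And>x y. x \<in> carrier M \<Longrightarrow> y \<in> carrier M \<Longrightarrow> f x \<oplus>\<^bsub>Q\<^esub> f y = f (x \<oplus>\<^bsub>M\<^esub> y)"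
    and smult: "\<And>r x. r \<in> carrier R \<Longrightarrow> x \<in> carrier M \<Longrightarrow> r \<odot>\<^bsub>Q\<^esub> f x = f (r \<odot>\<^bsub>M\<^esub> x)"
  shows "module R Q"
proof -
  interpret M: module R M by fact
  show ?thesis
  proof (rule moduleI)
    show "cring R" by (rule M.R.is_cring)
    show "abelian_group Q"
    proof (rule abelian_groupI)
      fix x assume "x \<in> carrier Q"
      then obtain u where u: "u \<in> carrier M" "x = f u" using assms(2) by auto
      then have "f (\<ominus>\<^bsub>M\<^esub> u) \<oplus>\<^bsub>Q\<^esub> x = \<zero>\<^bsub>Q\<^esub>" by (simp add: add assms(3) M.M.l_neg)
      then show "\<exists>y\<in>carrier Q. y \<oplus>\<^bsub>Q\<^esub> x = \<zero>\<^bsub>Q\<^esub>" using u assms(2) by auto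
    qed (auto simp: assms(2,3) add M.M.a_ac)
  qed (auto simp: assms(2) add smult M.smult_l_distr M.smult_r_distr M.smult_assoc1)
qed

context module
begin

lemma a_r_coset_iff_cong_mod:
  assumes "submodule N R M" "x \<in> carrier M"
  shows "y \<in> N +>\<^bsub>M\<^esub> x \<longleftrightarrow> cong_mod M N y x"
proof
  assume "y \<in> N +>\<^bsub>M\<^esub> x"
  then obtain n where "n \<in> N" "y = n \<oplus>\<^bsub>M\<^esub> x" by (auto simp: a_r_coset_def')
  then show "cong_mod M N y x"
    using assms submodule_closed[OF assms(1)] by (simp add: cong_mod_def add_diff_cancel')
next
  assume "cong_mod M N y x"
  then show "y \<in> N +>\<^bsub>M\<^esub> x"
    unfolding cong_mod_def a_r_coset_def' by (metis UN_I add_diff_cancel'(1) singletonI)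
qed

lemma a_r_coset_eq_iff:
  assumes "submodule N R M" "x \<in> carrier M" "y \<in> carrier M"
  shows "N +>\<^bsub>M\<^esub> x = N +>\<^bsub>M\<^esub> y \<longleftrightarrow> cong_mod M N x y"
proof
  assume "N +>\<^bsub>M\<^esub> x = N +>\<^bsub>M\<^esub> y"
  then have "x \<in> N +>\<^bsub>M\<^esub> y"
    using a_r_coset_iff_cong_mod[OF assms(1,2), of x] cong_mod_refl assms by auto
  then show "cong_mod M N x y" using a_r_coset_iff_cong_mod assms by auto
next
  assume "cong_mod M N x y"
  then show "N +>\<^bsub>M\<^esub> x = N +>\<^bsub>M\<^esub> y"
    using a_r_coset_iff_cong_mod[OF assms(1)] assms cong_mod_trans[OF assms(1)]
      cong_mod_sym[OF assms(1)] by blast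
qed

lemma a_r_coset_zero: "submodule N R M \<Longrightarrow> N +>\<^bsub>M\<^esub> \<zero>\<^bsub>M\<^esub> = N"
  using a_r_coset_iff_cong_mod[of N "\<zero>\<^bsub>M\<^esub>"] cong_mod_zero submodule_closed
  by (metis M.zero_closed cong_mod_def subsetI subset_antisym)

lemma quot_module_carrier: "carrier (quot_module M N) = (\<lambda>x. N +>\<^bsub>M\<^esub> x) ` carrier M"
  by (auto simp: quot_module_def A_RCOSETS_def')

lemma quot_module_zero: "\<zero>\<^bsub>quot_module M N\<^esub> = N"
  by (simp add: quot_module_def)

lemma quot_module_add:
  assumes "submodule N R M" "x \<in> carrier M" "y \<in> carrier M"
  shows "(N +>\<^bsub>M\<^esub> x) \<oplus>\<^bsub>quot_module M N\<^esub> (N +>\<^bsub>M\<^esub> y) = N +>\<^bsub>M\<^esub> (x \<oplus>\<^bsub>M\<^esub> y)"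
proof -
  have "additive_subgroup N M"
    using assms(1) by (simp add: additive_subgroup_def submodule_def)
  then have "abelian_subgroup N M"
    using M.abelian_group_axioms by (rule abelian_subgroupI3)
  then show ?thesis
    using assms by (simp add: quot_module_def abelian_subgroup.a_rcos_sum)
qed

lemma UN_const_coset:
  assumes "submodule N R M" "x \<in> carrier M" "\<And>y. cong_mod M N y x \<Longrightarrow> F y = F x"
  shows "(\<Union>y\<in>N +>\<^bsub>M\<^esub> x. F y) = F x"
proof -
  have "x \<in> N +>\<^bsub>M\<^esub> x" "F y = F x" if "y \<in> N +>\<^bsub>M\<^esub> x" for y
    using that assms(3) a_r_coset_iff_cong_mod[OF assms(1,2)] cong_mod_refl[OF assms(1,2)] by blast+
  then show ?thesis
    using a_r_coset_iff_cong_mod[OF assms(1,2)] cong_mod_refl[OF assms(1,2)] by blast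
qed

lemma quot_module_smult:
  assumes "submodule N R M" "r \<in> carrier R" "x \<in> carrier M"
  shows "r \<odot>\<^bsub>quot_module M N\<^esub> (N +>\<^bsub>M\<^esub> x) = N +>\<^bsub>M\<^esub> (r \<odot>\<^bsub>M\<^esub> x)"
proof -
  have "N +>\<^bsub>M\<^esub> (r \<odot>\<^bsub>M\<^esub> y) = N +>\<^bsub>M\<^esub> (r \<odot>\<^bsub>M\<^esub> x)" if y: "cong_mod M N y x" for y
  proof -
    have "y \<in> carrier M" using y by (simp add: cong_mod_def)
    then show ?thesis
      using cong_mod_smult[OF assms(1,2) y] a_r_coset_eq_iff[OF assms(1)] assms(2,3) by simp
  qed
  then have "(\<Union>y\<in>N +>\<^bsub>M\<^esub> x. N +>\<^bsub>M\<^esub> (r \<odot>\<^bsub>M\<^esub> y)) = N +>\<^bsub>M\<^esub> (r \<odot>\<^bsub>M\<^esub> x)"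
    by (rule UN_const_coset[OF assms(1,3)])
  then show ?thesis by (simp add: quot_module_def)
qed

lemma quot_module_is_module:
  assumes "submodule N R M"
  shows "module R (quot_module M N)"
  by (rule module_of_surjection[OF module_axioms quot_module_carrier])
    (simp_all add: assms quot_module_add quot_module_smult quot_module_zero a_r_coset_zero)

lemma quot_map_linear:
  assumes "submodule N R M"
  shows "linear_map R M (quot_module M N) (\<lambda>x. N +>\<^bsub>M\<^esub> x)"
  using assms by (auto simp: linear_map_def quot_module_carrier quot_module_add quot_module_smult)

end

lemma self_module_simps [simp]:
  "carrier (self_module R) = carrier R" "\<zero>\<^bsub>self_module R\<^esub> = \<zero>\<^bsub>R\<^esub>"
  "x \<oplus>\<^bsub>self_module R\<^esub> y = x \<oplus>\<^bsub>R\<^esub> y" "r \<odot>\<^bsub>self_module R\<^esub> x = r \<otimes>\<^bsub>R\<^esub> x"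
  "a_r_coset (self_module R) I x = a_r_coset R I x"
  by (simp_all add: self_module_def a_r_coset_def')

lemma self_module_a_inv [simp]: "a_inv (self_module R) = a_inv R"
  by (simp add: self_module_def a_inv_def m_inv_def fun_eq_iff)

lemma (in cring) self_module_is_module: "module R (self_module R)"
  by (rule moduleI) (auto intro!: is_cring abelian_groupI simp: a_ac l_distr r_distr m_assoc intro: l_neg a_inv_closed)

lemma (in cring) submodule_self_iff_ideal: "submodule I R (self_module R) \<longleftrightarrow> ideal I R"
proof
  interpret S: module R "self_module R" by (rule self_module_is_module)
  assume I: "submodule I R (self_module R)"
  have "subgroup I (add_monoid R)"
    using S.submodule_subset[OF I] S.submodule_add[OF I] S.submodule_zero[OF I]
      S.submodule_minus[OF I]
    by (intro subgroup.intro) (auto simp: a_inv_def[symmetric])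
  then show "ideal I R"
    using S.submodule_smult[OF I] S.submodule_closed[OF I]
    by (auto intro!: idealI ring_axioms) (metis m_comm)
next
  interpret S: module R "self_module R" by (rule self_module_is_module)
  assume "ideal I R"
  then interpret ideal I R .
  show "submodule I R (self_module R)"
    by (rule S.submodule_by_smult) (auto intro: I_l_closed)
qed

lemma free_module_simps:
  "carrier (free_module R n) = {..<n} \<rightarrow>\<^sub>E carrier R"
  "\<zero>\<^bsub>free_module R n\<^esub> = (\<lambda>j\<in>{..<n}. \<zero>\<^bsub>R\<^esub>)"
  "u \<oplus>\<^bsub>free_module R n\<^esub> v = (\<lambda>j\<in>{..<n}. u j \<oplus>\<^bsub>R\<^esub> v j)"
  "r \<odot>\<^bsub>free_module R n\<^esub> u = (\<lambda>j\<in>{..<n}. r \<otimes>\<^bsub>R\<^esub> u j)"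
  by (simp_all add: free_module_def)

definition unit_vector :: "('a, 'r) ring_scheme \<Rightarrow> nat \<Rightarrow> nat \<Rightarrow> nat \<Rightarrow> 'a" where
  "unit_vector R n k = (\<lambda>j\<in>{..<n}. if j = k then \<one>\<^bsub>R\<^esub> else \<zero>\<^bsub>R\<^esub>)"

text \<open>
  Building a vector up coordinate by coordinate gives an induction principle for free modules.
\<close>

definition head_vector :: "('a, 'r) ring_scheme \<Rightarrow> nat \<Rightarrow> nat \<Rightarrow> (nat \<Rightarrow> 'a) \<Rightarrow> nat \<Rightarrow> 'a" where
  "head_vector R n k f = (\<lambda>j\<in>{..<n}. if j < k then f j else \<zero>\<^bsub>R\<^esub>)"

context cring
begin

lemma free_module_is_module: "module R (free_module R n)"
proof (rule moduleI)
  show "abelian_group (free_module R n)"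
  proof (rule abelian_groupI)
    fix x assume x: "x \<in> carrier (free_module R n)"
    then have "(\<lambda>j\<in>{..<n}. \<ominus> x j) \<oplus>\<^bsub>free_module R n\<^esub> x = \<zero>\<^bsub>free_module R n\<^esub>"
      by (auto simp: free_module_simps PiE_iff l_neg)
    moreover have "(\<lambda>j\<in>{..<n}. \<ominus> x j) \<in> carrier (free_module R n)"
      using x by (auto simp: free_module_simps PiE_iff)
    ultimately show "\<exists>y\<in>carrier (free_module R n). y \<oplus>\<^bsub>free_module R n\<^esub> x = \<zero>\<^bsub>free_module R n\<^esub>"
      by blast
  qed (auto simp: free_module_simps PiE_iff fun_eq_iff extensional_def a_ac)
qed (auto simp: free_module_simps is_cring PiE_iff fun_eq_iff extensional_def l_distr r_distr m_assoc)

lemma unit_vector_closed [simp]: "unit_vector R n k \<in> carrier (free_module R n)"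
  by (simp add: unit_vector_def free_module_simps)

lemma head_vector_0: "head_vector R n 0 f = \<zero>\<^bsub>free_module R n\<^esub>"
  by (simp add: head_vector_def free_module_simps)

lemma head_vector_self: "f \<in> carrier (free_module R n) \<Longrightarrow> head_vector R n n f = f"
  by (auto simp: free_module_simps head_vector_def PiE_iff extensional_def fun_eq_iff)

lemma head_vector_closed:
  "f \<in> carrier (free_module R n) \<Longrightarrow> head_vector R n k f \<in> carrier (free_module R n)"
  by (auto simp: free_module_simps head_vector_def PiE_iff)

lemma head_vector_Suc:
  assumes "f \<in> carrier (free_module R n)" "k < n"
  shows "head_vector R n (Suc k) f =
    head_vector R n k f \<oplus>\<^bsub>free_module R n\<^esub> f k \<odot>\<^bsub>free_module R n\<^esub> unit_vector R n k"
proof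
  fix j
  show "head_vector R n (Suc k) f j =
    (head_vector R n k f \<oplus>\<^bsub>free_module R n\<^esub> f k \<odot>\<^bsub>free_module R n\<^esub> unit_vector R n k) j"
    using assms
    by (cases "j = k") (auto simp: free_module_simps head_vector_def unit_vector_def PiE_iff less_Suc_eq)
qed

lemma free_module_mem_submodule:
  assumes "submodule N R (free_module R n)" "f \<in> carrier (free_module R n)"
    and "\<And>k. k < n \<Longrightarrow> f k \<odot>\<^bsub>free_module R n\<^esub> unit_vector R n k \<in> N"
  shows "f \<in> N"
proof -
  interpret F: module R "free_module R n" by (rule free_module_is_module)
  have "k \<le> n \<Longrightarrow> head_vector R n k f \<in> N" for k
  proof (induction k)
    case 0
    show ?case using F.submodule_zero[OF assms(1)] by (simp only: head_vector_0)
  next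
    case (Suc k)
    then have "k < n" "head_vector R n k f \<in> N" by auto
    with F.submodule_add[OF assms(1)] assms(3) show ?case
      by (simp only: head_vector_Suc[OF assms(2)])
  qed
  from this[of n] show ?thesis using head_vector_self[OF assms(2)] by simp
qed

lemma free_module_linear_extension:
  assumes "module R A" and a: "\<And>j. j < n \<Longrightarrow> a j \<in> carrier A"
  obtains g where "linear_map R (free_module R n) A g"
    and "\<And>f k. f \<in> carrier (free_module R n) \<Longrightarrow> g f = (\<Oplus>\<^bsub>A\<^esub>j\<in>{..<n}. f j \<odot>\<^bsub>A\<^esub> a j)"
proof
  interpret A: module R A by fact
  let ?g = "\<lambda>f. \<Oplus>\<^bsub>A\<^esub>j\<in>{..<n}. f j \<odot>\<^bsub>A\<^esub> a j"
  show "linear_map R (free_module R n) A ?g"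
    unfolding linear_map_def
  proof (intro conjI ballI)
    fix x assume x: "x \<in> carrier (free_module R n)"
    then show "?g x \<in> carrier A" using a by (auto intro!: A.finsum_closed simp: free_module_simps)
    fix y assume y: "y \<in> carrier (free_module R n)"
    have "?g (x \<oplus>\<^bsub>free_module R n\<^esub> y) = (\<Oplus>\<^bsub>A\<^esub>j\<in>{..<n}. x j \<odot>\<^bsub>A\<^esub> a j \<oplus>\<^bsub>A\<^esub> y j \<odot>\<^bsub>A\<^esub> a j)"
      using x y a by (intro A.finsum_cong') (auto simp: free_module_simps A.smult_l_distr PiE_iff)
    also have "\<dots> = ?g x \<oplus>\<^bsub>A\<^esub> ?g y"
      using x y a by (intro A.finsum_addf) (auto simp: free_module_simps PiE_iff)
    finally show "?g (x \<oplus>\<^bsub>free_module R n\<^esub> y) = ?g x \<oplus>\<^bsub>A\<^esub> ?g y" .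
  next
    fix r x assume r: "r \<in> carrier R" and x: "x \<in> carrier (free_module R n)"
    have "?g (r \<odot>\<^bsub>free_module R n\<^esub> x) = (\<Oplus>\<^bsub>A\<^esub>j\<in>{..<n}. r \<odot>\<^bsub>A\<^esub> (x j \<odot>\<^bsub>A\<^esub> a j))"
      using r x a by (intro A.finsum_cong') (auto simp: free_module_simps A.smult_assoc1 PiE_iff)
    also have "\<dots> = r \<odot>\<^bsub>A\<^esub> ?g x"
      using r x a by (subst A.finsum_smult_ldistr) (auto simp: free_module_simps PiE_iff)
    finally show "?g (r \<odot>\<^bsub>free_module R n\<^esub> x) = r \<odot>\<^bsub>A\<^esub> ?g x" .
  qed
qed auto

text \<open>
  Projectivity of free modules, in the form of a choice principle: a linear relation that is total on
  a free module contains the graph of a linear map, namely of the one that takes each basis vector to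
  some element related to it. Liftings along surjections, along maps onto a kernel and modulo a
  submodule are all instances.
\<close>

lemma free_module_linear_choice:
  assumes A: "module R A"
    and total: "\<And>f. f \<in> carrier (free_module R n) \<Longrightarrow> \<exists>a\<in>carrier A. T f a"
    and add: "\<And>f f' a a'. f \<in> carrier (free_module R n) \<Longrightarrow> f' \<in> carrier (free_module R n) \<Longrightarrow>
        a \<in> carrier A \<Longrightarrow> a' \<in> carrier A \<Longrightarrow> T f a \<Longrightarrow> T f' a' \<Longrightarrow>
        T (f \<oplus>\<^bsub>free_module R n\<^esub> f') (a \<oplus>\<^bsub>A\<^esub> a')"
    and smult: "\<And>r f a. r \<in> carrier R \<Longrightarrow> f \<in> carrier (free_module R n) \<Longrightarrow>
        a \<in> carrier A \<Longrightarrow> T f a \<Longrightarrow> T (r \<odot>\<^bsub>free_module R n\<^esub> f) (r \<odot>\<^bsub>A\<^esub> a)"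
  obtains g where "linear_map R (free_module R n) A g"
    and "\<And>f. f \<in> carrier (free_module R n) \<Longrightarrow> T f (g f)"
proof -
  interpret A: module R A by fact
  interpret F: module R "free_module R n" by (rule free_module_is_module)
  let ?F = "free_module R n"
  define a where "a j = (SOME x. x \<in> carrier A \<and> T (unit_vector R n j) x)" for j
  have a: "a j \<in> carrier A \<and> T (unit_vector R n j) (a j)" for j
    unfolding a_def by (rule someI_ex) (use total unit_vector_closed in blast)
  obtain g where g: "linear_map R ?F A g"
    and g_eq: "\<And>f. f \<in> carrier ?F \<Longrightarrow> g f = (\<Oplus>\<^bsub>A\<^esub>j\<in>{..<n}. f j \<odot>\<^bsub>A\<^esub> a j)"
    using free_module_linear_extension[OF A, of n a] a by metis
  have "T f (g f)" if f: "f \<in> carrier ?F" for f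
  proof -
    have fk: "f k \<in> carrier R" if "k < n" for k
      using f that by (auto simp: free_module_simps PiE_iff)
    have "k \<le> n \<Longrightarrow> T (head_vector R n k f) (\<Oplus>\<^bsub>A\<^esub>j\<in>{..<k}. f j \<odot>\<^bsub>A\<^esub> a j)" for k
    proof (induction k)
      case 0
      \<comment> \<open>A total relation closed under scalars relates zero to zero.\<close>
      obtain b where b: "b \<in> carrier A" "T f b" using total f by auto
      have "T (\<zero> \<odot>\<^bsub>?F\<^esub> f) (\<zero> \<odot>\<^bsub>A\<^esub> b)" using f b by (intro smult) auto
      then show ?case
        using F.smult_l_null[OF f] A.smult_l_null[OF b(1)] by (simp only: head_vector_0) simp
    next
      case (Suc k)
      have "T (head_vector R n k f \<oplus>\<^bsub>?F\<^esub> f k \<odot>\<^bsub>?F\<^esub> unit_vector R n k)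
          ((\<Oplus>\<^bsub>A\<^esub>j\<in>{..<k}. f j \<odot>\<^bsub>A\<^esub> a j) \<oplus>\<^bsub>A\<^esub> f k \<odot>\<^bsub>A\<^esub> a k)"
        using Suc a fk f
        by (intro add smult head_vector_closed F.smult_closed A.smult_closed A.finsum_closed
            unit_vector_closed) auto
      moreover have "(\<Oplus>\<^bsub>A\<^esub>j\<in>{..<Suc k}. f j \<odot>\<^bsub>A\<^esub> a j) =
          (\<Oplus>\<^bsub>A\<^esub>j\<in>{..<k}. f j \<odot>\<^bsub>A\<^esub> a j) \<oplus>\<^bsub>A\<^esub> f k \<odot>\<^bsub>A\<^esub> a k"
        unfolding lessThan_Suc using Suc.prems a fk
        by (subst A.finsum_insert) (auto simp: A.M.a_comm)
      ultimately show ?case using Suc.prems by (simp only: head_vector_Suc[OF f])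
    qed
    from this[of n] show ?thesis using head_vector_self[OF f] g_eq[OF f] by simp
  qed
  then show thesis using that g by blast
qed

lemma free_module_ideal_submodule:
  assumes "ideal J R"
  shows "submodule ({..<n} \<rightarrow>\<^sub>E J) R (free_module R n)"
proof -
  interpret F: module R "free_module R n" by (rule free_module_is_module)
  interpret J: ideal J R by fact
  show ?thesis
    using J.a_subset by (intro F.submodule_by_smult) (auto simp: free_module_simps PiE_iff J.I_l_closed)
qed

lemma free_module_ideal_subset:
  assumes "submodule N R (free_module R n)" "J \<subseteq> carrier R"
    and "\<And>r f. r \<in> J \<Longrightarrow> f \<in> carrier (free_module R n) \<Longrightarrow> r \<odot>\<^bsub>free_module R n\<^esub> f \<in> N"
  shows "({..<n} \<rightarrow>\<^sub>E J) \<subseteq> N"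
proof
  fix f assume "f \<in> {..<n} \<rightarrow>\<^sub>E J"
  then show "f \<in> N"
    using assms(2) free_module_mem_submodule[OF assms(1), of f] assms(3)[OF _ unit_vector_closed]
    by (auto simp: free_module_simps(1) PiE_iff)
qed

end

section \<open>Noetherian rings\<close>

locale noetherian_cring = noetherian_ring R + cring R for R (structure)

lemma (in cring) coordinate_linear:
  "k < n \<Longrightarrow> linear_map R (free_module R n) (self_module R) (\<lambda>f. f k)"
  by (auto simp: linear_map_def free_module_simps PiE_iff)

lemma (in module) submodule_Int:
  assumes "submodule N R M" "submodule L R M"
  shows "submodule (N \<inter> L) R M"
  using assms by (intro submodule_by_smult)
    (auto simp: submodule_closed submodule_add submodule_smult submodule_zero)

context noetherian_cring
begin

text \<open>
  The usual induction for submodules of \<open>R\<^sup>n\<close>, by the number \<open>k\<close> of coordinates that may be nonzero: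
  the \<open>k\<close>-th coordinates form an ideal, and subtracting a combination of elements
  that generate it leads to vectors with one coordinate less. That \<open>S\<close> generates \<open>N\<close> is expressed by
  minimality, which needs no linear combinations.
\<close>

lemma free_module_submodule_fg_aux:
  assumes "k \<le> n" "submodule N R (free_module R n)" "\<And>f j. f \<in> N \<Longrightarrow> k \<le> j \<Longrightarrow> j < n \<Longrightarrow> f j = \<zero>"
  shows "\<exists>S. finite S \<and> S \<subseteq> N \<and> (\<forall>L. submodule L R (free_module R n) \<longrightarrow> S \<subseteq> L \<longrightarrow> N \<subseteq> L)"
  using assms
proof (induction k arbitrary: N)
  case 0
  interpret F: module R "free_module R n" by (rule free_module_is_module)
  have "f = \<zero>\<^bsub>free_module R n\<^esub>" if "f \<in> N" for f
  proof -
    have "f \<in> carrier (free_module R n)" using F.submodule_closed[OF 0(2) that] .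
    then show ?thesis
      using 0(3)[OF that] by (auto simp: free_module_simps PiE_iff extensional_def fun_eq_iff)
  qed
  then show ?case using F.submodule_zero by (intro exI[of _ "{}"]) blast
next
  case (Suc k)
  let ?F = "free_module R n"
  interpret F: module R ?F by (rule free_module_is_module)
  interpret S: module R "self_module R" by (rule self_module_is_module)
  have coord: "linear_map R ?F (self_module R) (\<lambda>f. f k)"
    using Suc.prems(1) by (intro coordinate_linear) auto
  define N0 where "N0 = N \<inter> {f \<in> carrier ?F. f k \<in> {\<zero>}}"
  have N0: "submodule N0 R ?F"
    unfolding N0_def
    using F.submodule_Int[OF Suc.prems(2) F.submodule_preimage[OF self_module_is_module coord S.zero_submodule]]
    by simp
  have "f j = \<zero>" if "f \<in> N0" "k \<le> j" "j < n" for f j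
    using that Suc.prems(3)[of f j] by (cases "j = k") (auto simp: N0_def)
  with Suc.IH[OF _ N0] Suc.prems(1) obtain S0 where S0: "finite S0" "S0 \<subseteq> N0"
    and S0_gen: "\<And>L. submodule L R ?F \<Longrightarrow> S0 \<subseteq> L \<Longrightarrow> N0 \<subseteq> L"
    by auto
  have idl: "ideal ((\<lambda>f. f k) ` N) R"
    using F.submodule_image[OF self_module_is_module coord Suc.prems(2)]
    by (simp only: submodule_self_iff_ideal)
  obtain A where A: "finite A" "A \<subseteq> carrier R" "(\<lambda>f. f k) ` N = Idl A"
    using finetely_gen[OF idl] by blast
  have "\<forall>a\<in>A. \<exists>f\<in>N. f k = a"
    using genideal_self[OF A(2)] A(3) by (metis (no_types, lifting) imageE subsetD)
  then obtain s where s: "\<And>a. a \<in> A \<Longrightarrow> s a \<in> N \<and> s a k = a" by metis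
  have "N \<subseteq> L" if L: "submodule L R ?F" and sub: "S0 \<union> s ` A \<subseteq> L" for L
  proof
    fix f assume f: "f \<in> N"
    have NL: "submodule (N \<inter> L) R ?F" using Suc.prems(2) L by (rule F.submodule_Int)
    have "ideal ((\<lambda>f. f k) ` (N \<inter> L)) R"
      using F.submodule_image[OF self_module_is_module coord NL]
      by (simp only: submodule_self_iff_ideal)
    moreover have "A \<subseteq> (\<lambda>f. f k) ` (N \<inter> L)"
    proof
      fix a assume "a \<in> A"
      then have "s a \<in> N \<inter> L" "a = s a k" using s sub by auto
      then show "a \<in> (\<lambda>f. f k) ` (N \<inter> L)" by blast
    qed
    ultimately have "Idl A \<subseteq> (\<lambda>f. f k) ` (N \<inter> L)" by (rule genideal_minimal)
    then obtain g where g: "g \<in> N" "g \<in> L" "f k = g k" using f A(3) by blast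
    have carr: "f \<in> carrier ?F" "g \<in> carrier ?F" using F.submodule_closed[OF Suc.prems(2)] f g by auto
    have fg: "f \<ominus>\<^bsub>?F\<^esub> g \<in> N" using F.submodule_diff[OF Suc.prems(2) f g(1)] .
    have "(f \<ominus>\<^bsub>?F\<^esub> g) k = f k \<ominus>\<^bsub>self_module R\<^esub> g k"
      using linear_map_diff[OF F.module_axioms self_module_is_module coord carr] .
    also have "\<dots> = \<zero>"
      using S.diff_self[of "g k"] g(3) linear_map_closed[OF coord carr(2)] by simp
    finally have "f \<ominus>\<^bsub>?F\<^esub> g \<in> N0" using fg carr by (auto simp: N0_def)
    then have "f \<ominus>\<^bsub>?F\<^esub> g \<in> L" using S0_gen[OF L] sub by auto
    then have "(f \<ominus>\<^bsub>?F\<^esub> g) \<oplus>\<^bsub>?F\<^esub> g \<in> L" using g(2) F.submodule_add[OF L] by auto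
    then show "f \<in> L" using F.add_diff_cancel'(1)[OF carr] by simp
  qed
  moreover have "finite (S0 \<union> s ` A)" "S0 \<union> s ` A \<subseteq> N" using S0 A s by (auto simp: N0_def)
  ultimately show ?case by blast
qed

lemma free_module_submodule_fg:
  assumes "submodule N R (free_module R n)"
  obtains S where "finite S" "S \<subseteq> N"
    and "\<And>L. submodule L R (free_module R n) \<Longrightarrow> S \<subseteq> L \<Longrightarrow> N \<subseteq> L"
  using free_module_submodule_fg_aux[of n n N] assms by auto

lemma free_module_ascending_chain:
  assumes L: "\<And>j. submodule (L j) R (free_module R n)" and mono: "\<And>j. L j \<subseteq> L (Suc j)"
  obtains j where "\<And>i. j \<le> i \<Longrightarrow> L i = L j"
proof -
  let ?F = "free_module R n"
  interpret F: module R ?F by (rule free_module_is_module)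
  have le: "L i \<subseteq> L j" if "i \<le> j" for i j
    using lift_Suc_mono_le[of L, OF mono that] .
  have U: "submodule (\<Union>j. L j) R ?F"
  proof (rule F.submodule_by_smult)
    show "(\<Union>j. L j) \<subseteq> carrier ?F" using F.submodule_subset[OF L] by blast
    show "\<zero>\<^bsub>?F\<^esub> \<in> (\<Union>j. L j)" using F.submodule_zero[OF L] by blast
    fix x y assume "x \<in> (\<Union>j. L j)" "y \<in> (\<Union>j. L j)"
    then obtain i j where "x \<in> L i" "y \<in> L j" by auto
    then have "x \<in> L (max i j)" "y \<in> L (max i j)" using le[of i "max i j"] le[of j "max i j"] by auto
    then show "x \<oplus>\<^bsub>?F\<^esub> y \<in> (\<Union>j. L j)" using F.submodule_add[OF L] by blast
  qed (use F.submodule_smult[OF L] in blast)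
  obtain S where S: "finite S" "S \<subseteq> (\<Union>j. L j)"
    and gen: "\<And>K. submodule K R ?F \<Longrightarrow> S \<subseteq> K \<Longrightarrow> (\<Union>j. L j) \<subseteq> K"
    using free_module_submodule_fg[OF U] by metis
  have "\<exists>j. S \<subseteq> L j"
    using S
  proof (induction S)
    case (insert x S)
    then obtain i j where "x \<in> L i" "S \<subseteq> L j" by auto
    then have "insert x S \<subseteq> L (max i j)" using le[of i "max i j"] le[of j "max i j"] by auto
    then show ?case by blast
  qed auto
  then obtain j where "S \<subseteq> L j" by blast
  then have "(\<Union>j. L j) \<subseteq> L j" using gen L by blast
  then have "L i = L j" if "j \<le> i" for i using le[OF that] by blast
  then show thesis using that by blast
qed

lemma free_module_submodule_is_image:
  assumes N: "submodule N R (free_module R n)"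
  obtains k g where "linear_map R (free_module R k) (free_module R n) g"
    and "g ` carrier (free_module R k) = N"
proof -
  let ?F = "free_module R n"
  interpret F: module R ?F by (rule free_module_is_module)
  obtain S where S: "finite S" "S \<subseteq> N"
    and gen: "\<And>K. submodule K R ?F \<Longrightarrow> S \<subseteq> K \<Longrightarrow> N \<subseteq> K"
    using free_module_submodule_fg[OF N] by metis
  obtain k s where s: "S = s ` {i::nat. i < k}" using S(1) unfolding finite_conv_nat_seg_image by blast
  interpret K: module R "free_module R k" by (rule free_module_is_module)
  have sN: "s j \<in> N" if "j < k" for j using S(2) s that by blast
  then have sF: "s j \<in> carrier ?F" if "j < k" for j using F.submodule_closed[OF N] that by auto
  obtain g where g: "linear_map R (free_module R k) ?F g"
    and g_eq: "\<And>f. f \<in> carrier (free_module R k) \<Longrightarrow> g f = (\<Oplus>\<^bsub>?F\<^esub>j\<in>{..<k}. f j \<odot>\<^bsub>?F\<^esub> s j)"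
    by (rule free_module_linear_extension[OF F.module_axioms, of k s]) (use sF in auto)
  have unit: "g (unit_vector R k j) = s j" if "j < k" for j
  proof -
    have "(\<Oplus>\<^bsub>?F\<^esub>i\<in>{..<k}. unit_vector R k j i \<odot>\<^bsub>?F\<^esub> s i) =
        (\<Oplus>\<^bsub>?F\<^esub>i\<in>{..<k}. if j = i then s i else \<zero>\<^bsub>?F\<^esub>)"
      using sF by (intro F.finsum_cong') (auto simp: unit_vector_def)
    also have "\<dots> = s j" using sF that by (intro F.finsum_singleton) auto
    finally show ?thesis using g_eq[OF unit_vector_closed] by simp
  qed
  have "g f \<in> N" if f: "f \<in> carrier (free_module R k)" for f
  proof -
    have "submodule {x \<in> carrier (free_module R k). g x \<in> N} R (free_module R k)"
      using F.module_axioms g N by (rule K.submodule_preimage)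
    moreover have "f j \<odot>\<^bsub>free_module R k\<^esub> unit_vector R k j \<in> {x \<in> carrier (free_module R k). g x \<in> N}"
      if "j < k" for j
    proof -
      have "f j \<in> carrier R" using f that by (auto simp: free_module_simps PiE_iff)
      then show ?thesis
        using linear_map_smult[OF g _ unit_vector_closed] unit[OF that] F.submodule_smult[OF N] sN[OF that]
        by auto
    qed
    ultimately show ?thesis using free_module_mem_submodule[of _ k f] f by blast
  qed
  moreover have "N \<subseteq> g ` carrier (free_module R k)"
  proof (rule gen)
    show "submodule (g ` carrier (free_module R k)) R ?F"
      using K.submodule_image[OF F.module_axioms g K.carrier_is_submodule] .
    show "S \<subseteq> g ` carrier (free_module R k)"
      using s unit unit_vector_closed by (metis (no_types, lifting) image_subset_iff imageI mem_Collect_eq)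
  qed
  ultimately show thesis using that[OF g] by blast
qed

end

section \<open>Powers of ideals\<close>

abbreviation (in cring) ideal_power :: "'a set \<Rightarrow> nat \<Rightarrow> 'a set" (infixr \<open>\<up>\<close> 75) where
  "I \<up> n \<equiv> I [^]\<^bsub>ideals_set R\<^esub> n"

context cring
begin

lemma ideals_set_mult [simp]: "I \<otimes>\<^bsub>ideals_set R\<^esub> J = I \<cdot> J"
  and ideals_set_one [simp]: "\<one>\<^bsub>ideals_set R\<^esub> = carrier R"
  by (simp_all add: ideals_set_def)

lemma ideal_power_0: "I \<up> (0::nat) = carrier R"
  and ideal_power_Suc: "I \<up> Suc n = (I \<up> n) \<cdot> I"
  by (simp_all add: ideals_set_def)

lemma ideal_power_is_ideal: "ideal I R \<Longrightarrow> ideal (I \<up> (n::nat)) R"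
  by (induction n) (auto simp: oneideal ideal_prod_is_ideal)

lemma ideal_prod_subsetI:
  assumes "ideal K R" "\<And>i j. i \<in> I \<Longrightarrow> j \<in> J \<Longrightarrow> i \<otimes> j \<in> K"
  shows "I \<cdot> J \<subseteq> K"
proof
  interpret K: ideal K R by fact
  fix x assume "x \<in> I \<cdot> J"
  then show "x \<in> K" by induction (use assms in auto)
qed

lemma ideal_power_Suc_subset:
  assumes "ideal I R" shows "I \<up> Suc n \<subseteq> I \<up> n"
  using ideal_prod_inter[OF ideal_power_is_ideal[OF assms] assms] by auto

lemma ideal_power_mem:
  assumes "x \<in> I" "ideal I R" shows "x [^] n \<in> I \<up> (n::nat)"
  using assms by (induction n) (auto intro: ideal_prod.prod ideal.Icarr)

lemma ideal_power_antimono: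
  assumes "ideal I R" "m \<le> n" shows "I \<up> n \<subseteq> I \<up> (m::nat)"
  using assms(2) by (induction rule: dec_induct) (use ideal_power_Suc_subset[OF assms(1)] in auto)

lemma ideal_power_mono:
  assumes "ideal I R" "ideal J R" "I \<subseteq> J"
  shows "I \<up> n \<subseteq> J \<up> (n::nat)"
proof (induction n)
  case (Suc n)
  show ?case unfolding ideal_power_Suc
    using Suc assms ideal_prod_is_ideal[OF ideal_power_is_ideal[OF assms(2)] assms(2)]
    by (intro ideal_prod_subsetI) (auto intro: ideal_prod.prod)
qed (simp add: ideal_power_0)

lemma ideal_power_power:
  assumes "ideal I R"
  shows "(I \<up> (m::nat)) \<up> (n::nat) = I \<up> (m * n)"
proof -
  interpret I: comm_monoid "ideals_set R" by (rule ideals_set_is_comm_monoid)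
  have "I \<in> carrier (ideals_set R)" using assms by (simp add: ideals_set_def)
  then show ?thesis by (rule I.nat_pow_pow)
qed

lemma ideal_power_add_subset:
  assumes I: "ideal I R" and J: "ideal J R"
  shows "(I <+>\<^bsub>R\<^esub> J) \<up> n \<subseteq> (I \<up> (n::nat)) <+>\<^bsub>R\<^esub> J"
proof (induction n)
  case 0
  interpret J: ideal J R by fact
  have "x \<in> carrier R <+>\<^bsub>R\<^esub> J" if "x \<in> carrier R" for x
  proof -
    have "x = x \<oplus> \<zero>" using that by simp
    then show ?thesis using that J.zero_closed unfolding set_add_def' by blast
  qed
  then show ?case by (auto simp: ideal_power_0 monoid.nat_pow_0)
next
  case (Suc n)
  interpret J: ideal J R by fact
  interpret I: ideal I R by fact
  interpret P: ideal "I \<up> n" R by (rule ideal_power_is_ideal[OF I])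
  have "ideal ((I \<up> Suc n) <+>\<^bsub>R\<^esub> J) R"
    by (intro add_ideals ideal_power_is_ideal I J)
  then show ?case
    unfolding ideal_power_Suc[of "I <+>\<^bsub>R\<^esub> J"]
  proof (rule ideal_prod_subsetI)
    fix x y assume x: "x \<in> (I <+>\<^bsub>R\<^esub> J) \<up> n" and y: "y \<in> I <+>\<^bsub>R\<^esub> J"
    obtain p j where p: "p \<in> I \<up> n" "j \<in> J" "x = p \<oplus> j"
      using x Suc by (auto simp: set_add_def')
    obtain i j' where i: "i \<in> I" "j' \<in> J" "y = i \<oplus> j'"
      using y by (auto simp: set_add_def')
    have "x \<otimes> y = p \<otimes> i \<oplus> (p \<otimes> j' \<oplus> j \<otimes> (i \<oplus> j'))"
      using p i by (simp add: l_distr r_distr a_ac)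
    moreover have "p \<otimes> i \<in> I \<up> Suc n"
      using p i by (simp add: ideal_power_Suc ideal_prod.prod)
    moreover have "p \<otimes> j' \<oplus> j \<otimes> (i \<oplus> j') \<in> J"
      using p i by (intro J.a_closed J.I_l_closed J.I_r_closed) auto
    ultimately show "x \<otimes> y \<in> (I \<up> Suc n) <+>\<^bsub>R\<^esub> J"
      by (auto simp: set_add_def')
  qed
qed

text \<open>
  With \<open>I\<^sup>m \<subseteq> Q\<close> and \<open>J\<^sup>n \<subseteq> Q\<close> one has \<open>(I + J)\<^sup>m \<subseteq> J + Q\<close> and \<open>(J + Q)\<^sup>n \<subseteq> J\<^sup>n + Q\<close>, both by the
  preceding lemma; this avoids the multinomial expansion.
\<close>

lemma ideal_power_sum_subset:
  assumes "ideal I R" "ideal J R" "ideal Q R"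
    and "I \<up> m \<subseteq> Q" "J \<up> n \<subseteq> Q"
  shows "(I <+>\<^bsub>R\<^esub> J) \<up> (m * n :: nat) \<subseteq> Q"
proof -
  interpret Q: ideal Q R by fact
  have sub: "A <+>\<^bsub>R\<^esub> B \<subseteq> C <+>\<^bsub>R\<^esub> D" if "A \<subseteq> C" "B \<subseteq> D" for A B C D
    using that by (auto simp: set_add_def')
  have comm: "Q <+>\<^bsub>R\<^esub> J = J <+>\<^bsub>R\<^esub> Q"
    using set_add_comm Q.a_subset additive_subgroup.a_subset[OF ideal.axioms(1)[OF assms(2)]] by simp
  have "(I <+>\<^bsub>R\<^esub> J) \<up> (m * n) = ((I <+>\<^bsub>R\<^esub> J) \<up> m) \<up> n"
    using assms by (simp add: ideal_power_power add_ideals)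
  also have "\<dots> \<subseteq> (J <+>\<^bsub>R\<^esub> Q) \<up> n"
    using ideal_power_add_subset[OF assms(1,2), of m] sub[OF assms(4), of J J] comm
    by (intro ideal_power_mono ideal_power_is_ideal add_ideals assms) auto
  also have "\<dots> \<subseteq> (J \<up> n) <+>\<^bsub>R\<^esub> Q"
    by (rule ideal_power_add_subset[OF assms(2,3)])
  also have "\<dots> \<subseteq> Q" using assms(5) by (auto simp: set_add_def')
  finally show ?thesis .
qed

lemma cgenideal_power_subset:
  assumes "x \<in> carrier R" "ideal Q R" "x [^] n \<in> Q"
  shows "(PIdl x) \<up> (n::nat) \<subseteq> Q"
proof -
  interpret Q: ideal Q R by fact
  have "(PIdl x) \<up> n \<subseteq> PIdl (x [^] n)"
  proof (induction n)
    case 0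
    have "r \<in> PIdl (x [^] (0::nat))" if "r \<in> carrier R" for r
      unfolding cgenideal_def using that by (auto intro!: exI[of _ r])
    then show ?case by auto
  next
    case (Suc n)
    show ?case unfolding ideal_power_Suc
    proof (rule ideal_prod_subsetI)
      show "ideal (PIdl (x [^] Suc n)) R" using assms(1) by (intro cgenideal_ideal) auto
      fix i j assume "i \<in> (PIdl x) \<up> n" "j \<in> PIdl x"
      then obtain r s where "r \<in> carrier R" "s \<in> carrier R" "i = r \<otimes> x [^] n" "j = s \<otimes> x"
        using Suc by (auto simp: cgenideal_def)
      then have "i \<otimes> j = (r \<otimes> s) \<otimes> x [^] Suc n" "r \<otimes> s \<in> carrier R"
        using assms(1) by (simp_all add: m_ac)
      then show "i \<otimes> j \<in> PIdl (x [^] Suc n)" by (auto simp: cgenideal_def)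
    qed
  qed
  also have "\<dots> \<subseteq> Q" using assms by (auto simp: cgenideal_def intro: Q.I_l_closed)
  finally show ?thesis .
qed

text \<open>
  This turns torsion with respect to each generator of \<open>\<aa>\<close> into annihilation by a power of \<open>\<aa>\<close>, and so
  brings in the modules \<open>R/\<aa>\<^sup>n\<close>.
\<close>

lemma genideal_power_subset:
  assumes "finite G" "G \<subseteq> carrier R" "ideal Q R" "\<And>x. x \<in> G \<Longrightarrow> \<exists>e. x [^] (e::nat) \<in> Q"
  shows "\<exists>m. (Idl G) \<up> (m::nat) \<subseteq> Q"
  using assms
proof (induction G)
  case empty
  interpret Q: ideal Q R by fact
  have "Idl {} \<subseteq> {\<zero>}" by (rule genideal_minimal) (auto intro: zeroideal)
  then have "(Idl {}) \<up> (1::nat) \<subseteq> Q"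
    using ideal_prod_inter[OF oneideal genideal_ideal, of "{}"] Q.zero_closed by auto
  then show ?case by blast
next
  case (insert x G)
  then have x: "x \<in> carrier R" and G: "G \<subseteq> carrier R" by auto
  obtain m where m: "(Idl G) \<up> (m::nat) \<subseteq> Q" using insert by auto
  obtain e where "x [^] (e::nat) \<in> Q" using insert.prems by blast
  then have "(PIdl x) \<up> e \<subseteq> Q"
    using x insert.prems by (intro cgenideal_power_subset) auto
  then have sum: "(PIdl x <+>\<^bsub>R\<^esub> Idl G) \<up> (e * m) \<subseteq> Q"
    using x G insert.prems m by (intro ideal_power_sum_subset cgenideal_ideal genideal_ideal)
  have sum_ideal: "ideal (PIdl x <+>\<^bsub>R\<^esub> Idl G) R"
    using x G by (intro add_ideals cgenideal_ideal genideal_ideal)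
  have "Idl (insert x G) \<subseteq> PIdl x <+>\<^bsub>R\<^esub> Idl G"
  proof (rule genideal_minimal[OF sum_ideal])
    have "a \<in> PIdl x <+>\<^bsub>R\<^esub> Idl G" if "a \<in> PIdl x" for a
    proof -
      interpret G: ideal "Idl G" R by (rule genideal_ideal[OF G])
      interpret P: ideal "PIdl x" R by (rule cgenideal_ideal[OF x])
      have "a = a \<oplus> \<zero>" using P.Icarr[OF that] by simp
      then show ?thesis using that G.zero_closed unfolding set_add_def' by blast
    qed
    moreover have "a \<in> PIdl x <+>\<^bsub>R\<^esub> Idl G" if "a \<in> Idl G" for a
    proof -
      interpret G: ideal "Idl G" R by (rule genideal_ideal[OF G])
      interpret P: ideal "PIdl x" R by (rule cgenideal_ideal[OF x])
      have "a = \<zero> \<oplus> a" using G.Icarr[OF that] by simp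
      then show ?thesis using that P.zero_closed unfolding set_add_def' by blast
    qed
    ultimately show "insert x G \<subseteq> PIdl x <+>\<^bsub>R\<^esub> Idl G"
      using cgenideal_self[OF x] genideal_self[OF G] by blast
  qed
  then have "(Idl (insert x G)) \<up> (e * m) \<subseteq> Q"
    using ideal_power_mono[OF genideal_ideal sum_ideal, of "insert x G" "e * m"] x G sum by auto
  then show ?case by blast
qed

end

section \<open>Free resolutions\<close>

lemma mod_hom_iff: "h \<in> mod_hom R A B \<longleftrightarrow> linear_map R A B h \<and> h \<in> extensional (carrier A)"
  by (auto simp: mod_hom_def linear_map_def PiE_iff)

lemma mod_hom_restrict:
  assumes "module R A" "linear_map R A B g"
  shows "restrict g (carrier A) \<in> mod_hom R A B"
proof -
  interpret A: module R A by fact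
  show ?thesis using assms(2) by (auto simp: mod_hom_iff linear_map_def)
qed

text \<open>
  The conditions on a resolution, given below as criteria for an element to be a boundary instead of
  equations between images and kernels.
\<close>

locale free_resolution = cring R for R (structure) +
  fixes N :: "('a, 'c, 'n) module_scheme" and F :: "('a, 'c) resolution"
  assumes N: "module R N" and resolution: "is_free_resolution R N F"
begin

lemma term_is_module: "module R (term_module R F i)"
  by (simp add: term_module_def free_module_is_module)

lemma bdry_linear: "linear_map R (term_module R F (Suc i)) (term_module R F i) (bdry F i)"
  and augm_linear: "linear_map R (term_module R F 0) N (augm F)"
  and augm_surj: "augm F ` carrier (term_module R F 0) = carrier N"
  using resolution by (auto simp: is_free_resolution_def mod_hom_iff)

lemma augm_eq_zero_iff:
  assumes "z \<in> carrier (term_module R F 0)"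
  shows "augm F z = \<zero>\<^bsub>N\<^esub> \<longleftrightarrow> (\<exists>w\<in>carrier (term_module R F (Suc 0)). z = bdry F 0 w)"
proof -
  have "bdry F 0 ` carrier (term_module R F 1) =
      {z \<in> carrier (term_module R F 0). augm F z = \<zero>\<^bsub>N\<^esub>}"
    using resolution by (simp add: is_free_resolution_def a_kernel_def')
  then show ?thesis using assms by (auto simp: set_eq_iff image_iff)
qed

lemma bdry_eq_zero_iff:
  assumes "z \<in> carrier (term_module R F (Suc i))"
  shows "bdry F i z = \<zero>\<^bsub>term_module R F i\<^esub> \<longleftrightarrow>
    (\<exists>w\<in>carrier (term_module R F (Suc (Suc i))). z = bdry F (Suc i) w)"
proof -
  have "bdry F (Suc i) ` carrier (term_module R F (Suc (Suc i))) =
      {z \<in> carrier (term_module R F (Suc i)). bdry F i z = \<zero>\<^bsub>term_module R F i\<^esub>}"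
    using resolution by (simp add: is_free_resolution_def a_kernel_def')
  then show ?thesis using assms by (auto simp: set_eq_iff image_iff)
qed

lemma bdry_bdry:
  assumes "w \<in> carrier (term_module R F (Suc (Suc i)))"
  shows "bdry F i (bdry F (Suc i) w) = \<zero>\<^bsub>term_module R F i\<^esub>"
  using bdry_eq_zero_iff[of "bdry F (Suc i) w" i] linear_map_closed[OF bdry_linear] assms by blast

lemma augm_bdry:
  assumes "w \<in> carrier (term_module R F (Suc 0))"
  shows "augm F (bdry F 0 w) = \<zero>\<^bsub>N\<^esub>"
  using augm_eq_zero_iff[of "bdry F 0 w"] linear_map_closed[OF bdry_linear] assms by blast

lemma term_linear_choice:
  assumes A: "module R A"
    and total: "\<And>f. f \<in> carrier (term_module R F i) \<Longrightarrow> \<exists>a\<in>carrier A. T f a"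
    and add: "\<And>f f' a a'. f \<in> carrier (term_module R F i) \<Longrightarrow> f' \<in> carrier (term_module R F i) \<Longrightarrow>
        a \<in> carrier A \<Longrightarrow> a' \<in> carrier A \<Longrightarrow> T f a \<Longrightarrow> T f' a' \<Longrightarrow>
        T (f \<oplus>\<^bsub>term_module R F i\<^esub> f') (a \<oplus>\<^bsub>A\<^esub> a')"
    and smult: "\<And>r f a. r \<in> carrier R \<Longrightarrow> f \<in> carrier (term_module R F i) \<Longrightarrow>
        a \<in> carrier A \<Longrightarrow> T f a \<Longrightarrow> T (r \<odot>\<^bsub>term_module R F i\<^esub> f) (r \<odot>\<^bsub>A\<^esub> a)"
  obtains g where "linear_map R (term_module R F i) A g"
    and "\<And>f. f \<in> carrier (term_module R F i) \<Longrightarrow> T f (g f)"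
  using assms unfolding term_module_def by (rule free_module_linear_choice) blast+

lemma term_linear_lift:
  assumes A: "module R A" and p: "linear_map R A B p" and u: "linear_map R (term_module R F i) B u"
    and sub: "\<And>f. f \<in> carrier (term_module R F i) \<Longrightarrow> u f \<in> p ` carrier A"
  obtains g where "linear_map R (term_module R F i) A g"
    and "\<And>f. f \<in> carrier (term_module R F i) \<Longrightarrow> p (g f) = u f"
proof (rule term_linear_choice[OF A, of i "\<lambda>f a. p a = u f"])
  fix f assume "f \<in> carrier (term_module R F i)"
  then show "\<exists>a\<in>carrier A. p a = u f" using sub by force
qed (simp_all add: linear_map_add[OF p] linear_map_add[OF u] linear_map_smult[OF p] linear_map_smult[OF u] that)

lemma term_linear_lift_mod:
  assumes A: "module R A" and B: "module R B" "submodule K R B"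
    and p: "linear_map R A B p" and u: "linear_map R (term_module R F i) B u"
    and sub: "\<And>f. f \<in> carrier (term_module R F i) \<Longrightarrow> \<exists>a\<in>carrier A. cong_mod B K (u f) (p a)"
  obtains g where "linear_map R (term_module R F i) A g"
    and "\<And>f. f \<in> carrier (term_module R F i) \<Longrightarrow> cong_mod B K (u f) (p (g f))"
  using sub
proof (rule term_linear_choice[OF A, of i "\<lambda>f a. cong_mod B K (u f) (p a)"])
qed (simp_all add: linear_map_add[OF p] linear_map_add[OF u] linear_map_smult[OF p] linear_map_smult[OF u]
    module.cong_mod_add[OF B] module.cong_mod_smult[OF B] that)

end

lemma (in noetherian_cring) free_module_kernel_is_image:
  assumes "module R N" "linear_map R (free_module R n) N g"
  shows "\<exists>k h. h \<in> mod_hom R (free_module R k) (free_module R n) \<and>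
    h ` carrier (free_module R k) = a_kernel (free_module R n) N g"
proof -
  interpret N: module R N by fact
  interpret F: module R "free_module R n" by (rule free_module_is_module)
  have "submodule {x \<in> carrier (free_module R n). g x \<in> {\<zero>\<^bsub>N\<^esub>}} R (free_module R n)"
    using assms N.zero_submodule by (rule F.submodule_preimage)
  then obtain k h where h: "linear_map R (free_module R k) (free_module R n) h"
    "h ` carrier (free_module R k) = {x \<in> carrier (free_module R n). g x \<in> {\<zero>\<^bsub>N\<^esub>}}"
    by (rule free_module_submodule_is_image)
  have "restrict h (carrier (free_module R k)) \<in> mod_hom R (free_module R k) (free_module R n)"
    using free_module_is_module h(1) by (rule mod_hom_restrict)
  moreover have "restrict h (carrier (free_module R k)) ` carrier (free_module R k) =
      a_kernel (free_module R n) N g"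
    using h(2) by (simp add: a_kernel_def')
  ultimately show ?thesis by blast
qed

text \<open>
  Each kernel is a submodule of a finite free module over a Noetherian ring, hence the image of the
  next finite free module. A state of the recursive construction is a pair of consecutive ranks with
  the map between the two modules.
\<close>

lemma (in noetherian_cring) free_resolution_exists:
  assumes N: "module R N" and g: "linear_map R (free_module R n) N g"
    and surj: "g ` carrier (free_module R n) = carrier N"
  shows "\<exists>F. is_free_resolution R N F"
proof -
  let ?aug = "restrict g (carrier (free_module R n))"
  have aug: "?aug \<in> mod_hom R (free_module R n) N"
    using free_module_is_module g by (rule mod_hom_restrict)
  let ?P = "\<lambda>i (s, t, d). d \<in> mod_hom R (free_module R t) (free_module R s) \<and>
      (i = (0::nat) \<longrightarrow> s = n \<and> d ` carrier (free_module R t) = a_kernel (free_module R n) N ?aug)"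
  let ?Q = "\<lambda>i (s, t, d) (s', t', d'). s' = t \<and>
      d' ` carrier (free_module R t') = a_kernel (free_module R t) (free_module R s) d"
  have base: "\<exists>x. ?P 0 x"
    using free_module_kernel_is_image[OF N, of n ?aug] aug by (auto simp: mod_hom_iff)
  have step: "\<exists>y. ?P (Suc i) y \<and> ?Q i x y" if "?P i x" for i x
  proof -
    obtain s t d where x: "x = (s, t, d)" by (cases x)
    have "linear_map R (free_module R t) (free_module R s) d"
      using that x by (simp add: mod_hom_iff)
    then obtain k h where "h \<in> mod_hom R (free_module R k) (free_module R t)"
      "h ` carrier (free_module R k) = a_kernel (free_module R t) (free_module R s) d"
      using free_module_kernel_is_image[OF free_module_is_module] by blast
    then show ?thesis using x by (intro exI[of _ "(t, k, h)"]) simp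
  qed
  from dependent_nat_choice[of ?P ?Q, OF base step]
  obtain f where f_all: "\<forall>i. ?P i (f i) \<and> ?Q i (f i) (f (Suc i))" ..
  have f: "?P i (f i)" "?Q i (f i) (f (Suc i))" for i
    using f_all[THEN spec, of i] by (rule conjunct1, rule conjunct2)
  define F where "F = \<lparr>rk = (\<lambda>i. fst (f i)), bdry = (\<lambda>i. snd (snd (f i))), augm = ?aug\<rparr>"
  have next_rank: "fst (snd (f i)) = fst (f (Suc i))" for i
    using f(2)[of i] by (simp add: case_prod_beta)
  have "is_free_resolution R N F"
    unfolding is_free_resolution_def term_module_def F_def
    using f next_rank aug surj by (auto simp: case_prod_beta)
  then show ?thesis by blast
qed

text \<open>
  The recursion carries the invariant that the map constructed so far takes boundaries to
  boundaries; exactness of \<open>G\<close> passes it on to the next degree.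
\<close>

lemma (in cring) chain_lift_exists:
  assumes "free_resolution R N F" "free_resolution R N' G" and f: "linear_map R N N' f"
  shows "\<exists>\<phi>. is_chain_lift R F G f \<phi>"
proof -
  interpret F: free_resolution R N F by fact
  interpret G: free_resolution R N' G by fact
  let ?F = "term_module R F" and ?G = "term_module R G"
  let ?P = "\<lambda>i \<phi>. \<phi> \<in> mod_hom R (?F i) (?G i) \<and>
      (i = (0::nat) \<longrightarrow> (\<forall>x\<in>carrier (?F 0). augm G (\<phi> x) = f (augm F x))) \<and>
      (\<forall>z\<in>carrier (?F (Suc i)). \<exists>w\<in>carrier (?G (Suc i)). \<phi> (bdry F i z) = bdry G i w)"
  let ?Q = "\<lambda>i \<phi> \<psi>. \<forall>z\<in>carrier (?F (Suc i)). bdry G i (\<psi> z) = \<phi> (bdry F i z)"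
  have base: "\<exists>\<phi>. ?P 0 \<phi>"
  proof -
    obtain g where g: "linear_map R (?F 0) (?G 0) g"
      and g_eq: "\<And>x. x \<in> carrier (?F 0) \<Longrightarrow> augm G (g x) = f (augm F x)"
    proof (rule F.term_linear_lift[OF G.term_is_module G.augm_linear linear_map_compose[OF F.augm_linear f]])
      fix x assume "x \<in> carrier (?F 0)"
      then have "f (augm F x) \<in> carrier N'"
        using linear_map_closed[OF f] linear_map_closed[OF F.augm_linear] by blast
      then show "f (augm F x) \<in> augm G ` carrier (?G 0)" using G.augm_surj by simp
    qed blast
    have "\<exists>w\<in>carrier (?G (Suc 0)). g (bdry F 0 z) = bdry G 0 w" if z: "z \<in> carrier (?F (Suc 0))" for z
    proof -
      have dz: "bdry F 0 z \<in> carrier (?F 0)" using z by (rule linear_map_closed[OF F.bdry_linear])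
      have "augm G (g (bdry F 0 z)) = \<zero>\<^bsub>N'\<^esub>"
        using g_eq[OF dz] F.augm_bdry[OF z] linear_map_zero[OF F.N G.N f] by simp
      then show ?thesis using G.augm_eq_zero_iff linear_map_closed[OF g dz] by blast
    qed
    then show ?thesis
      using mod_hom_restrict[OF F.term_is_module g] g_eq linear_map_closed[OF F.bdry_linear]
      by (intro exI[of _ "restrict g (carrier (?F 0))"]) (auto simp: restrict_apply')
  qed
  have step: "\<exists>\<psi>. ?P (Suc i) \<psi> \<and> ?Q i \<phi> \<psi>" if \<phi>: "?P i \<phi>" for i \<phi>
  proof -
    have \<phi>_lin: "linear_map R (?F i) (?G i) \<phi>" using \<phi> by (simp add: mod_hom_iff)
    obtain g where g: "linear_map R (?F (Suc i)) (?G (Suc i)) g"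
      and g_eq: "\<And>z. z \<in> carrier (?F (Suc i)) \<Longrightarrow> bdry G i (g z) = \<phi> (bdry F i z)"
    proof (rule F.term_linear_lift[OF G.term_is_module G.bdry_linear
          linear_map_compose[OF F.bdry_linear \<phi>_lin]])
      fix z assume "z \<in> carrier (?F (Suc i))"
      then show "\<phi> (bdry F i z) \<in> bdry G i ` carrier (?G (Suc i))" using \<phi> by (metis imageI)
    qed blast
    have "\<exists>w\<in>carrier (?G (Suc (Suc i))). g (bdry F (Suc i) z) = bdry G (Suc i) w"
      if z: "z \<in> carrier (?F (Suc (Suc i)))" for z
    proof -
      have dz: "bdry F (Suc i) z \<in> carrier (?F (Suc i))" using z by (rule linear_map_closed[OF F.bdry_linear])
      have "bdry G i (g (bdry F (Suc i) z)) = \<zero>\<^bsub>?G i\<^esub>"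
        using g_eq[OF dz] F.bdry_bdry[OF z] linear_map_zero[OF F.term_is_module G.term_is_module \<phi>_lin]
        by simp
      then show ?thesis using G.bdry_eq_zero_iff linear_map_closed[OF g dz] by blast
    qed
    then show ?thesis
      using mod_hom_restrict[OF F.term_is_module g] g_eq linear_map_closed[OF F.bdry_linear]
      by (intro exI[of _ "restrict g (carrier (?F (Suc i)))"]) (auto simp: restrict_apply')
  qed
  from dependent_nat_choice[of ?P ?Q, OF base step]
  obtain \<phi> where "\<forall>i. ?P i (\<phi> i) \<and> ?Q i (\<phi> i) (\<phi> (Suc i))" ..
  then have "is_chain_lift R F G f \<phi>" unfolding is_chain_lift_def by auto
  then show ?thesis by (rule exI[of _ \<phi>])
qed

section \<open>The projections between cyclic modules\<close>

context cring
begin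

lemma cyclic_module_is_module:
  assumes "ideal I R" shows "module R (cyclic_module R I)"
  using module.quot_module_is_module[OF self_module_is_module] assms submodule_self_iff_ideal by blast

lemma cyclic_map_linear:
  assumes "ideal I R" shows "linear_map R (self_module R) (cyclic_module R I) (\<lambda>x. I +> x)"
  using module.quot_map_linear[OF self_module_is_module, of I] assms submodule_self_iff_ideal by simp

lemma cyclic_module_carrier: "carrier (cyclic_module R I) = (\<lambda>x. I +> x) ` carrier R"
  using module.quot_module_carrier[OF self_module_is_module, of I] by simp

lemma cyclic_coset_eq_iff:
  assumes "ideal I R" "x \<in> carrier R" "y \<in> carrier R"
  shows "I +> x = I +> y \<longleftrightarrow> x \<ominus> y \<in> I"
  using module.a_r_coset_eq_iff[OF self_module_is_module, of I x y] assms submodule_self_iff_ideal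
  by (simp add: cong_mod_def a_minus_def)

lemma cyclic_proj_coset:
  assumes "ideal I R" "ideal J R" "I \<subseteq> J" "x \<in> carrier R"
  shows "(\<Union>y\<in>I +> x. J +> y) = J +> x"
proof -
  interpret S: module R "self_module R" by (rule self_module_is_module)
  have I: "submodule I R (self_module R)" using assms(1) submodule_self_iff_ideal by blast
  have "J +> y = J +> x" if "cong_mod (self_module R) I y x" for y
    using that assms cyclic_coset_eq_iff[OF assms(2)] by (auto simp: cong_mod_def a_minus_def)
  then show ?thesis
    using S.UN_const_coset[OF I, of x "\<lambda>y. J +> y"] assms(4) by simp
qed

lemma cyclic_proj_linear:
  assumes "ideal I R" "ideal J R" "I \<subseteq> J"
  shows "linear_map R (cyclic_module R I) (cyclic_module R J)
    (\<lambda>X\<in>carrier (cyclic_module R I). \<Union>x\<in>X. J +> x)"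
proof -
  interpret S: module R "self_module R" by (rule self_module_is_module)
  let ?p = "\<lambda>X\<in>carrier (cyclic_module R I). \<Union>x\<in>X. J +> x"
  have p: "?p (I +> x) = J +> x" if "x \<in> carrier R" for x
    using cyclic_proj_coset[OF assms that] that by (auto simp: cyclic_module_carrier)
  have I: "submodule I R (self_module R)" and J: "submodule J R (self_module R)"
    using assms submodule_self_iff_ideal by auto
  show ?thesis
    using S.quot_module_add[OF I] S.quot_module_add[OF J] S.quot_module_smult[OF I] S.quot_module_smult[OF J] p
    unfolding linear_map_def by (auto simp: cyclic_module_carrier simp del: restrict_apply)
qed

end

lemma (in noetherian_cring) cyclic_resolution_exists:
  assumes "ideal I R" shows "\<exists>F. is_free_resolution R (cyclic_module R I) F"
proof (rule free_resolution_exists)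
  show "module R (cyclic_module R I)" using assms by (rule cyclic_module_is_module)
  show "linear_map R (free_module R 1) (cyclic_module R I) (\<lambda>f. I +> f 0)"
    using linear_map_compose[OF coordinate_linear[of 0 1] cyclic_map_linear[OF assms]] by simp
  have "x \<in> (\<lambda>f. f 0) ` carrier (free_module R 1)" if "x \<in> carrier R" for x
    using that by (intro image_eqI[of _ _ "\<lambda>j\<in>{..<1}. x"]) (auto simp: free_module_simps)
  then show "(\<lambda>f. I +> f 0) ` carrier (free_module R 1) = carrier (cyclic_module R I)"
    unfolding cyclic_module_carrier by (auto simp: free_module_simps PiE_iff image_iff)
qed

section \<open>Cochains along a tower of resolutions\<close>

text \<open>
  Free resolutions \<open>F n\<close> of \<open>R/\<aa>\<^bsup>n+1\<^esup>\<close> with chain maps \<open>\<phi> n : F (n+1) \<rightarrow> F n\<close> over the projections.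
\<close>

locale resolution_tower = noetherian_cring R for R :: "('a, 'r) ring_scheme" (structure) +
  fixes \<aa> :: "'a set"
    and F :: "nat \<Rightarrow> ('a, 'a set) resolution"
    and \<phi> :: "nat \<Rightarrow> nat \<Rightarrow> (nat \<Rightarrow> 'a) \<Rightarrow> nat \<Rightarrow> 'a"
  assumes aa: "ideal \<aa> R"
    and tower_resolution: "is_free_resolution R (power_quot R \<aa> n) (F n)"
    and tower_lift: "is_chain_lift R (F (Suc n)) (F n) (power_quot_proj R \<aa> n) (\<phi> n)"
begin

abbreviation A :: "nat \<Rightarrow> 'a set" where "A n \<equiv> \<aa> \<up> Suc n"
abbreviation T :: "nat \<Rightarrow> nat \<Rightarrow> ('a, nat \<Rightarrow> 'a) module" where "T n i \<equiv> term_module R (F n) i"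
abbreviation d :: "nat \<Rightarrow> nat \<Rightarrow> (nat \<Rightarrow> 'a) \<Rightarrow> nat \<Rightarrow> 'a" where "d n \<equiv> bdry (F n)"

lemma A_ideal: "ideal (A n) R"
  using aa by (rule ideal_power_is_ideal)

lemma tower_free_resolution: "free_resolution R (power_quot R \<aa> n) (F n)"
proof (intro free_resolution.intro free_resolution_axioms.intro)
  show "cring R" by (rule is_cring)
  show "module R (power_quot R \<aa> n)"
    unfolding power_quot_def using A_ideal by (rule cyclic_module_is_module)
  show "is_free_resolution R (power_quot R \<aa> n) (F n)" by (rule tower_resolution)
qed

sublocale res: free_resolution R "power_quot R \<aa> n" "F n" for n
  by (rule tower_free_resolution)

lemma d_linear: "linear_map R (T n (Suc i)) (T n i) (d n i)"
  by (rule res.bdry_linear)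

lemma d_closed: "z \<in> carrier (T n (Suc i)) \<Longrightarrow> d n i z \<in> carrier (T n i)"
  using d_linear by (rule linear_map_closed)

text \<open>
  The composite chain map \<open>F (n+k) \<rightarrow> F n\<close>.
\<close>

primrec phi :: "nat \<Rightarrow> nat \<Rightarrow> nat \<Rightarrow> (nat \<Rightarrow> 'a) \<Rightarrow> nat \<Rightarrow> 'a" where
  "phi n 0 i z = z"
| "phi n (Suc k) i z = phi n k i (\<phi> (n + k) i z)"

lemma \<phi>_linear: "linear_map R (T (Suc n) i) (T n i) (\<phi> n i)"
  using tower_lift[of n] by (simp add: is_chain_lift_def mod_hom_iff)

lemma phi_linear: "linear_map R (T (n + k) i) (T n i) (phi n k i)"
proof (induction k)
  case (Suc k)
  then show ?case
    using linear_map_compose[OF \<phi>_linear Suc] by simp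
qed (simp add: linear_map_ident)

lemma phi_closed: "z \<in> carrier (T (n + k) i) \<Longrightarrow> phi n k i z \<in> carrier (T n i)"
  using phi_linear by (rule linear_map_closed)

lemma phi_bdry:
  "z \<in> carrier (T (n + k) (Suc i)) \<Longrightarrow> d n i (phi n k (Suc i) z) = phi n k i (d (n + k) i z)"
proof (induction k arbitrary: z)
  case (Suc k)
  then have "\<phi> (n + k) (Suc i) z \<in> carrier (T (n + k) (Suc i))"
    using linear_map_closed[OF \<phi>_linear[of "n + k"]] by simp
  moreover have "d (n + k) i (\<phi> (n + k) (Suc i) z) = \<phi> (n + k) i (d (n + Suc k) i z)"
    using tower_lift[of "n + k"] Suc.prems by (simp add: is_chain_lift_def)
  ultimately show ?case using Suc.IH by simp
qed simp

lemma phi_add: "phi n (k + l) i z = phi n k i (phi (n + k) l i z)"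
  by (induction l arbitrary: z) (simp_all add: add.assoc)

lemma phi_augm:
  assumes "z \<in> carrier (T (n + k) 0)" "r \<in> carrier R" "augm (F (n + k)) z = A (n + k) +> r"
  shows "augm (F n) (phi n k 0 z) = A n +> r"
  using assms
proof (induction k arbitrary: z)
  case (Suc k)
  have "augm (F (n + k)) (\<phi> (n + k) 0 z) = power_quot_proj R \<aa> (n + k) (A (Suc (n + k)) +> r)"
    using tower_lift[of "n + k"] Suc.prems by (simp add: is_chain_lift_def)
  also have "\<dots> = A (n + k) +> r"
    using Suc.prems(2) cyclic_proj_coset[OF A_ideal A_ideal ideal_power_Suc_subset[OF aa, of "Suc (n + k)"]]
    by (auto simp: power_quot_proj_def power_quot_def cyclic_module_carrier)
  finally show ?case
    using Suc linear_map_closed[OF \<phi>_linear[of "n + k" 0]] by simp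
qed simp

text \<open>
  Here \<open>g\<close> represents an \<open>i\<close>-cocycle of \<open>Hom(F n, W/N)\<close>; since the terms are free, every such cocycle is
  represented by a map to \<open>W\<close>.
\<close>

definition cocycle ::
  "nat \<Rightarrow> nat \<Rightarrow> ('a, 'b, 'm) module_scheme \<Rightarrow> 'b set \<Rightarrow> ((nat \<Rightarrow> 'a) \<Rightarrow> 'b) \<Rightarrow> bool" where
  "cocycle i n W N g \<longleftrightarrow>
     linear_map R (T n i) W g \<and> (\<forall>z\<in>carrier (T n (Suc i)). g (d n i z) \<in> N)"

text \<open>
  For \<open>i = 0\<close> there is no cochain to take the coboundary of, and the condition is that \<open>g\<close> vanishes
  modulo \<open>N\<close>.
\<close>

primrec cobounds ::
  "nat \<Rightarrow> nat \<Rightarrow> ('a, 'b, 'm) module_scheme \<Rightarrow> 'b set \<Rightarrow> ((nat \<Rightarrow> 'a) \<Rightarrow> 'b) \<Rightarrow> bool" where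
  "cobounds 0 n W N g \<longleftrightarrow> (\<forall>z\<in>carrier (T n 0). g z \<in> N)"
| "cobounds (Suc j) n W N g \<longleftrightarrow> (\<exists>h. linear_map R (T n j) W h \<and>
     (\<forall>z\<in>carrier (T n (Suc j)). cong_mod W N (g z) (h (d n j z))))"

text \<open>
  The \<open>i\<close>-th local cohomology of \<open>W/N\<close> is zero; \<open>H_trivial_iff\<close> and \<open>vanishes_quot_module_iff\<close> below make
  the link with the direct limit of Ext modules.
\<close>

definition vanishes :: "nat \<Rightarrow> ('a, 'b, 'm) module_scheme \<Rightarrow> 'b set \<Rightarrow> bool" where
  "vanishes i W N \<longleftrightarrow>
     (\<forall>n g. cocycle i n W N g \<longrightarrow> (\<exists>k. cobounds i (n + k) W N (\<lambda>z. g (phi n k i z))))"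

lemma cocycle_pull:
  assumes "cocycle i n W N g"
  shows "cocycle i (n + k) W N (\<lambda>z. g (phi n k i z))"
  unfolding cocycle_def
proof (intro conjI ballI)
  show "linear_map R (T (n + k) i) W (\<lambda>z. g (phi n k i z))"
    using assms linear_map_compose[OF phi_linear] by (auto simp: cocycle_def)
  fix z assume z: "z \<in> carrier (T (n + k) (Suc i))"
  then show "g (phi n k i (d (n + k) i z)) \<in> N"
    using assms phi_closed[OF z] by (simp add: phi_bdry[symmetric] cocycle_def)
qed

lemma cobounds_pull:
  assumes "cobounds i n W N g"
  shows "cobounds i (n + k) W N (\<lambda>z. g (phi n k i z))"
proof (cases i)
  case 0
  then show ?thesis using assms phi_closed by auto
next
  case (Suc j)
  with assms obtain h where h: "linear_map R (T n j) W h"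
    "\<And>z. z \<in> carrier (T n (Suc j)) \<Longrightarrow> cong_mod W N (g z) (h (d n j z))" by auto
  have "cong_mod W N (g (phi n k (Suc j) z)) (h (phi n k j (d (n + k) j z)))"
    if z: "z \<in> carrier (T (n + k) (Suc j))" for z
    using h(2)[OF phi_closed[OF z]] by (simp add: phi_bdry z)
  then show ?thesis
    using Suc linear_map_compose[OF phi_linear h(1)] by (auto intro!: exI[of _ "\<lambda>z. h (phi n k j z)"])
qed

lemma cobounds_pull_pull:
  assumes "cobounds i (n + k) W N (\<lambda>z. g (phi n k i z))"
  shows "cobounds i (n + (k + l)) W N (\<lambda>z. g (phi n (k + l) i z))"
  using cobounds_pull[OF assms, of l] by (simp add: phi_add add.assoc)

lemma cobounds_cong_mod:
  assumes W: "module R W" "submodule N R W" and "cobounds i n W N g"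
    and "\<And>z. z \<in> carrier (T n i) \<Longrightarrow> cong_mod W N (g' z) (g z)"
  shows "cobounds i n W N g'"
proof (cases i)
  case 0
  then show ?thesis using assms module.cong_mod_mem[OF W] by auto
next
  case (Suc j)
  then show ?thesis using assms(3,4) module.cong_mod_trans[OF W] by (auto, metis)
qed

lemma cobounds_mono:
  assumes "cobounds i n W N g" "N \<subseteq> L"
  shows "cobounds i n W L g"
proof (cases i)
  case 0
  then show ?thesis using assms by auto
next
  case (Suc j)
  then show ?thesis using assms unfolding Suc cobounds.simps cong_mod_def by blast
qed

lemma cobounds_map:
  assumes W: "module R W" "module R W'" and p: "linear_map R W W' p"
    and "\<And>x. x \<in> N \<Longrightarrow> p x \<in> N'" and "cobounds i n W N g"
  shows "cobounds i n W' N' (\<lambda>z. p (g z))"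
proof (cases i)
  case 0
  then show ?thesis using assms by auto
next
  case (Suc j)
  with assms obtain h where h: "linear_map R (T n j) W h"
    "\<And>z. z \<in> carrier (T n (Suc j)) \<Longrightarrow> cong_mod W N (g z) (h (d n j z))" by auto
  have "cong_mod W' N' (p (g z)) (p (h (d n j z)))" if z: "z \<in> carrier (T n (Suc j))" for z
    using h(2)[OF z] assms(4) linear_map_diff[OF W p, symmetric] linear_map_closed[OF p]
    by (auto simp: cong_mod_def)
  then show ?thesis
    using Suc linear_map_compose[OF h(1) p] by (auto intro!: exI[of _ "\<lambda>z. p (h z)"])
qed

text \<open>
  A coboundary modulo \<open>L\<close> can be corrected by an honest coboundary so that its values lie in \<open>L\<close>. The
  correction is invisible after composing with the boundary map. Having this in one lemma saves
  treating degree zero separately later on.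
\<close>

lemma cobounds_normalise:
  assumes W: "module R W" "submodule L R W" and u: "linear_map R (T n j) W u"
    and "cobounds j n W L u"
  obtains u' where "linear_map R (T n j) W u'" "\<And>w. w \<in> carrier (T n j) \<Longrightarrow> u' w \<in> L"
    and "\<And>z. z \<in> carrier (T n (Suc j)) \<Longrightarrow> u' (d n j z) = u (d n j z)"
    and "\<And>N. submodule N R W \<Longrightarrow> cobounds j n W N (\<lambda>w. u w \<ominus>\<^bsub>W\<^esub> u' w)"
proof (cases j)
  case 0
  interpret W: module R W by fact
  show ?thesis
    using that[OF u] assms(4) 0 linear_map_closed[OF u] by (auto simp: W.diff_self W.submodule_zero)
next
  case (Suc j')
  interpret W: module R W by fact
  from Suc assms(4) obtain h where h: "linear_map R (T n j') W h"
    "\<And>w. w \<in> carrier (T n j) \<Longrightarrow> cong_mod W L (u w) (h (d n j' w))" by auto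
  let ?u = "\<lambda>w. u w \<ominus>\<^bsub>W\<^esub> h (d n j' w)"
  have "linear_map R (T n j) W ?u"
    using linear_map_diff_maps[OF W(1) u] linear_map_compose[OF d_linear h(1)] Suc by auto
  moreover have "?u w \<in> L" if "w \<in> carrier (T n j)" for w
    using h(2)[OF that] by (simp add: cong_mod_def)
  moreover have "?u (d n j z) = u (d n j z)" if z: "z \<in> carrier (T n (Suc j))" for z
    using res.bdry_bdry[of z n j'] z Suc linear_map_zero[OF res.term_is_module W(1) h(1)]
      linear_map_closed[OF u d_closed[OF z]]
    by (simp add: W.diff_zero)
  moreover have "cobounds j n W N (\<lambda>w. u w \<ominus>\<^bsub>W\<^esub> ?u w)" if N: "submodule N R W" for N
  proof -
    have "cong_mod W N (u w \<ominus>\<^bsub>W\<^esub> ?u w) (h (d n j' w))" if w: "w \<in> carrier (T n j)" for w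
    proof -
      have "u w \<in> carrier W" "h (d n j' w) \<in> carrier W" using h(2)[OF w] by (auto simp: cong_mod_def)
      then have "u w \<ominus>\<^bsub>W\<^esub> ?u w = h (d n j' w)"
        by (simp add: a_minus_def W.M.minus_add W.M.a_assoc[symmetric] W.M.r_neg)
      then show ?thesis using W.cong_mod_refl[OF N] h(2)[OF w] by (auto simp: cong_mod_def)
    qed
    then show ?thesis unfolding Suc cobounds.simps using Suc h(1) by blast
  qed
  ultimately show ?thesis by (rule that)
qed

subsection \<open>The universal cocycle\<close>

text \<open>
  The identity of the \<open>i\<close>-th term, taken modulo \<open>N\<close>, is a cocycle as soon as \<open>N\<close> contains the boundaries.
\<close>

definition universal_cocycle_dies :: "nat \<Rightarrow> nat \<Rightarrow> (nat \<Rightarrow> 'a) set \<Rightarrow> bool" where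
  "universal_cocycle_dies i n N \<longleftrightarrow> (\<exists>k. cobounds i (n + k) (T n i) N (phi n k i))"

text \<open>
  Every cocycle \<open>g\<close> factors as the universal one followed by the map that \<open>g\<close> induces from \<open>T/g\<^sup>-\<^sup>1(N)\<close> to \<open>W/N\<close>,
  and coboundaries are preserved by changing coefficients.
\<close>

lemma vanishes_by_universal:
  assumes W: "module R W" "submodule N R W"
    and univ: "\<And>n g N'. cocycle i n W N g \<Longrightarrow> N' = {f \<in> carrier (T n i). g f \<in> N} \<Longrightarrow>
      submodule N' R (T n i) \<Longrightarrow> d n i ` carrier (T n (Suc i)) \<subseteq> N' \<Longrightarrow> universal_cocycle_dies i n N'"
  shows "vanishes i W N"
  unfolding vanishes_def
proof (intro allI impI)
  fix n g assume g: "cocycle i n W N g"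
  then have lin: "linear_map R (T n i) W g" by (simp add: cocycle_def)
  let ?N = "{f \<in> carrier (T n i). g f \<in> N}"
  have "submodule ?N R (T n i)"
    using res.term_is_module W(1) lin W(2) by (rule module.submodule_preimage)
  moreover have "d n i ` carrier (T n (Suc i)) \<subseteq> ?N"
    using g d_closed by (auto simp: cocycle_def)
  ultimately obtain k where "cobounds i (n + k) (T n i) ?N (phi n k i)"
    using univ[OF g refl] by (auto simp: universal_cocycle_dies_def)
  from cobounds_map[OF res.term_is_module W(1) lin _ this, of N]
  show "\<exists>k. cobounds i (n + k) W N (\<lambda>z. g (phi n k i z))" by auto
qed

lemma universal_cocycle_dies_if_vanishes:
  assumes "vanishes i (T n i) N" "d n i ` carrier (T n (Suc i)) \<subseteq> N"
  shows "universal_cocycle_dies i n N"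
proof -
  have "cocycle i n (T n i) N (\<lambda>z. z)"
    using assms(2) by (auto simp: cocycle_def linear_map_ident)
  then show ?thesis using assms(1) unfolding vanishes_def universal_cocycle_dies_def by blast
qed

subsection \<open>Short exact sequences of coefficients\<close>

text \<open>
  The portion \<open>H\<^sup>i(W/N) \<rightarrow> H\<^sup>i(W/L) \<rightarrow> H\<^bsup>i+1\<^esup>(L/N)\<close> of the long exact sequence: the connecting map takes \<open>g\<close> to
  its coboundary \<open>g \<circ> d\<close>, and if this is the coboundary of some \<open>h\<close> with values in \<open>L\<close>, then \<open>g - h\<close>
  is a cocycle modulo \<open>N\<close> that agrees with \<open>g\<close> modulo \<open>L\<close>.
\<close>

lemma lift_cocycle:
  assumes W: "module R W" "submodule L R W" "submodule N R W" "N \<subseteq> L"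
    and van: "vanishes (Suc i) (W\<lparr>carrier := L\<rparr>) N" and g: "cocycle i n W L g"
  obtains k g' where "cocycle i (n + k) W N g'"
    and "\<And>z. z \<in> carrier (T (n + k) i) \<Longrightarrow> cong_mod W L (g' z) (g (phi n k i z))"
proof -
  interpret W: module R W by fact
  have L: "module R (W\<lparr>carrier := L\<rparr>)" using W(2,1) by (rule submodule.submodule_is_module)
  have lin: "linear_map R (T n i) W g" and gL: "\<And>z. z \<in> carrier (T n (Suc i)) \<Longrightarrow> g (d n i z) \<in> L"
    using g by (auto simp: cocycle_def)
  have "linear_map R (T n (Suc i)) (W\<lparr>carrier := L\<rparr>) (\<lambda>z. g (d n i z))"
    using linear_map_compose[OF d_linear lin] gL by (rule linear_map_restrict_codomain)
  moreover have "g (d n i (d n (Suc i) z)) \<in> N" if "z \<in> carrier (T n (Suc (Suc i)))" for z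
    using res.bdry_bdry[OF that] linear_map_zero[OF res.term_is_module W(1) lin] W.submodule_zero[OF W(3)]
    by simp
  ultimately have "cocycle (Suc i) n (W\<lparr>carrier := L\<rparr>) N (\<lambda>z. g (d n i z))"
    by (simp add: cocycle_def)
  then obtain k where "cobounds (Suc i) (n + k) (W\<lparr>carrier := L\<rparr>) N (\<lambda>z. g (d n i (phi n k (Suc i) z)))"
    using van unfolding vanishes_def by blast
  then obtain h where h: "linear_map R (T (n + k) i) (W\<lparr>carrier := L\<rparr>) h"
    and gh: "\<And>z. z \<in> carrier (T (n + k) (Suc i)) \<Longrightarrow>
      cong_mod (W\<lparr>carrier := L\<rparr>) N (g (d n i (phi n k (Suc i) z))) (h (d (n + k) i z))"
    by auto
  have hW: "linear_map R (T (n + k) i) W h"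
    using h W.submodule_subset[OF W(2)] by (rule linear_map_extend_codomain)
  let ?g = "\<lambda>z. g (phi n k i z) \<ominus>\<^bsub>W\<^esub> h z"
  have "linear_map R (T (n + k) i) W ?g"
    using W(1) linear_map_compose[OF phi_linear lin] hW by (rule linear_map_diff_maps)
  moreover have "?g (d (n + k) i z) \<in> N" if "z \<in> carrier (T (n + k) (Suc i))" for z
    using gh[OF that] unfolding W.cong_mod_restrict[OF W(2)] by (simp add: cong_mod_def phi_bdry that)
  ultimately have "cocycle i (n + k) W N ?g" by (simp add: cocycle_def)
  moreover have "cong_mod W L (?g z) (g (phi n k i z))" if z: "z \<in> carrier (T (n + k) i)" for z
  proof -
    have 1: "g (phi n k i z) \<in> carrier W" using linear_map_closed[OF lin phi_closed[OF z]] .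
    have 2: "h z \<in> L" using linear_map_closed[OF h z] by simp
    then have "cong_mod W L (h z) \<zero>\<^bsub>W\<^esub>"
      using W.cong_mod_zero W.submodule_closed[OF W(2)] by blast
    from W.cong_mod_diff[OF W(2) W.cong_mod_refl[OF W(2) 1] this]
    show ?thesis using 1 by (simp add: W.diff_zero)
  qed
  ultimately show thesis by (rule that)
qed

lemma vanishes_quotient:
  assumes W: "module R W" "submodule L R W" "submodule N R W" "N \<subseteq> L"
    and van: "vanishes (Suc i) (W\<lparr>carrier := L\<rparr>) N" "vanishes i W N"
  shows "vanishes i W L"
  unfolding vanishes_def
proof (intro allI impI)
  fix n g assume g: "cocycle i n W L g"
  obtain k g' where g': "cocycle i (n + k) W N g'"
    and cong: "\<And>z. z \<in> carrier (T (n + k) i) \<Longrightarrow> cong_mod W L (g' z) (g (phi n k i z))"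
    by (rule lift_cocycle[OF W van(1) g]) blast
  obtain l where "cobounds i (n + k + l) W N (\<lambda>z. g' (phi (n + k) l i z))"
    using g' van(2) unfolding vanishes_def by blast
  then have "cobounds i (n + k + l) W L (\<lambda>z. g' (phi (n + k) l i z))"
    using W(4) by (rule cobounds_mono)
  from cobounds_cong_mod[OF W(1,2) this, of "\<lambda>z. g (phi n (k + l) i z)"]
  have "cobounds i (n + (k + l)) W L (\<lambda>z. g (phi n (k + l) i z))"
    using cong phi_closed module.cong_mod_sym[OF W(1,2)] by (auto simp: phi_add add.assoc)
  then show "\<exists>k. cobounds i (n + k) W L (\<lambda>z. g (phi n k i z))" by blast
qed

end

section \<open>Vanishing above the number of generators\<close>

context resolution_tower
begin

text \<open>
  An element \<open>y\<close> of \<open>\<aa>\<^bsup>n+1\<^esup>\<close> acts as zero on \<open>R/\<aa>\<^bsup>n+1\<^esup>\<close>, so multiplication by \<open>y\<close> on the resolution is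
  homotopic to zero. The homotopy is constructed degree by degree from \<open>d h' + h d = y\<close>; of this
  relation only the consequence \<open>d h d = y d\<close> is recorded.
\<close>

lemma power_homotopy:
  assumes y: "y \<in> A n"
  shows "\<exists>h. linear_map R (T n i) (T n (Suc i)) h \<and>
    (\<forall>z\<in>carrier (T n (Suc i)). d n i (h (d n i z)) = y \<odot>\<^bsub>T n i\<^esub> d n i z)"
proof (induction i)
  have yR: "y \<in> carrier R" using ideal.Icarr[OF A_ideal y] .
  case 0
  interpret W: module R "T n 0" by (rule res.term_is_module)
  interpret Q: module R "power_quot R \<aa> n" by (rule res.N)
  obtain h where h: "linear_map R (T n 0) (T n (Suc 0)) h"
    and dh: "\<And>w. w \<in> carrier (T n 0) \<Longrightarrow> d n 0 (h w) = y \<odot>\<^bsub>T n 0\<^esub> w"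
  proof (rule res.term_linear_lift[OF res.term_is_module d_linear
        linear_map_smult_map[OF W.module_axioms linear_map_ident yR]])
    fix w assume w: "w \<in> carrier (T n 0)"
    then have "augm (F n) w \<in> carrier (power_quot R \<aa> n)"
      using linear_map_closed[OF res.augm_linear] by blast
    then obtain r where r: "r \<in> carrier R" "augm (F n) w = A n +> r"
      by (auto simp: power_quot_def cyclic_module_carrier)
    have "augm (F n) (y \<odot>\<^bsub>T n 0\<^esub> w) = y \<odot>\<^bsub>power_quot R \<aa> n\<^esub> (A n +> r)"
      using linear_map_smult[OF res.augm_linear yR w] r by simp
    also have "\<dots> = A n +> (y \<otimes> r)"
      using linear_map_smult[OF cyclic_map_linear[OF A_ideal] yR, of r n] r by (simp add: power_quot_def)
    also have "\<dots> = A n +> \<zero>"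
      using cyclic_coset_eq_iff[OF A_ideal, of "y \<otimes> r" \<zero> n] yR r ideal.I_r_closed[OF A_ideal y r(1)]
      by (simp add: a_minus_def)
    also have "\<dots> = \<zero>\<^bsub>power_quot R \<aa> n\<^esub>"
      using linear_map_zero[OF self_module_is_module cyclic_module_is_module[OF A_ideal] cyclic_map_linear[OF A_ideal], of n]
      by (simp add: power_quot_def)
    finally show "y \<odot>\<^bsub>T n 0\<^esub> w \<in> d n 0 ` carrier (T n (Suc 0))"
      using res.augm_eq_zero_iff[of "y \<odot>\<^bsub>T n 0\<^esub> w" n] w yR by auto
  qed blast
  show ?case using h dh d_closed by blast
next
  have yR: "y \<in> carrier R" using ideal.Icarr[OF A_ideal y] .
  case (Suc i)
  then obtain h where h: "linear_map R (T n i) (T n (Suc i)) h"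
    and dh: "\<And>z. z \<in> carrier (T n (Suc i)) \<Longrightarrow> d n i (h (d n i z)) = y \<odot>\<^bsub>T n i\<^esub> d n i z" by blast
  interpret V: module R "T n i" by (rule res.term_is_module)
  interpret W: module R "T n (Suc i)" by (rule res.term_is_module)
  \<comment> \<open>A cycle by the relation for \<open>h\<close>, so it can be lifted through the boundary map.\<close>
  let ?u = "\<lambda>w. y \<odot>\<^bsub>T n (Suc i)\<^esub> w \<ominus>\<^bsub>T n (Suc i)\<^esub> h (d n i w)"
  have u: "linear_map R (T n (Suc i)) (T n (Suc i)) ?u"
    using linear_map_diff_maps[OF W.module_axioms
        linear_map_smult_map[OF W.module_axioms linear_map_ident yR] linear_map_compose[OF d_linear h]] .
  obtain h' where h': "linear_map R (T n (Suc i)) (T n (Suc (Suc i))) h'"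
    and dh': "\<And>w. w \<in> carrier (T n (Suc i)) \<Longrightarrow> d n (Suc i) (h' w) = ?u w"
  proof (rule res.term_linear_lift[OF res.term_is_module d_linear u])
    fix w assume w: "w \<in> carrier (T n (Suc i))"
    have hd: "h (d n i w) \<in> carrier (T n (Suc i))" using linear_map_closed[OF h d_closed[OF w]] .
    have "d n i (?u w) = y \<odot>\<^bsub>T n i\<^esub> d n i w \<ominus>\<^bsub>T n i\<^esub> d n i (h (d n i w))"
      using linear_map_diff[OF W.module_axioms V.module_axioms d_linear, of "y \<odot>\<^bsub>T n (Suc i)\<^esub> w" "h (d n i w)"]
        w yR hd by (simp add: linear_map_smult[OF d_linear])
    also have "\<dots> = \<zero>\<^bsub>T n i\<^esub>" using dh[OF w] V.diff_self d_closed[OF w] yR by simp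
    finally show "?u w \<in> d n (Suc i) ` carrier (T n (Suc (Suc i)))"
      using res.bdry_eq_zero_iff[OF linear_map_closed[OF u w]] by blast
  qed blast
  have "d n (Suc i) (h' (d n (Suc i) z)) = y \<odot>\<^bsub>T n (Suc i)\<^esub> d n (Suc i) z"
    if z: "z \<in> carrier (T n (Suc (Suc i)))" for z
    using dh'[OF d_closed[OF z]] res.bdry_bdry[OF z] d_closed[OF z] yR
      linear_map_zero[OF V.module_axioms W.module_axioms h]
    by (simp add: W.diff_zero)
  then show ?case using h' by blast
qed

text \<open>
  With the homotopy \<open>s\<close>, the cochain \<open>g \<circ> s\<close> has coboundary \<open>y g\<close>: the difference is \<open>g\<close> applied to a cycle,
  hence to a boundary.
\<close>

lemma power_kills_cocycle:
  assumes W: "module R W" "submodule N R W" and y: "y \<in> A n" and g: "cocycle (Suc j) n W N g"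
  obtains h where "linear_map R (T n j) W h"
    and "\<And>z. z \<in> carrier (T n (Suc j)) \<Longrightarrow> cong_mod W N (h (d n j z)) (y \<odot>\<^bsub>W\<^esub> g z)"
proof -
  interpret W: module R W by fact
  interpret V: module R "T n j" by (rule res.term_is_module)
  interpret V': module R "T n (Suc j)" by (rule res.term_is_module)
  have yR: "y \<in> carrier R" using ideal.Icarr[OF A_ideal y] .
  have lin: "linear_map R (T n (Suc j)) W g" using g by (simp add: cocycle_def)
  obtain s where s: "linear_map R (T n j) (T n (Suc j)) s"
    and ds: "\<And>z. z \<in> carrier (T n (Suc j)) \<Longrightarrow> d n j (s (d n j z)) = y \<odot>\<^bsub>T n j\<^esub> d n j z"
    using power_homotopy[OF y, of j] by blast
  have "cong_mod W N (g (s (d n j z))) (y \<odot>\<^bsub>W\<^esub> g z)" if z: "z \<in> carrier (T n (Suc j))" for z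
  proof -
    have sd: "s (d n j z) \<in> carrier (T n (Suc j))" using linear_map_closed[OF s d_closed[OF z]] .
    have yz: "y \<odot>\<^bsub>T n (Suc j)\<^esub> z \<in> carrier (T n (Suc j))" using yR z by simp
    let ?v = "s (d n j z) \<ominus>\<^bsub>T n (Suc j)\<^esub> y \<odot>\<^bsub>T n (Suc j)\<^esub> z"
    have "d n j ?v = \<zero>\<^bsub>T n j\<^esub>"
      using linear_map_diff[OF V'.module_axioms V.module_axioms d_linear sd yz] ds[OF z]
        linear_map_smult[OF d_linear yR z] V.diff_self d_closed[OF z] yR by simp
    then obtain w where w: "w \<in> carrier (T n (Suc (Suc j)))" "?v = d n (Suc j) w"
      using res.bdry_eq_zero_iff[of ?v n j] sd yz by auto
    then have "g ?v \<in> N" using g by (simp add: cocycle_def)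
    moreover have "g ?v = g (s (d n j z)) \<ominus>\<^bsub>W\<^esub> y \<odot>\<^bsub>W\<^esub> g z"
      using linear_map_diff[OF V'.module_axioms W.module_axioms lin sd yz] linear_map_smult[OF lin yR z] by simp
    ultimately show ?thesis
      using linear_map_closed[OF lin] sd z yR by (simp add: cong_mod_def)
  qed
  then show thesis using that linear_map_compose[OF s lin] by blast
qed

text \<open>
  Let \<open>E = T/N\<close> for the term \<open>T\<close> of degree zero, and let \<open>w\<close> in \<open>T\<close> lie over the unit of \<open>R/\<aa>\<^bsup>n+1\<^esup>\<close>. As
  \<open>\<aa>\<^sup>m\<close> kills \<open>E\<close>, there is a homomorphism \<open>R/\<aa>\<^bsup>n+m+1\<^esup> \<rightarrow> E\<close> sending the unit to the class of \<open>w\<close>, and it agrees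
  with the identity of \<open>T\<close> modulo boundaries. In other words, with \<open>X\<close> the image of the boundaries in
  \<open>E\<close>, the class of the identity in \<open>H\<^sup>0(E/X)\<close> comes from \<open>H\<^sup>0(E)\<close>.
\<close>

lemma degree_zero_lift:
  assumes N: "submodule N R (T n 0)"
    and kill: "\<And>r f. r \<in> \<aa> \<up> (m::nat) \<Longrightarrow> f \<in> carrier (T n 0) \<Longrightarrow> r \<odot>\<^bsub>T n 0\<^esub> f \<in> N"
  obtains h where "linear_map R (T (n + m) 0) (T n 0) h"
    and "\<And>z. z \<in> carrier (T (n + m) (Suc 0)) \<Longrightarrow> h (d (n + m) 0 z) \<in> N"
    and "\<And>z. z \<in> carrier (T (n + m) 0) \<Longrightarrow>
      cong_mod (T n 0) (d n 0 ` carrier (T n (Suc 0))) (phi n m 0 z) (h z)"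
proof -
  interpret W: module R "T n 0" by (rule res.term_is_module)
  interpret Q: module R "power_quot R \<aa> n" by (rule res.N)
  interpret S: module R "self_module R" by (rule self_module_is_module)
  note coset = cyclic_map_linear[OF A_ideal, folded power_quot_def]
  have zero_coset: "A l +> \<zero> = \<zero>\<^bsub>power_quot R \<aa> l\<^esub>" for l
    using linear_map_zero[OF self_module_is_module res.N coset, of l] by simp
  have add_coset: "(A l +> r) \<oplus>\<^bsub>power_quot R \<aa> l\<^esub> (A l +> s) = A l +> (r \<oplus> s)"
    if "r \<in> carrier R" "s \<in> carrier R" for l r s
    using linear_map_add[OF coset, of r s l] that by simp
  have smult_coset: "r \<odot>\<^bsub>power_quot R \<aa> l\<^esub> (A l +> s) = A l +> (r \<otimes> s)"
    if "r \<in> carrier R" "s \<in> carrier R" for l r s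
    using linear_map_smult[OF coset, of r s l] that by simp
  have "A n +> \<one> \<in> carrier (power_quot R \<aa> n)"
    by (simp add: power_quot_def cyclic_module_carrier)
  then obtain w where w: "w \<in> carrier (T n 0)" "augm (F n) w = A n +> \<one>"
    using res.augm_surj[of n] by (metis imageE)
  \<comment> \<open>The map \<open>h\<close> sends \<open>z\<close> to \<open>r w\<close>, where \<open>r\<close> represents the augmentation of \<open>z\<close>. It is only determined
    modulo multiples of \<open>w\<close> by \<open>\<aa>\<^bsup>n+m+1\<^esup>\<close>, so it is obtained from the relation.\<close>
  let ?T = "\<lambda>z v. \<exists>r\<in>carrier R. augm (F (n + m)) z = A (n + m) +> r \<and> v = r \<odot>\<^bsub>T n 0\<^esub> w"
  obtain h where h: "linear_map R (T (n + m) 0) (T n 0) h"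
    and hT: "\<And>z. z \<in> carrier (T (n + m) 0) \<Longrightarrow> ?T z (h z)"
  proof (rule res.term_linear_choice[OF res.term_is_module, of "n + m" 0 n 0 ?T])
    fix z assume "z \<in> carrier (T (n + m) 0)"
    then have "augm (F (n + m)) z \<in> carrier (power_quot R \<aa> (n + m))"
      using linear_map_closed[OF res.augm_linear] by blast
    then show "\<exists>v\<in>carrier (T n 0). ?T z v"
      using w(1) by (auto simp: power_quot_def cyclic_module_carrier)
  next
    fix z z' v v' assume z: "z \<in> carrier (T (n + m) 0)" "z' \<in> carrier (T (n + m) 0)"
      and v: "?T z v" "?T z' v'"
    then obtain r r' where r: "r \<in> carrier R" "augm (F (n + m)) z = A (n + m) +> r" "v = r \<odot>\<^bsub>T n 0\<^esub> w"
      "r' \<in> carrier R" "augm (F (n + m)) z' = A (n + m) +> r'" "v' = r' \<odot>\<^bsub>T n 0\<^esub> w" by auto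
    then show "?T (z \<oplus>\<^bsub>T (n + m) 0\<^esub> z') (v \<oplus>\<^bsub>T n 0\<^esub> v')"
      using linear_map_add[OF res.augm_linear z] add_coset w(1)
      by (intro bexI[of _ "r \<oplus> r'"]) (simp_all add: W.smult_l_distr)
  next
    fix s z v assume s: "s \<in> carrier R" and z: "z \<in> carrier (T (n + m) 0)" and v: "?T z v"
    then obtain r where r: "r \<in> carrier R" "augm (F (n + m)) z = A (n + m) +> r" "v = r \<odot>\<^bsub>T n 0\<^esub> w" by auto
    then show "?T (s \<odot>\<^bsub>T (n + m) 0\<^esub> z) (s \<odot>\<^bsub>T n 0\<^esub> v)"
      using linear_map_smult[OF res.augm_linear s z] smult_coset s w(1)
      by (intro bexI[of _ "s \<otimes> r"]) (simp_all add: W.smult_assoc1)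
  qed blast+
  have "h (d (n + m) 0 z) \<in> N" if z: "z \<in> carrier (T (n + m) (Suc 0))" for z
  proof -
    obtain r where r: "r \<in> carrier R" "augm (F (n + m)) (d (n + m) 0 z) = A (n + m) +> r"
      "h (d (n + m) 0 z) = r \<odot>\<^bsub>T n 0\<^esub> w" using hT[OF d_closed[OF z]] by auto
    then have "A (n + m) +> r = A (n + m) +> \<zero>" using res.augm_bdry[OF z] zero_coset by simp
    then have "r \<in> A (n + m)"
      using cyclic_coset_eq_iff[OF A_ideal, of r \<zero> "n + m"] r(1) by (simp add: a_minus_def)
    then have "r \<in> \<aa> \<up> m" using ideal_power_antimono[OF aa, of m "Suc (n + m)"] by auto
    then show ?thesis using kill w(1) r by simp
  qed
  moreover have "cong_mod (T n 0) (d n 0 ` carrier (T n (Suc 0))) (phi n m 0 z) (h z)"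
    if z: "z \<in> carrier (T (n + m) 0)" for z
  proof -
    obtain r where r: "r \<in> carrier R" "augm (F (n + m)) z = A (n + m) +> r"
      "h z = r \<odot>\<^bsub>T n 0\<^esub> w" using hT[OF z] by auto
    have "augm (F n) (h z) = augm (F n) (phi n m 0 z)"
      using phi_augm[OF z r(1,2)] r w linear_map_smult[OF res.augm_linear r(1) w(1)]
        smult_coset[OF r(1) one_closed] by simp
    then have "augm (F n) (phi n m 0 z \<ominus>\<^bsub>T n 0\<^esub> h z) = \<zero>\<^bsub>power_quot R \<aa> n\<^esub>"
      using linear_map_diff[OF W.module_axioms Q.module_axioms res.augm_linear phi_closed[OF z] linear_map_closed[OF h z]]
        Q.diff_self linear_map_closed[OF res.augm_linear] phi_closed[OF z] by simp
    then show ?thesis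
      using res.augm_eq_zero_iff[of "phi n m 0 z \<ominus>\<^bsub>T n 0\<^esub> h z" n] phi_closed[OF z] linear_map_closed[OF h z]
      by (auto simp: cong_mod_def)
  qed
  ultimately show thesis using that h by blast
qed

end

text \<open>
  Zorn's lemma. In terms of quotients, \<open>M/K\<close> is an essential extension of \<open>B/D\<close>.
\<close>

lemma (in module) submodule_maximal_avoiding:
  assumes B: "submodule B R M" and D: "D \<subseteq> B" "submodule D R M"
  obtains K where "submodule K R M" "D \<subseteq> K" "K \<inter> B \<subseteq> D"
    and "\<forall>L. submodule L R M \<longrightarrow> K \<subseteq> L \<longrightarrow> L \<inter> B \<subseteq> D \<longrightarrow> L = K"
proof -
  let ?S = "{L. submodule L R M \<and> D \<subseteq> L \<and> L \<inter> B \<subseteq> D}"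
  have "\<exists>K\<in>?S. \<forall>X\<in>?S. K \<subseteq> X \<longrightarrow> X = K"
  proof (rule subset_Zorn_nonempty)
    show "?S \<noteq> {}" using D by blast
    fix C assume C: "C \<noteq> {}" "subset.chain ?S C"
    then have sub: "L \<in> ?S" if "L \<in> C" for L using that unfolding subset.chain_def by blast
    have "submodule (\<Union>C) R M"
    proof (rule submodule_by_smult)
      show "\<Union>C \<subseteq> carrier M" using sub submodule_subset by blast
      show "\<zero>\<^bsub>M\<^esub> \<in> \<Union>C" using C(1) sub submodule_zero by blast
      fix x y assume "x \<in> \<Union>C" "y \<in> \<Union>C"
      then obtain X Y where XY: "X \<in> C" "Y \<in> C" "x \<in> X" "y \<in> Y" by blast
      then have "X \<subseteq> Y \<or> Y \<subseteq> X" using C(2) unfolding subset_chain_def by blast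
      then show "x \<oplus>\<^bsub>M\<^esub> y \<in> \<Union>C" using XY sub submodule_add by blast
    qed (use sub submodule_smult in blast)
    then show "\<Union>C \<in> ?S" using C(1) sub by blast
  qed
  then obtain K where K: "K \<in> ?S" and max: "\<forall>X\<in>?S. K \<subseteq> X \<longrightarrow> X = K" ..
  show thesis
  proof (rule that)
    show "\<forall>L. submodule L R M \<longrightarrow> K \<subseteq> L \<longrightarrow> L \<inter> B \<subseteq> D \<longrightarrow> L = K"
    proof (intro allI impI)
      fix L assume "submodule L R M" "K \<subseteq> L" "L \<inter> B \<subseteq> D"
      then have "L \<in> ?S" using K by blast
      then show "L = K" using max \<open>K \<subseteq> L\<close> by blast
    qed
  qed (use K in auto)
qed

definition power_kills ::
  "('a, 'r) ring_scheme \<Rightarrow> 'a \<Rightarrow> ('a, 'b, 'm) module_scheme \<Rightarrow> 'b set \<Rightarrow> bool" where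
  "power_kills R x W N \<longleftrightarrow> (\<exists>e::nat. \<forall>w\<in>carrier W. (x [^]\<^bsub>R\<^esub> e) \<odot>\<^bsub>W\<^esub> w \<in> N)"

lemma power_kills_mono: "power_kills R x W N \<Longrightarrow> N \<subseteq> L \<Longrightarrow> power_kills R x W L"
  unfolding power_kills_def by blast

text \<open>
  An essential extension \<open>F/K\<close> of a module \<open>B/(K \<inter> B)\<close> killed by \<open>x\<^sup>e\<close> is killed by a power of \<open>x\<close>. The chain
  of submodules \<open>{f. x\<^sup>j f \<in> K}\<close> stops at some \<open>J0\<close>. An element of \<open>x\<^bsup>J0\<^esup>F + K\<close> that lies in \<open>B\<close> is then in \<open>K\<close>,
  because its multiple by \<open>x\<^sup>e\<close> is; maximality of \<open>K\<close> gives \<open>x\<^bsup>J0\<^esup>F \<subseteq> K\<close>. This elementary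
  argument takes the place of the Artin-Rees lemma.
\<close>

lemma (in noetherian_cring) power_kills_essential:
  assumes B: "submodule B R (free_module R n)" and K: "submodule K R (free_module R n)"
    and max: "\<And>L. submodule L R (free_module R n) \<Longrightarrow> K \<subseteq> L \<Longrightarrow> L \<inter> B \<subseteq> K \<Longrightarrow> L = K"
    and x: "x \<in> carrier R" and kill: "\<And>f. f \<in> B \<Longrightarrow> (x [^] (e::nat)) \<odot>\<^bsub>free_module R n\<^esub> f \<in> K"
  shows "power_kills R x (free_module R n) K"
proof -
  let ?F = "free_module R n"
  interpret F: module R ?F by (rule free_module_is_module)
  have pow: "linear_map R ?F ?F (\<lambda>f. (x [^] (j::nat)) \<odot>\<^bsub>?F\<^esub> f)" for j
    using F.module_axioms linear_map_ident by (rule linear_map_smult_map) (use x in simp)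
  have pow_add: "(x [^] (i + j)) \<odot>\<^bsub>?F\<^esub> f = (x [^] i) \<odot>\<^bsub>?F\<^esub> ((x [^] (j::nat)) \<odot>\<^bsub>?F\<^esub> f)"
    if "f \<in> carrier ?F" for f and i j :: nat
    using that x by (simp add: nat_pow_mult[symmetric] F.smult_assoc1)
  let ?L = "\<lambda>j. {f \<in> carrier ?F. (x [^] (j::nat)) \<odot>\<^bsub>?F\<^esub> f \<in> K}"
  have L: "submodule (?L j) R ?F" for j
    using F.module_axioms pow K by (rule F.submodule_preimage)
  have "?L j \<subseteq> ?L (Suc j)" for j
    using pow_add[of _ 1 j] F.submodule_smult[OF K] x by auto
  with L obtain J0 where J0: "\<And>i. J0 \<le> i \<Longrightarrow> ?L i = ?L J0"
    by (rule free_module_ascending_chain) blast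
  let ?P = "(\<lambda>f. (x [^] J0) \<odot>\<^bsub>?F\<^esub> f) ` carrier ?F"
  have P: "submodule ?P R ?F" using F.module_axioms pow F.carrier_is_submodule by (rule F.submodule_image)
  let ?M = "(sum_of ?F K ?P)"
  have M: "submodule ?M R ?F" using K P by (rule F.submodule_sum)
  have KM: "K \<subseteq> ?M" using K P by (rule F.submodule_sum_upper)
  have MB: "?M \<inter> B \<subseteq> K"
  proof
    fix b assume "b \<in> ?M \<inter> B"
    then obtain u f where b: "b \<in> B" "u \<in> K" "f \<in> carrier ?F" "b = u \<oplus>\<^bsub>?F\<^esub> (x [^] J0) \<odot>\<^bsub>?F\<^esub> f" by blast
    let ?v = "(x [^] J0) \<odot>\<^bsub>?F\<^esub> f"
    have uv: "u \<in> carrier ?F" "?v \<in> carrier ?F" using b x F.submodule_closed[OF K] by auto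
    have "(x [^] (e + J0)) \<odot>\<^bsub>?F\<^esub> f = (x [^] e) \<odot>\<^bsub>?F\<^esub> ?v" using pow_add b by simp
    also have "?v = b \<ominus>\<^bsub>?F\<^esub> u"
      using b(4) F.add_diff_cancel'(3)[OF uv(2,1)] uv by (simp add: F.M.a_comm)
    also have "(x [^] e) \<odot>\<^bsub>?F\<^esub> (b \<ominus>\<^bsub>?F\<^esub> u) = (x [^] e) \<odot>\<^bsub>?F\<^esub> b \<ominus>\<^bsub>?F\<^esub> (x [^] e) \<odot>\<^bsub>?F\<^esub> u"
      using uv b F.submodule_closed[OF B] x by (simp add: F.smult_diff)
    also have "\<dots> \<in> K"
      using kill[OF b(1)] F.submodule_smult[OF K, of "x [^] e" u] b(2) x
      by (intro F.submodule_diff[OF K]) auto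
    finally have "f \<in> ?L (e + J0)" using b(3) by simp
    then have "f \<in> ?L J0" using J0[of "e + J0"] by simp
    then show "b \<in> K" using b F.submodule_add[OF K] by simp
  qed
  have "?M = K" using M KM MB by (rule max)
  moreover have "?P \<subseteq> ?M" using K P by (rule F.submodule_sum_upper)
  ultimately show ?thesis unfolding power_kills_def by blast
qed

lemma power_kills_preimage:
  assumes "power_kills R x W N" "linear_map R B W g" "module R B" "x \<in> carrier R"
  shows "power_kills R x B {f \<in> carrier B. g f \<in> N}"
proof -
  interpret B: module R B by fact
  obtain e where e: "\<forall>w\<in>carrier W. (x [^]\<^bsub>R\<^esub> (e::nat)) \<odot>\<^bsub>W\<^esub> w \<in> N"
    using assms(1) by (auto simp: power_kills_def)
  have "(x [^]\<^bsub>R\<^esub> e) \<odot>\<^bsub>B\<^esub> f \<in> carrier B" "g ((x [^]\<^bsub>R\<^esub> e) \<odot>\<^bsub>B\<^esub> f) \<in> N" if "f \<in> carrier B" for f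
    using e that assms(4) linear_map_closed[OF assms(2) that] linear_map_smult[OF assms(2) _ that] by auto
  then show ?thesis unfolding power_kills_def by blast
qed

lemma (in module) colon_ideal:
  assumes "submodule N R M"
  shows "ideal {r \<in> carrier R. \<forall>w\<in>carrier M. r \<odot>\<^bsub>M\<^esub> w \<in> N} R"
proof -
  interpret S: module R "self_module R" by (rule R.self_module_is_module)
  have "submodule {r \<in> carrier R. \<forall>w\<in>carrier M. r \<odot>\<^bsub>M\<^esub> w \<in> N} R (self_module R)"
    using assms
    by (intro S.submodule_by_smult)
      (auto simp: smult_l_distr smult_assoc1 submodule_add submodule_smult submodule_zero)
  then show ?thesis by (simp only: R.submodule_self_iff_ideal)
qed

context resolution_tower
begin

text \<open>
  Local cohomology of a torsion module vanishes in positive degrees. The universal coefficients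
  \<open>X = T\<^bsub>i+1\<^esub>/N\<close> embed in \<open>T\<^bsub>i\<^esub>/d(N)\<close> by the boundary map, since cycles are boundaries and lie in \<open>N\<close>, and the
  universal class dies there, being the coboundary of the identity. Enlarging \<open>d(N)\<close> to a maximal \<open>K\<close> with the
  same intersection with the boundaries makes \<open>E = T\<^bsub>i\<^esub>/K\<close> an essential extension of \<open>X\<close>, hence
  torsion. So the class comes from \<open>H\<^sup>i(E/X)\<close>, and this is zero by induction if \<open>i > 0\<close>, while for \<open>i = 0\<close> it is
  covered by \<open>H\<^sup>0(E)\<close>.
\<close>

lemma torsion_universal_cocycle_dies:
  assumes G: "finite G" "G \<subseteq> carrier R" "\<aa> = Idl G"
    and "submodule N R (T n (Suc i))" "d n (Suc i) ` carrier (T n (Suc (Suc i))) \<subseteq> N"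
    and "\<And>x. x \<in> G \<Longrightarrow> power_kills R x (T n (Suc i)) N"
  shows "universal_cocycle_dies (Suc i) n N"
  using assms(4-)
proof (induction i arbitrary: n N rule: less_induct)
  case (less i)
  note N = less.prems(1) and im = less.prems(2) and kill = less.prems(3)
  interpret V: module R "T n i" by (rule res.term_is_module)
  interpret V': module R "T n (Suc i)" by (rule res.term_is_module)
  let ?B = "d n i ` carrier (T n (Suc i))" and ?D = "d n i ` N"
  have B: "submodule ?B R (T n i)"
    using V.module_axioms d_linear V'.carrier_is_submodule by (rule V'.submodule_image)
  have D: "submodule ?D R (T n i)"
    using V.module_axioms d_linear N by (rule V'.submodule_image)
  have DB: "?D \<subseteq> ?B" using V'.submodule_subset[OF N] by blast
  obtain K where K: "submodule K R (T n i)" "?D \<subseteq> K" "K \<inter> ?B \<subseteq> ?D"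
    and max_all: "\<forall>L. submodule L R (T n i) \<longrightarrow> K \<subseteq> L \<longrightarrow> L \<inter> ?B \<subseteq> ?D \<longrightarrow> L = K"
    by (rule V.submodule_maximal_avoiding[OF B DB D])
  have max: "L = K" if "submodule L R (T n i)" "K \<subseteq> L" "L \<inter> ?B \<subseteq> K" for L
    using that K(3) max_all by blast
  have killK: "power_kills R x (T n i) K" if x: "x \<in> G" for x
  proof -
    have xR: "x \<in> carrier R" using x G by auto
    obtain e where e: "\<forall>w\<in>carrier (T n (Suc i)). (x [^] (e::nat)) \<odot>\<^bsub>T n (Suc i)\<^esub> w \<in> N"
      using kill[OF x] unfolding power_kills_def ..
    have "(x [^] e) \<odot>\<^bsub>T n i\<^esub> f \<in> K" if f: "f \<in> ?B" for f
    proof -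
      obtain z where z: "f = d n i z" "z \<in> carrier (T n (Suc i))" using f by (rule imageE)
      then have "(x [^] e) \<odot>\<^bsub>T n i\<^esub> f = d n i ((x [^] e) \<odot>\<^bsub>T n (Suc i)\<^esub> z)"
        using xR by (simp add: linear_map_smult[OF d_linear])
      then show ?thesis using bspec[OF e z(2)] K(2) by auto
    qed
    then show ?thesis
      using power_kills_essential[of ?B "rk (F n) i" K x e] B K(1) max xR
      unfolding term_module_def by metis
  qed
  let ?L = "(sum_of (T n i) K ?B)"
  have L: "submodule ?L R (T n i)" using K(1) B by (rule V.submodule_sum)
  note KL = V.submodule_sum_upper(1)[OF K(1) B] and BL = V.submodule_sum_upper(2)[OF K(1) B]
  \<comment> \<open>A cocycle \<open>h\<close> with values in \<open>E\<close> whose class in \<open>H\<^sup>i(E/X)\<close> is that of the identity.\<close>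
  have "\<exists>k h. linear_map R (T (n + k) i) (T n i) h \<and>
      (\<forall>z\<in>carrier (T (n + k) (Suc i)). h (d (n + k) i z) \<in> K) \<and>
      (\<forall>z\<in>carrier (T (n + k) i). cong_mod (T n i) ?L (phi n k i z) (h z))"
  proof (cases i)
    case 0
    let ?Q = "{r \<in> carrier R. \<forall>w\<in>carrier (T n i). r \<odot>\<^bsub>T n i\<^esub> w \<in> K}"
    have "\<exists>e. x [^] (e::nat) \<in> ?Q" if "x \<in> G" for x
      using killK[OF that] that G(2) by (auto simp: power_kills_def)
    then obtain m where m: "\<aa> \<up> (m::nat) \<subseteq> ?Q"
      using genideal_power_subset[OF G(1,2) V.colon_ideal[OF K(1)]] G(3) by blast
    have K0: "submodule K R (T n 0)" using K(1) 0 by simp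
    have kill0: "r \<odot>\<^bsub>T n 0\<^esub> f \<in> K" if "r \<in> \<aa> \<up> m" "f \<in> carrier (T n 0)" for r f
      using m that 0 by auto
    obtain h where "linear_map R (T (n + m) 0) (T n 0) h"
      "\<And>z. z \<in> carrier (T (n + m) (Suc 0)) \<Longrightarrow> h (d (n + m) 0 z) \<in> K"
      "\<And>z. z \<in> carrier (T (n + m) 0) \<Longrightarrow>
        cong_mod (T n 0) (d n 0 ` carrier (T n (Suc 0))) (phi n m 0 z) (h z)"
      by (rule degree_zero_lift[OF K0 kill0]) blast+
    then show ?thesis
      using V.cong_mod_mono[OF _ BL] 0 by (intro exI[of _ m] exI[of _ h]) blast
  next
    case (Suc j)
    have "universal_cocycle_dies (Suc j) n ?L"
    proof (rule less.IH)
      show "j < i" using Suc by simp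
      show "submodule ?L R (T n (Suc j))" using L Suc by simp
      show "d n (Suc j) ` carrier (T n (Suc (Suc j))) \<subseteq> ?L" using BL Suc by simp
      show "power_kills R x (T n (Suc j)) ?L" if "x \<in> G" for x
        using power_kills_mono[OF killK[OF that] KL] Suc by simp
    qed
    then obtain k h where h: "linear_map R (T (n + k) j) (T n i) h"
      and cong: "\<And>z. z \<in> carrier (T (n + k) i) \<Longrightarrow> cong_mod (T n i) ?L (phi n k i z) (h (d (n + k) j z))"
      using Suc by (auto simp: universal_cocycle_dies_def)
    have "linear_map R (T (n + k) i) (T n i) (\<lambda>z. h (d (n + k) j z))"
      using linear_map_compose[OF d_linear h] Suc by simp
    moreover have "h (d (n + k) j (d (n + k) i z)) \<in> K" if "z \<in> carrier (T (n + k) (Suc i))" for z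
      using res.bdry_bdry[of z "n + k" j] that Suc
        linear_map_zero[OF res.term_is_module V.module_axioms h] V.submodule_zero[OF K(1)] by simp
    ultimately show ?thesis using cong by blast
  qed
  then obtain k h where h: "linear_map R (T (n + k) i) (T n i) h"
    and hK: "\<And>z. z \<in> carrier (T (n + k) (Suc i)) \<Longrightarrow> h (d (n + k) i z) \<in> K"
    and cong: "\<And>z. z \<in> carrier (T (n + k) i) \<Longrightarrow> cong_mod (T n i) ?L (phi n k i z) (h z)" by blast
  \<comment> \<open>Modulo \<open>K\<close> the difference takes values in \<open>X\<close>, so it can be written as \<open>d \<circ> b\<close>; the universal class
    is the coboundary of this \<open>b\<close>.\<close>
  define u where "u z = phi n k i z \<ominus>\<^bsub>T n i\<^esub> h z" for z
  have u: "linear_map R (T (n + k) i) (T n i) u"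
    unfolding u_def using V.module_axioms phi_linear h by (rule linear_map_diff_maps)
  obtain b where b: "linear_map R (T (n + k) i) (T n (Suc i)) b"
    and ub: "\<And>z. z \<in> carrier (T (n + k) i) \<Longrightarrow> cong_mod (T n i) K (u z) (d n i (b z))"
  proof (rule res.term_linear_lift_mod[OF V'.module_axioms V.module_axioms K(1) d_linear u])
    fix z assume z: "z \<in> carrier (T (n + k) i)"
    then have "u z \<in> ?L" using cong by (simp add: u_def cong_mod_def)
    then obtain x w where xw: "x \<in> K" "w \<in> carrier (T n (Suc i))" "u z = x \<oplus>\<^bsub>T n i\<^esub> d n i w" by blast
    then have "cong_mod (T n i) K (u z) (d n i w)"
      using V.submodule_closed[OF K(1)] d_closed by (simp add: cong_mod_def V.add_diff_cancel')
    then show "\<exists>w\<in>carrier (T n (Suc i)). cong_mod (T n i) K (u z) (d n i w)" using xw(2) by blast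
  qed blast
  have "cong_mod (T n (Suc i)) N (phi n k (Suc i) z) (b (d (n + k) i z))"
    if z: "z \<in> carrier (T (n + k) (Suc i))" for z
  proof -
    let ?c = "d (n + k) i z" and ?p = "phi n k (Suc i) z"
    have c: "?c \<in> carrier (T (n + k) i)" using d_closed[OF z] .
    have p: "?p \<in> carrier (T n (Suc i))" using phi_closed[OF z] .
    have bc: "b ?c \<in> carrier (T n (Suc i))" using linear_map_closed[OF b c] .
    have hc: "h ?c \<in> carrier (T n i)" using linear_map_closed[OF h c] .
    let ?e = "?p \<ominus>\<^bsub>T n (Suc i)\<^esub> b ?c"
    have e: "?e \<in> carrier (T n (Suc i))" using p bc by simp
    have "d n i ?e = d n i ?p \<ominus>\<^bsub>T n i\<^esub> d n i (b ?c)"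
      using linear_map_diff[OF V'.module_axioms V.module_axioms d_linear p bc] .
    moreover have "cong_mod (T n i) K (d n i ?p) (u ?c)"
      using hK[OF z] phi_closed[OF c] hc
      unfolding cong_mod_def u_def phi_bdry[OF z]
      by (simp add: a_minus_def V.M.minus_add V.M.a_assoc[symmetric] V.M.r_neg)
    then have "cong_mod (T n i) K (d n i ?p) (d n i (b ?c))"
      using ub[OF c] V.cong_mod_trans[OF K(1)] by blast
    ultimately have "d n i ?e \<in> K" by (simp add: cong_mod_def)
    then have "d n i ?e \<in> ?D" using K(3) e by blast
    then obtain v where v: "v \<in> N" "d n i ?e = d n i v" by blast
    have vc: "v \<in> carrier (T n (Suc i))" using V'.submodule_closed[OF N v(1)] .
    have "d n i (?e \<ominus>\<^bsub>T n (Suc i)\<^esub> v) = \<zero>\<^bsub>T n i\<^esub>"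
      using linear_map_diff[OF V'.module_axioms V.module_axioms d_linear e vc] v(2)
        V.diff_self[OF d_closed[OF vc]] by simp
    then have "?e \<ominus>\<^bsub>T n (Suc i)\<^esub> v \<in> N"
      using res.bdry_eq_zero_iff[of "?e \<ominus>\<^bsub>T n (Suc i)\<^esub> v" n i] e vc im by auto
    then have "?e \<in> N"
      using V'.submodule_add[OF N _ v(1)] V'.add_diff_cancel'(1)[OF e vc] by metis
    then show ?thesis using p bc by (simp add: cong_mod_def)
  qed
  then show ?case
    unfolding universal_cocycle_dies_def using b by auto
qed

text \<open>
  Let \<open>y\<close> kill the class of \<open>g\<close>, say \<open>y g = h d\<close>, and factor multiplication by \<open>y\<close> on \<open>X = W/N\<close> as \<open>X \<rightarrow> yX \<rightarrow> X\<close>. The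
  image of the class in \<open>H\<^bsup>j+1\<^esup>(yX)\<close> comes from \<open>H\<^sup>j(X/yX) = 0\<close>, so the class comes from the
  kernel of \<open>y\<close> on \<open>X\<close>, where it vanishes as well. The cochain \<open>h\<close> is first made divisible by \<open>y\<close>, and
  subtracting the coboundary of the quotient \<open>b\<close> moves \<open>g\<close> into the kernel of \<open>y\<close>.
\<close>

lemma dies_by_multiplication:
  assumes W: "module R W" "submodule N R W" and y: "y \<in> A n" and g: "cocycle (Suc j) n W N g"
    and image: "vanishes j W (sum_of W ((\<lambda>w. y \<odot>\<^bsub>W\<^esub> w) ` carrier W) N)"
    and kernel: "vanishes (Suc j) (W\<lparr>carrier := {w \<in> carrier W. y \<odot>\<^bsub>W\<^esub> w \<in> N}\<rparr>) N"
  shows "\<exists>k. cobounds (Suc j) (n + k) W N (\<lambda>z. g (phi n k (Suc j) z))"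
proof -
  interpret W: module R W by fact
  have yR: "y \<in> carrier R" using ideal.Icarr[OF A_ideal y] .
  have my: "linear_map R W W (\<lambda>w. y \<odot>\<^bsub>W\<^esub> w)"
    using W(1) linear_map_ident yR by (rule linear_map_smult_map)
  let ?Y = "(\<lambda>w. y \<odot>\<^bsub>W\<^esub> w) ` carrier W" and ?C = "{w \<in> carrier W. y \<odot>\<^bsub>W\<^esub> w \<in> N}"
  let ?L = "(sum_of W ?Y N)"
  have Y: "submodule ?Y R W" using W(1) my W.carrier_is_submodule by (rule W.submodule_image)
  have C: "submodule ?C R W" using W(1) my W(2) by (rule W.submodule_preimage)
  have L: "submodule ?L R W" using Y W(2) by (rule W.submodule_sum)
  have lin: "linear_map R (T n (Suc j)) W g" using g by (simp add: cocycle_def)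
  obtain h where h: "linear_map R (T n j) W h"
    and hg: "\<And>z. z \<in> carrier (T n (Suc j)) \<Longrightarrow> cong_mod W N (h (d n j z)) (y \<odot>\<^bsub>W\<^esub> g z)"
    by (rule power_kills_cocycle[OF W y g]) blast
  have "h (d n j z) \<in> ?L" if z: "z \<in> carrier (T n (Suc j))" for z
  proof -
    have "y \<odot>\<^bsub>W\<^esub> g z \<in> ?Y" using linear_map_closed[OF lin z] by blast
    then have "y \<odot>\<^bsub>W\<^esub> g z \<in> ?L" using W.submodule_sum_upper(1)[OF Y W(2)] by blast
    then show ?thesis
      using W.cong_mod_mem[OF L W.cong_mod_mono[OF hg[OF z] W.submodule_sum_upper(2)[OF Y W(2)]]] by blast
  qed
  then have "cocycle j n W ?L h" using h by (simp add: cocycle_def)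
  then obtain k where cob: "cobounds j (n + k) W ?L (\<lambda>z. h (phi n k j z))"
    using image unfolding vanishes_def by blast
  obtain u where u: "linear_map R (T (n + k) j) W u"
    and uL: "\<And>w. w \<in> carrier (T (n + k) j) \<Longrightarrow> u w \<in> ?L"
    and ud: "\<And>z. z \<in> carrier (T (n + k) (Suc j)) \<Longrightarrow> u (d (n + k) j z) = h (phi n k j (d (n + k) j z))"
    by (rule cobounds_normalise[OF W(1) L linear_map_compose[OF phi_linear h] cob]) blast
  obtain b where b: "linear_map R (T (n + k) j) W b"
    and ub: "\<And>w. w \<in> carrier (T (n + k) j) \<Longrightarrow> cong_mod W N (u w) (y \<odot>\<^bsub>W\<^esub> b w)"
  proof (rule res.term_linear_lift_mod[OF W(1) W my u])
    fix w assume "w \<in> carrier (T (n + k) j)"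
    then obtain x v where xv: "x \<in> carrier W" "v \<in> N" "u w = y \<odot>\<^bsub>W\<^esub> x \<oplus>\<^bsub>W\<^esub> v" using uL by blast
    then have "cong_mod W N (u w) (y \<odot>\<^bsub>W\<^esub> x)"
      using W.submodule_closed[OF W(2)] yR
      by (simp add: cong_mod_def W.M.a_comm[of "y \<odot>\<^bsub>W\<^esub> x"] W.add_diff_cancel')
    then show "\<exists>x\<in>carrier W. cong_mod W N (u w) (y \<odot>\<^bsub>W\<^esub> x)" using xv(1) by blast
  qed blast
  let ?g = "\<lambda>z. g (phi n k (Suc j) z) \<ominus>\<^bsub>W\<^esub> b (d (n + k) j z)"
  have gl: "linear_map R (T (n + k) (Suc j)) W ?g"
    using linear_map_diff_maps[OF W(1) linear_map_compose[OF phi_linear lin] linear_map_compose[OF d_linear b]] .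
  have gC: "?g z \<in> ?C" if z: "z \<in> carrier (T (n + k) (Suc j))" for z
  proof -
    have 1: "g (phi n k (Suc j) z) \<in> carrier W" using linear_map_closed[OF lin phi_closed[OF z]] .
    have 2: "b (d (n + k) j z) \<in> carrier W" using linear_map_closed[OF b d_closed[OF z]] .
    have "cong_mod W N (h (phi n k j (d (n + k) j z))) (y \<odot>\<^bsub>W\<^esub> g (phi n k (Suc j) z))"
      using hg[OF phi_closed[OF z]] by (simp add: phi_bdry[OF z])
    moreover have "cong_mod W N (h (phi n k j (d (n + k) j z))) (y \<odot>\<^bsub>W\<^esub> b (d (n + k) j z))"
      using ub[OF d_closed[OF z]] ud[OF z] by simp
    ultimately have "cong_mod W N (y \<odot>\<^bsub>W\<^esub> g (phi n k (Suc j) z)) (y \<odot>\<^bsub>W\<^esub> b (d (n + k) j z))"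
      using W.cong_mod_trans[OF W(2)] W.cong_mod_sym[OF W(2)] by blast
    then show ?thesis using 1 2 yR by (simp add: cong_mod_def W.smult_diff)
  qed
  have "?g (d (n + k) (Suc j) z) \<in> N" if z: "z \<in> carrier (T (n + k) (Suc (Suc j)))" for z
  proof -
    have "g (phi n k (Suc j) (d (n + k) (Suc j) z)) \<in> N"
      using g phi_closed[OF z] by (simp add: cocycle_def phi_bdry[OF z, symmetric])
    moreover have "b (d (n + k) j (d (n + k) (Suc j) z)) = \<zero>\<^bsub>W\<^esub>"
      using res.bdry_bdry[OF z] linear_map_zero[OF res.term_is_module W(1) b] by simp
    ultimately show ?thesis using W.submodule_closed[OF W(2)] by (simp add: W.diff_zero)
  qed
  then have "cocycle (Suc j) (n + k) (W\<lparr>carrier := ?C\<rparr>) N ?g"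
    using linear_map_restrict_codomain[OF gl gC] by (simp add: cocycle_def)
  then obtain l where "cobounds (Suc j) (n + k + l) (W\<lparr>carrier := ?C\<rparr>) N (\<lambda>z. ?g (phi (n + k) l (Suc j) z))"
    using kernel unfolding vanishes_def by blast
  then obtain h' where h': "linear_map R (T (n + k + l) j) (W\<lparr>carrier := ?C\<rparr>) h'"
    and gh': "\<And>z. z \<in> carrier (T (n + k + l) (Suc j)) \<Longrightarrow>
      cong_mod (W\<lparr>carrier := ?C\<rparr>) N (?g (phi (n + k) l (Suc j) z)) (h' (d (n + k + l) j z))"
    by auto
  have h'W: "linear_map R (T (n + k + l) j) W h'"
    using h' W.submodule_subset[OF C] by (rule linear_map_extend_codomain)
  let ?h = "\<lambda>z. b (phi (n + k) l j z) \<oplus>\<^bsub>W\<^esub> h' z"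
  have "linear_map R (T (n + k + l) j) W ?h"
    using W(1) linear_map_compose[OF phi_linear b] h'W by (rule linear_map_add_maps)
  moreover have "cong_mod W N (g (phi n k (Suc j) (phi (n + k) l (Suc j) z))) (?h (d (n + k + l) j z))"
    if z: "z \<in> carrier (T (n + k + l) (Suc j))" for z
  proof -
    let ?p = "phi (n + k) l (Suc j) z"
    have p: "?p \<in> carrier (T (n + k) (Suc j))" using phi_closed[OF z] .
    have 1: "g (phi n k (Suc j) ?p) \<in> carrier W" using linear_map_closed[OF lin phi_closed[OF p]] .
    have 2: "b (d (n + k) j ?p) \<in> carrier W" using linear_map_closed[OF b d_closed[OF p]] .
    have "cong_mod W N (?g ?p) (h' (d (n + k + l) j z))"
      using gh'[OF z] unfolding W.cong_mod_restrict[OF C] by simp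
    from W.cong_mod_add[OF W(2) W.cong_mod_refl[OF W(2) 2] this]
    show ?thesis using W.add_diff_cancel'(2)[OF 1 2] by (simp add: phi_bdry[OF z])
  qed
  ultimately have "cobounds (Suc j) (n + k + l) W N (\<lambda>z. g (phi n k (Suc j) (phi (n + k) l (Suc j) z)))"
    by auto
  then have "cobounds (Suc j) (n + (k + l)) W N (\<lambda>z. g (phi n (k + l) (Suc j) z))"
    by (simp add: phi_add add.assoc)
  then show ?thesis by blast
qed

text \<open>
  The set \<open>B\<close> collects the generators whose powers need not kill the coefficients. Removing \<open>x\<close> from it
  costs one degree by \<open>dies_by_multiplication\<close> for \<open>y = x\<^bsup>n+1\<^esup>\<close>, as both the kernel and the cokernel of
  \<open>y\<close> are killed by \<open>y\<close>.
\<close>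

lemma universal_cocycle_dies_bound:
  assumes G: "finite G" "G \<subseteq> carrier R" "\<aa> = Idl G"
    and "finite B" "B \<subseteq> G" "card B < i"
    and "submodule N R (T n i)" "d n i ` carrier (T n (Suc i)) \<subseteq> N"
    and "\<And>x. x \<in> G - B \<Longrightarrow> power_kills R x (T n i) N"
  shows "universal_cocycle_dies i n N"
  using assms(4-)
proof (induction B arbitrary: i n N)
  case empty
  then obtain j where i: "i = Suc j" by (cases i) auto
  show ?case
    using torsion_universal_cocycle_dies[OF G, of N n j] empty.prems(3-5) unfolding i by simp
next
  case (insert x B)
  then obtain j where i: "i = Suc j" and j: "card B < j" by (cases i) auto
  have x: "x \<in> G" "x \<in> carrier R" using insert.prems G by auto
  have van: "vanishes l V K"
    if l: "card B < l" and V: "module R V" "submodule K R V"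
      and kill: "\<And>x. x \<in> G - B \<Longrightarrow> power_kills R x V K"
    for l K and V :: "('a, nat \<Rightarrow> 'a) module"
  proof (rule vanishes_by_universal[OF V])
    fix n g N'
    assume g: "cocycle l n V K g" and N': "N' = {f \<in> carrier (T n l). g f \<in> K}"
      and sub: "submodule N' R (T n l)" "d n l ` carrier (T n (Suc l)) \<subseteq> N'"
    show "universal_cocycle_dies l n N'"
    proof (rule insert.IH[OF _ l sub])
      show "B \<subseteq> G" using insert.prems by simp
      fix x assume x: "x \<in> G - B"
      have "linear_map R (T n l) V g" using g by (simp add: cocycle_def)
      with kill[OF x] show "power_kills R x (T n l) N'"
        unfolding N' using res.term_is_module x G(2) by (intro power_kills_preimage) auto
    qed
  qed
  interpret W: module R "T n i" by (rule res.term_is_module)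
  note N = insert.prems(3)
  have y: "x [^] Suc n \<in> A n"
    unfolding \<open>\<aa> = Idl G\<close> using x(1) G(2) genideal_self[OF G(2)] genideal_ideal[OF G(2)]
    by (intro ideal_power_mem) auto
  have yR: "x [^] Suc n \<in> carrier R" using x by simp
  let ?y = "x [^] Suc n"
  have my: "linear_map R (T n i) (T n i) (\<lambda>w. ?y \<odot>\<^bsub>T n i\<^esub> w)"
    using W.module_axioms linear_map_ident yR by (rule linear_map_smult_map)
  let ?Y = "(\<lambda>w. ?y \<odot>\<^bsub>T n i\<^esub> w) ` carrier (T n i)"
  let ?L = "(sum_of (T n i) ?Y N)"
  let ?C = "{w \<in> carrier (T n i). ?y \<odot>\<^bsub>T n i\<^esub> w \<in> N}"
  have Y: "submodule ?Y R (T n i)"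
    using W.module_axioms my W.carrier_is_submodule by (rule W.submodule_image)
  have L: "submodule ?L R (T n i)" using Y N by (rule W.submodule_sum)
  have C: "submodule ?C R (T n i)" using W.module_axioms my N by (rule W.submodule_preimage)
  have NC: "N \<subseteq> ?C" using W.submodule_closed[OF N] W.submodule_smult[OF N yR] by auto
  have killN: "power_kills R x' (T n i) N" if "x' \<in> G - B" "x' \<noteq> x" for x'
    using that insert.prems(5) by blast
  have 1: "vanishes j (T n i) ?L"
  proof (rule van[OF j W.module_axioms L])
    fix x' assume x': "x' \<in> G - B"
    show "power_kills R x' (T n i) ?L"
    proof (cases "x' = x")
      case True
      have "?y \<odot>\<^bsub>T n i\<^esub> w \<in> ?L" if "w \<in> carrier (T n i)" for w
        using W.submodule_sum_upper(1)[OF Y N] that by blast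
      then show ?thesis unfolding True power_kills_def by blast
    next
      case False
      then show ?thesis
        using power_kills_mono[OF killN[OF x'] W.submodule_sum_upper(2)[OF Y N]] by blast
    qed
  qed
  have 2: "vanishes i ((T n i)\<lparr>carrier := ?C\<rparr>) N"
  proof (rule van)
    show "card B < i" using i j by simp
    show "module R ((T n i)\<lparr>carrier := ?C\<rparr>)"
      using C W.module_axioms by (rule submodule.submodule_is_module)
    show "submodule N R ((T n i)\<lparr>carrier := ?C\<rparr>)"
      using C N NC by (rule W.submodule_of_submodule)
    fix x' assume x': "x' \<in> G - B"
    show "power_kills R x' ((T n i)\<lparr>carrier := ?C\<rparr>) N"
    proof (cases "x' = x")
      case True
      have "\<forall>w\<in>carrier ((T n i)\<lparr>carrier := ?C\<rparr>). ?y \<odot>\<^bsub>(T n i)\<lparr>carrier := ?C\<rparr>\<^esub> w \<in> N" by simp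
      then show ?thesis unfolding True power_kills_def by blast
    next
      case False
      then show ?thesis using killN[OF x'] unfolding power_kills_def by auto
    qed
  qed
  have "cocycle i n (T n i) N (\<lambda>z. z)"
    using insert.prems(4) by (auto simp: cocycle_def linear_map_ident)
  then show ?case
    unfolding universal_cocycle_dies_def i
    using dies_by_multiplication[OF W.module_axioms N y, of j "\<lambda>z. z"] 1 2 unfolding i by blast
qed

section \<open>Vanishing above the cohomological dimension\<close>

lemma vanishes_coordinatewise:
  assumes J: "ideal J R" and van: "vanishes i (self_module R) J"
  shows "vanishes i (free_module R r) ({..<r} \<rightarrow>\<^sub>E J)"
  unfolding vanishes_def
proof (intro allI impI)
  interpret S: module R "self_module R" by (rule self_module_is_module)
  interpret P: module R "free_module R r" by (rule free_module_is_module)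
  have JS: "submodule J R (self_module R)" using J submodule_self_iff_ideal by blast
  fix n g assume g: "cocycle i n (free_module R r) ({..<r} \<rightarrow>\<^sub>E J) g"
  then have lin: "linear_map R (T n i) (free_module R r) g" by (simp add: cocycle_def)
  have coord: "cocycle i n (self_module R) J (\<lambda>z. g z j)" if "j < r" for j
    using g linear_map_compose[OF lin coordinate_linear[OF that]] that
    by (auto simp: cocycle_def PiE_iff)
  have "\<forall>j\<in>{..<r}. \<exists>k. cobounds i (n + k) (self_module R) J (\<lambda>z. g (phi n k i z) j)"
    using van coord unfolding vanishes_def by blast
  then obtain k where k: "\<And>j. j < r \<Longrightarrow>
      cobounds i (n + k j) (self_module R) J (\<lambda>z. g (phi n (k j) i z) j)"
    by (metis lessThan_iff)
  \<comment> \<open>Once a coordinate has become a coboundary it remains one, so a common level exists; zero is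
    inserted for \<open>r = 0\<close>.\<close>
  define m where "m = Max (insert 0 (k ` {..<r}))"
  have m: "cobounds i (n + m) (self_module R) J (\<lambda>z. g (phi n m i z) j)" if "j < r" for j
  proof -
    have "k j \<le> m" unfolding m_def using that by (intro Max_ge) auto
    then obtain l where "m = k j + l" using le_Suc_ex by blast
    then show ?thesis
      using cobounds_pull_pull[OF k[OF that], of l] by simp
  qed
  have "cobounds i (n + m) (free_module R r) ({..<r} \<rightarrow>\<^sub>E J) (\<lambda>z. g (phi n m i z))"
  proof (cases i)
    case 0
    then show ?thesis
      using m linear_map_closed[OF lin phi_closed] by (auto simp: free_module_simps PiE_iff)
  next
    case (Suc i')
    have "\<forall>j\<in>{..<r}. \<exists>h. linear_map R (T (n + m) i') (self_module R) h \<and>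
        (\<forall>z\<in>carrier (T (n + m) i). cong_mod (self_module R) J (g (phi n m i z) j) (h (d (n + m) i' z)))"
      using m Suc by auto
    then obtain h where h: "\<And>j. j < r \<Longrightarrow> linear_map R (T (n + m) i') (self_module R) (h j)"
      and gh: "\<And>j z. j < r \<Longrightarrow> z \<in> carrier (T (n + m) i) \<Longrightarrow>
        cong_mod (self_module R) J (g (phi n m i z) j) (h j (d (n + m) i' z))"
      by (metis lessThan_iff)
    let ?h = "\<lambda>z. \<lambda>j\<in>{..<r}. h j z"
    have lin_h: "linear_map R (T (n + m) i') (free_module R r) ?h"
      using h unfolding linear_map_def by (auto simp: free_module_simps)
    have "cong_mod (free_module R r) ({..<r} \<rightarrow>\<^sub>E J) (g (phi n m i z)) (?h (d (n + m) i' z))"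
      if z: "z \<in> carrier (T (n + m) i)" for z
    proof -
      have 1: "g (phi n m i z) \<in> carrier (free_module R r)" using linear_map_closed[OF lin phi_closed[OF z]] .
      have 2: "?h (d (n + m) i' z) \<in> carrier (free_module R r)"
        using linear_map_closed[OF lin_h] d_closed z Suc by blast
      let ?e = "g (phi n m i z) \<ominus>\<^bsub>free_module R r\<^esub> ?h (d (n + m) i' z)"
      have e: "?e \<in> carrier (free_module R r)" using 1 2 by (rule P.M.minus_closed)
      have "?e j \<in> J" if j: "j < r" for j
        using linear_map_diff[OF P.module_axioms S.module_axioms coordinate_linear[OF j] 1 2]
          gh[OF j z] j by (simp add: cong_mod_def)
      then show ?thesis using 1 2 e by (auto simp: cong_mod_def free_module_simps(1) PiE_iff)
    qed
    then show ?thesis using Suc lin_h by auto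
  qed
  then show "\<exists>k. cobounds i (n + k) (free_module R r) ({..<r} \<rightarrow>\<^sub>E J) (\<lambda>z. g (phi n k i z))" by blast
qed

text \<open>
  Descending induction from the degrees above the number of generators. The sequence used is
  \<open>0 \<rightarrow> N/JT \<rightarrow> T/JT \<rightarrow> T/N \<rightarrow> 0\<close> for the term \<open>T\<close> carrying the universal cocycle: the middle is a power of
  \<open>R/J\<close> and the left module is killed by \<open>J\<close>.
\<close>

lemma universal_cocycle_dies_of_cyclic:
  assumes J: "ideal J R" and van: "\<And>i. s \<le> i \<Longrightarrow> vanishes i (self_module R) J"
    and "s \<le> i" "submodule N R (T n i)" "d n i ` carrier (T n (Suc i)) \<subseteq> N"
    and "\<And>r f. r \<in> J \<Longrightarrow> f \<in> carrier (T n i) \<Longrightarrow> r \<odot>\<^bsub>T n i\<^esub> f \<in> N"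
  shows "universal_cocycle_dies i n N"
proof -
  obtain G where G: "finite G" "G \<subseteq> carrier R" "\<aa> = Idl G" using finetely_gen[OF aa] by blast
  show ?thesis
    using assms(3-)
  proof (induction "Suc (card G) - i" arbitrary: i n N rule: less_induct)
    case less
    show ?case
    proof (cases "card G < i")
      case True
      then show ?thesis
        using universal_cocycle_dies_bound[OF G G(1) subset_refl True less.prems(2,3)] by simp
    next
      case False
      interpret W: module R "T n i" by (rule res.term_is_module)
      note N = less.prems(2)
      let ?J = "{..<rk (F n) i} \<rightarrow>\<^sub>E J"
      have J_sub: "submodule ?J R (T n i)"
        unfolding term_module_def using J by (rule free_module_ideal_submodule)
      have JN: "?J \<subseteq> N"
        using free_module_ideal_subset[of N "rk (F n) i" J] less.prems(2,4) ideal.Icarr[OF J]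
        unfolding term_module_def by blast
      have 1: "vanishes i (T n i) ?J"
        unfolding term_module_def using J van[OF less.prems(1)] by (rule vanishes_coordinatewise)
      have 2: "vanishes (Suc i) ((T n i)\<lparr>carrier := N\<rparr>) ?J"
      proof (rule vanishes_by_universal)
        show "module R ((T n i)\<lparr>carrier := N\<rparr>)"
          using N W.module_axioms by (rule submodule.submodule_is_module)
        show "submodule ?J R ((T n i)\<lparr>carrier := N\<rparr>)"
          using N J_sub JN by (rule W.submodule_of_submodule)
        fix m g N' assume g: "cocycle (Suc i) m ((T n i)\<lparr>carrier := N\<rparr>) ?J g"
          and N': "N' = {f \<in> carrier (T m (Suc i)). g f \<in> ?J}"
          and sub: "submodule N' R (T m (Suc i))" "d m (Suc i) ` carrier (T m (Suc (Suc i))) \<subseteq> N'"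
        interpret V: module R "T m (Suc i)" by (rule res.term_is_module)
        have "linear_map R (T m (Suc i)) ((T n i)\<lparr>carrier := N\<rparr>) g" using g by (simp add: cocycle_def)
        then have lin: "linear_map R (T m (Suc i)) (T n i) g"
          using W.submodule_subset[OF N] by (rule linear_map_extend_codomain)
        show "universal_cocycle_dies (Suc i) m N'"
        proof (rule less.hyps)
          show "Suc (card G) - Suc i < Suc (card G) - i" using False by simp
          show "s \<le> Suc i" using less.prems(1) by simp
          show "submodule N' R (T m (Suc i))" "d m (Suc i) ` carrier (T m (Suc (Suc i))) \<subseteq> N'"
            using sub .
          fix r f assume r: "r \<in> J" and f: "f \<in> carrier (T m (Suc i))"
          have rR: "r \<in> carrier R" using ideal.Icarr[OF J r] .
          have "r \<odot>\<^bsub>T n i\<^esub> g f \<in> ?J"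
            using linear_map_closed[OF lin f] ideal.I_r_closed[OF J r]
            by (auto simp: term_module_def free_module_simps PiE_iff)
          then show "r \<odot>\<^bsub>T m (Suc i)\<^esub> f \<in> N'"
            unfolding N' using f rR by (simp add: linear_map_smult[OF lin])
        qed
      qed
      have "vanishes i (T n i) N"
        using W.module_axioms N J_sub JN 2 1 by (rule vanishes_quotient)
      then show ?thesis using less.prems(3) by (rule universal_cocycle_dies_if_vanishes)
    qed
  qed
qed

text \<open>
  Through the universal cocycle the result for finitely generated coefficients extends to all modules
  killed by \<open>J\<close>.
\<close>

theorem vanishes_of_cyclic:
  assumes J: "ideal J R" and van: "\<And>i. s \<le> i \<Longrightarrow> vanishes i (self_module R) J"
    and i: "s \<le> i" and W: "module R W" "submodule N R W"
    and kill: "\<And>r w. r \<in> J \<Longrightarrow> w \<in> carrier W \<Longrightarrow> r \<odot>\<^bsub>W\<^esub> w \<in> N"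
  shows "vanishes i W N"
proof (rule vanishes_by_universal[OF W])
  fix n g N'
  assume g: "cocycle i n W N g" and N': "N' = {f \<in> carrier (T n i). g f \<in> N}"
    and sub: "submodule N' R (T n i)" "d n i ` carrier (T n (Suc i)) \<subseteq> N'"
  interpret V: module R "T n i" by (rule res.term_is_module)
  have lin: "linear_map R (T n i) W g" using g by (simp add: cocycle_def)
  have "r \<odot>\<^bsub>T n i\<^esub> f \<in> N'" if r: "r \<in> J" and f: "f \<in> carrier (T n i)" for r f
    unfolding N' using f ideal.Icarr[OF J r] kill[OF r linear_map_closed[OF lin f]]
    by (simp add: linear_map_smult[OF lin])
  then show "universal_cocycle_dies i n N'" using universal_cocycle_dies_of_cyclic[OF J van i sub] by blast
qed

end

section \<open>Cocycles with values in an ideal multiple\<close>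

text \<open>
  The submodule \<open>x\<^sub>1M + \<dots> + x\<^sub>kM\<close>, built up one element at a time so that induction on the list reaches it
  from zero.
\<close>

primrec multiples :: "('a, 'b, 'm) module_scheme \<Rightarrow> 'a list \<Rightarrow> 'b set" where
  "multiples M [] = {\<zero>\<^bsub>M\<^esub>}"
| "multiples M (x # xs) =
     sum_of M ((\<lambda>w. x \<odot>\<^bsub>M\<^esub> w) ` carrier M) (multiples M xs)"

lemma (in module) multiples_submodule: "set xs \<subseteq> carrier R \<Longrightarrow> submodule (multiples M xs) R M"
proof (induction xs)
  case (Cons x xs)
  then have "linear_map R M M (\<lambda>w. x \<odot>\<^bsub>M\<^esub> w)"
    by (intro linear_map_smult_map module_axioms linear_map_ident) auto
  then have "submodule ((\<lambda>w. x \<odot>\<^bsub>M\<^esub> w) ` carrier M) R M"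
    using module_axioms carrier_is_submodule by (intro submodule_image)
  with Cons show ?case by (auto intro!: submodule_sum)
qed (simp add: zero_submodule)

lemma (in module) smult_multiples:
  assumes xs: "set xs \<subseteq> carrier R" and r: "r \<in> Idl\<^bsub>R\<^esub> (set xs)" and w: "w \<in> carrier M"
  shows "r \<odot>\<^bsub>M\<^esub> w \<in> multiples M xs"
proof -
  let ?Q = "\<lambda>ys. {r \<in> carrier R. \<forall>w\<in>carrier M. r \<odot>\<^bsub>M\<^esub> w \<in> multiples M ys}"
  have "set xs \<subseteq> ?Q xs"
    using xs
  proof (induction xs)
    case (Cons x xs)
    have X: "linear_map R M M (\<lambda>w. x \<odot>\<^bsub>M\<^esub> w)"
      using Cons.prems by (intro linear_map_smult_map module_axioms linear_map_ident) auto
    have Y: "submodule ((\<lambda>w. x \<odot>\<^bsub>M\<^esub> w) ` carrier M) R M"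
      using module_axioms X carrier_is_submodule by (rule submodule_image)
    have Z: "submodule (multiples M xs) R M" using Cons.prems by (intro multiples_submodule) auto
    have "?Q xs \<subseteq> ?Q (x # xs)" using submodule_sum_upper(2)[OF Y Z] by auto
    moreover have "x \<in> ?Q (x # xs)" using submodule_sum_upper(1)[OF Y Z] Cons.prems by auto
    ultimately show ?case using Cons by auto
  qed simp
  then have "Idl\<^bsub>R\<^esub> (set xs) \<subseteq> ?Q xs"
    using colon_ideal[OF multiples_submodule[OF xs]] by (intro R.genideal_minimal)
  then show ?thesis using r w by blast
qed

context resolution_tower
begin

text \<open>
  Right exactness of \<open>H\<^sup>c\<close>: a class that dies modulo \<open>x\<^sub>1M + \<dots> + x\<^sub>kM\<close> is a combination of multiples \<open>x\<^sub>j \<xi>\<^sub>j\<close> of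
  classes of \<open>H\<^sup>c(M)\<close>. The predicate \<open>P\<close> stands for membership of the class of a cocycle in a subgroup
  that contains such multiples. Splitting off one \<open>x\<close> at a time, \<open>g\<close> is cohomologous to \<open>x b\<close> modulo the
  remaining multiples \<open>N\<close>. Here \<open>b\<close> is a cocycle only modulo \<open>C = {w. x w \<in> N}\<close>; as \<open>H\<^bsup>c+1\<^esup>(C) = 0\<close>
  it lifts to a cocycle \<open>b'\<close> with \<open>x b \<equiv> x b'\<close> modulo \<open>N\<close>, and \<open>g - x b'\<close> dies modulo \<open>N\<close>.
\<close>

lemma cocycle_in_multiples:
  assumes M: "module R M" and xs: "set xs \<subseteq> carrier R"
    and van: "\<And>K. submodule K R M \<Longrightarrow> vanishes (Suc c) (M\<lparr>carrier := K\<rparr>) {\<zero>\<^bsub>M\<^esub>}"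
    and P_zero: "\<And>n g. cocycle c n M {\<zero>\<^bsub>M\<^esub>} g \<Longrightarrow> cobounds c n M {\<zero>\<^bsub>M\<^esub>} g \<Longrightarrow> P n g"
    and P_smult: "\<And>n g x. x \<in> set xs \<Longrightarrow> cocycle c n M {\<zero>\<^bsub>M\<^esub>} g \<Longrightarrow> P n (\<lambda>z. x \<odot>\<^bsub>M\<^esub> g z)"
    and P_diff: "\<And>n g g'. cocycle c n M {\<zero>\<^bsub>M\<^esub>} g \<Longrightarrow> cocycle c n M {\<zero>\<^bsub>M\<^esub>} g' \<Longrightarrow>
       P n (\<lambda>z. g z \<ominus>\<^bsub>M\<^esub> g' z) \<Longrightarrow> P n g' \<Longrightarrow> P n g"
    and P_pull: "\<And>n k g. cocycle c n M {\<zero>\<^bsub>M\<^esub>} g \<Longrightarrow> P (n + k) (\<lambda>z. g (phi n k c z)) \<Longrightarrow> P n g"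
    and "cocycle c n M {\<zero>\<^bsub>M\<^esub>} g" "cobounds c n M (multiples M xs) g"
  shows "P n g"
  using xs P_smult assms(8,9)
proof (induction xs arbitrary: n g)
  case Nil
  then show ?case using P_zero by simp
next
  case (Cons x xs)
  interpret M: module R M by fact
  have x: "x \<in> carrier R" and xs: "set xs \<subseteq> carrier R" using Cons.prems(1) by auto
  note g = Cons.prems(3)
  have lin: "linear_map R (T n c) M g" using g by (simp add: cocycle_def)
  have mx: "linear_map R M M (\<lambda>w. x \<odot>\<^bsub>M\<^esub> w)" using M linear_map_ident x by (rule linear_map_smult_map)
  let ?N = "multiples M xs" and ?C = "{w \<in> carrier M. x \<odot>\<^bsub>M\<^esub> w \<in> multiples M xs}"
  have N: "submodule ?N R M" using xs by (rule M.multiples_submodule)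
  have L: "submodule (multiples M (x # xs)) R M" using Cons.prems(1) by (rule M.multiples_submodule)
  have C: "submodule ?C R M" using M mx N by (rule M.submodule_preimage)
  obtain u where u: "linear_map R (T n c) M u"
    and uL: "\<And>w. w \<in> carrier (T n c) \<Longrightarrow> u w \<in> multiples M (x # xs)"
    and ud: "\<And>z. z \<in> carrier (T n (Suc c)) \<Longrightarrow> u (d n c z) = g (d n c z)"
    and gu: "\<And>N. submodule N R M \<Longrightarrow> cobounds c n M N (\<lambda>w. g w \<ominus>\<^bsub>M\<^esub> u w)"
    by (rule cobounds_normalise[OF M L lin Cons.prems(4)]) blast
  obtain b where b: "linear_map R (T n c) M b"
    and ub: "\<And>w. w \<in> carrier (T n c) \<Longrightarrow> cong_mod M ?N (u w) (x \<odot>\<^bsub>M\<^esub> b w)"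
  proof (rule res.term_linear_lift_mod[OF M M N mx u])
    fix w assume "w \<in> carrier (T n c)"
    then obtain a v where av: "a \<in> carrier M" "v \<in> ?N" "u w = x \<odot>\<^bsub>M\<^esub> a \<oplus>\<^bsub>M\<^esub> v" using uL by force
    then have "cong_mod M ?N (u w) (x \<odot>\<^bsub>M\<^esub> a)"
      using M.submodule_closed[OF N] x
      by (simp add: cong_mod_def M.M.a_comm[of "x \<odot>\<^bsub>M\<^esub> a"] M.add_diff_cancel')
    then show "\<exists>a\<in>carrier M. cong_mod M ?N (u w) (x \<odot>\<^bsub>M\<^esub> a)" using av(1) by blast
  qed blast
  have "b (d n c z) \<in> ?C" if z: "z \<in> carrier (T n (Suc c))" for z
  proof -
    have "u (d n c z) = \<zero>\<^bsub>M\<^esub>" using ud[OF z] g z by (simp add: cocycle_def)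
    then have "x \<odot>\<^bsub>M\<^esub> b (d n c z) \<in> ?N"
      using M.cong_mod_mem[OF N ub[OF d_closed[OF z]]] M.submodule_zero[OF N] by simp
    then show ?thesis using linear_map_closed[OF b d_closed[OF z]] by simp
  qed
  then have bC: "cocycle c n M ?C b" using b by (simp add: cocycle_def)
  have zero_C: "{\<zero>\<^bsub>M\<^esub>} \<subseteq> ?C" using M.submodule_zero[OF C] by blast
  obtain k b' where b': "cocycle c (n + k) M {\<zero>\<^bsub>M\<^esub>} b'"
    and bb': "\<And>z. z \<in> carrier (T (n + k) c) \<Longrightarrow> cong_mod M ?C (b' z) (b (phi n k c z))"
    by (rule lift_cocycle[OF M C M.zero_submodule zero_C van[OF C] bC]) blast
  have b'_lin: "linear_map R (T (n + k) c) M b'" using b' by (simp add: cocycle_def)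
  have gk: "cocycle c (n + k) M {\<zero>\<^bsub>M\<^esub>} (\<lambda>z. g (phi n k c z))" using g by (rule cocycle_pull)
  have xb': "cocycle c (n + k) M {\<zero>\<^bsub>M\<^esub>} (\<lambda>z. x \<odot>\<^bsub>M\<^esub> b' z)"
    using b' linear_map_smult_map[OF M b'_lin x] x by (simp add: cocycle_def)
  let ?e = "\<lambda>z. g (phi n k c z) \<ominus>\<^bsub>M\<^esub> x \<odot>\<^bsub>M\<^esub> b' z"
  have e: "cocycle c (n + k) M {\<zero>\<^bsub>M\<^esub>} ?e"
    using gk xb' linear_map_diff_maps[OF M] by (auto simp: cocycle_def M.diff_self)
  have "cobounds c (n + k) M ?N (\<lambda>w. g (phi n k c w) \<ominus>\<^bsub>M\<^esub> u (phi n k c w))"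
    using cobounds_pull[OF gu[OF N]] .
  then have "cobounds c (n + k) M ?N ?e"
  proof (rule cobounds_cong_mod[OF M N])
    fix z assume z: "z \<in> carrier (T (n + k) c)"
    let ?p = "phi n k c z"
    have p: "?p \<in> carrier (T n c)" using phi_closed[OF z] .
    have "b' z \<ominus>\<^bsub>M\<^esub> b ?p \<in> ?C" and bc: "b' z \<in> carrier M" "b ?p \<in> carrier M"
      using bb'[OF z] by (auto simp: cong_mod_def)
    then have "cong_mod M ?N (x \<odot>\<^bsub>M\<^esub> b' z) (x \<odot>\<^bsub>M\<^esub> b ?p)"
      using x by (simp add: cong_mod_def M.smult_diff)
    then have "cong_mod M ?N (x \<odot>\<^bsub>M\<^esub> b' z) (u ?p)"
      using ub[OF p] M.cong_mod_trans[OF N] M.cong_mod_sym[OF N] by blast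
    then show "cong_mod M ?N (?e z) (g ?p \<ominus>\<^bsub>M\<^esub> u ?p)"
      using M.cong_mod_refl[OF N linear_map_closed[OF lin p]] by (intro M.cong_mod_diff[OF N])
  qed
  with e have "P (n + k) ?e" using Cons.IH[OF xs] Cons.prems(2) by auto
  moreover have "P (n + k) (\<lambda>z. x \<odot>\<^bsub>M\<^esub> b' z)" using Cons.prems(2) b' by simp
  ultimately have "P (n + k) (\<lambda>z. g (phi n k c z))" by (rule P_diff[OF gk xb'])
  with g show "P n g" by (rule P_pull)
qed

end

section \<open>Direct limits\<close>

lemma UN_pair_const:
  assumes "(k, u) \<in> X" "\<And>k u. (k, u) \<in> X \<Longrightarrow> F k u = c"
  shows "(\<Union>(k, u)\<in>X. F k u) = c"
proof
  show "(\<Union>(k, u)\<in>X. F k u) \<subseteq> c" using assms(2) by blast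
  show "c \<subseteq> (\<Union>(k, u)\<in>X. F k u)" using assms(2)[OF assms(1)] assms(1) by blast
qed

locale direct_system = cring R for R :: "('a, 'r) ring_scheme" (structure) +
  fixes A :: "nat \<Rightarrow> ('a, 'b, 'm) module_scheme" and f :: "nat \<Rightarrow> 'b \<Rightarrow> 'b"
  assumes system_module: "module R (A n)" and system_map: "linear_map R (A n) (A (Suc n)) (f n)"
begin

lemma iter_map_linear: "linear_map R (A n) (A (n + k)) (iter_map f n k)"
proof (induction k)
  case 0
  then show ?case by (simp add: linear_map_def)
next
  case (Suc k)
  then show ?case using linear_map_compose[OF Suc system_map] by (simp add: linear_map_def)
qed

lemma iter_map_add: "iter_map f n (k + l) x = iter_map f (n + k) l (iter_map f n k x)"
  by (induction l) (simp_all add: add.assoc)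

text \<open>
  Indexing the composite by its target instead of the number of steps makes representatives at a
  common level easy to compare. The truncated subtraction is exact for targets at or above the source.
\<close>

definition up :: "nat \<Rightarrow> nat \<Rightarrow> 'b \<Rightarrow> 'b" where "up n p = iter_map f n (p - n)"

lemma up_self [simp]: "up n n x = x"
  by (simp add: up_def)

lemma up_linear: "n \<le> p \<Longrightarrow> linear_map R (A n) (A p) (up n p)"
  using iter_map_linear[of n "p - n"] by (simp add: up_def)

lemma up_closed: "n \<le> p \<Longrightarrow> x \<in> carrier (A n) \<Longrightarrow> up n p x \<in> carrier (A p)"
  using up_linear by (rule linear_map_closed)

lemma up_up: "n \<le> p \<Longrightarrow> p \<le> q \<Longrightarrow> up p q (up n p x) = up n q x"
  using iter_map_add[of n "p - n" "q - p" x] by (simp add: up_def)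

lemma limit_class_mem:
  "(m, y) \<in> limit_class A f n x \<longleftrightarrow> y \<in> carrier (A m) \<and> (\<exists>p. n \<le> p \<and> m \<le> p \<and> up n p x = up m p y)"
proof -
  have "(\<exists>k l. n + k = m + l \<and> iter_map f n k x = iter_map f m l y) \<longleftrightarrow>
      (\<exists>p. n \<le> p \<and> m \<le> p \<and> up n p x = up m p y)" (is "?l \<longleftrightarrow> ?r")
  proof
    assume ?l
    then obtain k l where "n + k = m + l" "iter_map f n k x = iter_map f m l y" by blast
    then show ?r unfolding up_def by (intro exI[of _ "n + k"]) (metis add_diff_cancel_left' le_add1)
  next
    assume ?r
    then obtain p where "n \<le> p" "m \<le> p" "up n p x = up m p y" by blast
    then show ?l unfolding up_def by (intro exI[of _ "p - n"] exI[of _ "p - m"]) simp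
  qed
  then show ?thesis by (simp add: limit_class_def)
qed

lemma limit_class_eq_iff:
  assumes "x \<in> carrier (A n)" "y \<in> carrier (A m)"
  shows "limit_class A f n x = limit_class A f m y \<longleftrightarrow> (\<exists>p. n \<le> p \<and> m \<le> p \<and> up n p x = up m p y)"
proof
  assume "limit_class A f n x = limit_class A f m y"
  moreover have "(m, y) \<in> limit_class A f m y" using assms(2) limit_class_mem by blast
  ultimately show "\<exists>p. n \<le> p \<and> m \<le> p \<and> up n p x = up m p y" using limit_class_mem by metis
next
  assume "\<exists>p. n \<le> p \<and> m \<le> p \<and> up n p x = up m p y"
  then obtain p where p: "n \<le> p" "m \<le> p" "up n p x = up m p y" by blast
  have "(\<exists>q. n \<le> q \<and> l \<le> q \<and> up n q x = up l q z) \<longleftrightarrow> (\<exists>q. m \<le> q \<and> l \<le> q \<and> up m q y = up l q z)" for l z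
  proof -
    have *: "\<exists>q. n' \<le> q \<and> l \<le> q \<and> up n' q x' = up l q z"
      if "m' \<le> q" "l \<le> q" "up m' q y' = up l q z" "n' \<le> p" "m' \<le> p" "up n' p x' = up m' p y'"
      for q n' m' x' y'
    proof -
      let ?q = "max p q"
      have "up n' ?q x' = up m' ?q y'"
        using up_up[of n' p ?q x'] up_up[of m' p ?q y'] that by simp
      also have "\<dots> = up l ?q z"
        using up_up[of m' q ?q y'] up_up[of l q ?q z] that by simp
      finally show ?thesis using that by (intro exI[of _ ?q]) auto
    qed
    show ?thesis using *[of m _ y n x] *[of n _ x m y] p by metis
  qed
  then show "limit_class A f n x = limit_class A f m y"
    by (auto simp: limit_class_mem)
qed

lemma limit_class_up:
  assumes "x \<in> carrier (A n)" "n \<le> p"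
  shows "limit_class A f p (up n p x) = limit_class A f n x"
  using assms limit_class_eq_iff[OF up_closed[OF assms(2,1)] assms(1)] by auto

lemma limit_class_memD:
  assumes "(m, y) \<in> limit_class A f n x" "x \<in> carrier (A n)"
  shows "y \<in> carrier (A m)" "limit_class A f m y = limit_class A f n x"
  using assms limit_class_mem limit_class_eq_iff by metis+

lemma limit_class_self: "x \<in> carrier (A n) \<Longrightarrow> (n, x) \<in> limit_class A f n x"
  using limit_class_mem by blast

abbreviation L :: "('a, (nat \<times> 'b) set) module" where "L \<equiv> direct_limit A f"

lemma limit_carrier: "carrier L = {limit_class A f n x | n x. x \<in> carrier (A n)}"
  by (simp add: direct_limit_def)

lemma limit_carrierI: "x \<in> carrier (A n) \<Longrightarrow> limit_class A f n x \<in> carrier L"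
  by (auto simp: limit_carrier)

lemma limit_zero: "limit_class A f n \<zero>\<^bsub>A n\<^esub> = \<zero>\<^bsub>L\<^esub>"
proof -
  interpret A0: module R "A 0" by (rule system_module)
  have "up 0 n \<zero>\<^bsub>A 0\<^esub> = \<zero>\<^bsub>A n\<^esub>"
    by (rule linear_map_zero[OF system_module system_module up_linear]) simp
  then show ?thesis using limit_class_up[of "\<zero>\<^bsub>A 0\<^esub>" 0 n] by (simp add: direct_limit_def)
qed

lemma limit_class_eq_zero_iff:
  assumes "x \<in> carrier (A n)"
  shows "limit_class A f n x = \<zero>\<^bsub>L\<^esub> \<longleftrightarrow> (\<exists>k. iter_map f n k x = \<zero>\<^bsub>A (n + k)\<^esub>)"
proof -
  interpret An: module R "A n" by (rule system_module)
  have up0: "up n p \<zero>\<^bsub>A n\<^esub> = \<zero>\<^bsub>A p\<^esub>" if "n \<le> p" for p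
    using linear_map_zero[OF system_module system_module up_linear[OF that]] .
  have "limit_class A f n x = \<zero>\<^bsub>L\<^esub> \<longleftrightarrow> (\<exists>p. n \<le> p \<and> up n p x = \<zero>\<^bsub>A p\<^esub>)"
    using limit_class_eq_iff[OF assms An.M.zero_closed] limit_zero[of n] up0 by metis
  also have "\<dots> \<longleftrightarrow> (\<exists>k. iter_map f n k x = \<zero>\<^bsub>A (n + k)\<^esub>)"
    unfolding up_def by (metis add_diff_cancel_left' le_add1 le_add_diff_inverse)
  finally show ?thesis .
qed

lemma limit_add_aux:
  assumes "x \<in> carrier (A n)" "y \<in> carrier (A n)" "x' \<in> carrier (A m)" "y' \<in> carrier (A m)"
    and "limit_class A f n x = limit_class A f m x'" "limit_class A f n y = limit_class A f m y'"
  shows "limit_class A f n (x \<oplus>\<^bsub>A n\<^esub> y) = limit_class A f m (x' \<oplus>\<^bsub>A m\<^esub> y')"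
proof -
  interpret An: module R "A n" by (rule system_module)
  interpret Am: module R "A m" by (rule system_module)
  obtain p q where p: "n \<le> p" "m \<le> p" "up n p x = up m p x'" and q: "n \<le> q" "m \<le> q" "up n q y = up m q y'"
    using assms limit_class_eq_iff by metis
  let ?r = "max p q"
  have "up n ?r x = up m ?r x'" "up n ?r y = up m ?r y'"
    using up_up[of n p ?r x] up_up[of m p ?r x'] up_up[of n q ?r y] up_up[of m q ?r y'] p q by simp_all
  then have "up n ?r (x \<oplus>\<^bsub>A n\<^esub> y) = up m ?r (x' \<oplus>\<^bsub>A m\<^esub> y')"
    using linear_map_add[OF up_linear[of n ?r] assms(1,2)] linear_map_add[OF up_linear[of m ?r] assms(3,4)] p
    by simp
  then show ?thesis
    using limit_class_eq_iff[of "x \<oplus>\<^bsub>A n\<^esub> y" n "x' \<oplus>\<^bsub>A m\<^esub> y'" m] assms p by (metis An.M.a_closed Am.M.a_closed max.coboundedI1)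
qed

text \<open>
  The sum of two classes is defined through all pairs of representatives; by the preceding lemma it
  does not depend on them, and it may be computed at any common level.
\<close>

lemma limit_add:
  assumes "x \<in> carrier (A n)" "y \<in> carrier (A n)"
  shows "limit_class A f n x \<oplus>\<^bsub>L\<^esub> limit_class A f n y = limit_class A f n (x \<oplus>\<^bsub>A n\<^esub> y)"
proof -
  let ?X = "limit_class A f n x" and ?Y = "limit_class A f n y"
  have "limit_class A f (k + m) (iter_map f k m u \<oplus>\<^bsub>A (k + m)\<^esub> iter_map f m k v) =
      limit_class A f n (x \<oplus>\<^bsub>A n\<^esub> y)" if "(k, u) \<in> ?X" "(m, v) \<in> ?Y" for k u m v
  proof -
    note u = limit_class_memD[OF that(1) assms(1)] and v = limit_class_memD[OF that(2) assms(2)]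
    have i: "iter_map f k m u = up k (k + m) u" "iter_map f m k v = up m (k + m) v" by (simp_all add: up_def)
    show ?thesis
      unfolding i using u v assms
      by (intro limit_add_aux up_closed) (simp_all add: limit_class_up)
  qed
  then have "(\<Union>(k, u)\<in>?X. \<Union>(m, v)\<in>?Y. limit_class A f (k + m)
      (iter_map f k m u \<oplus>\<^bsub>A (k + m)\<^esub> iter_map f m k v)) = limit_class A f n (x \<oplus>\<^bsub>A n\<^esub> y)"
    by (intro UN_pair_const[OF limit_class_self[OF assms(1)]] UN_pair_const[OF limit_class_self[OF assms(2)]])
  then show ?thesis by (simp add: direct_limit_def)
qed

lemma limit_smult:
  assumes "r \<in> carrier R" "x \<in> carrier (A n)"
  shows "r \<odot>\<^bsub>L\<^esub> limit_class A f n x = limit_class A f n (r \<odot>\<^bsub>A n\<^esub> x)"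
proof -
  let ?X = "limit_class A f n x"
  interpret An: module R "A n" by (rule system_module)
  have "limit_class A f m (r \<odot>\<^bsub>A m\<^esub> y) = limit_class A f n (r \<odot>\<^bsub>A n\<^esub> x)" if my: "(m, y) \<in> ?X" for m y
  proof -
    interpret Am: module R "A m" by (rule system_module)
    have y: "y \<in> carrier (A m)" using limit_class_memD[OF my assms(2)] by simp
    obtain p where p: "n \<le> p" "m \<le> p" "up n p x = up m p y" using my limit_class_mem by blast
    have "up m p (r \<odot>\<^bsub>A m\<^esub> y) = up n p (r \<odot>\<^bsub>A n\<^esub> x)"
      using p linear_map_smult[OF up_linear[OF p(1)] assms] linear_map_smult[OF up_linear[OF p(2)] assms(1) y]
      by simp
    then show ?thesis
      using p limit_class_eq_iff[of "r \<odot>\<^bsub>A m\<^esub> y" m "r \<odot>\<^bsub>A n\<^esub> x" n] assms y by blast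
  qed
  then have "(\<Union>(m, y)\<in>?X. limit_class A f m (r \<odot>\<^bsub>A m\<^esub> y)) = limit_class A f n (r \<odot>\<^bsub>A n\<^esub> x)"
    by (intro UN_pair_const[OF limit_class_self[OF assms(2)]])
  then show ?thesis by (simp add: direct_limit_def)
qed

lemma limit_common_level:
  assumes "X \<in> carrier L" "Y \<in> carrier L" "W \<in> carrier L"
  obtains n x y w where "x \<in> carrier (A n)" "y \<in> carrier (A n)" "w \<in> carrier (A n)"
    "X = limit_class A f n x" "Y = limit_class A f n y" "W = limit_class A f n w"
proof -
  obtain i j k x y w where *: "x \<in> carrier (A i)" "y \<in> carrier (A j)" "w \<in> carrier (A k)"
    "X = limit_class A f i x" "Y = limit_class A f j y" "W = limit_class A f k w"
    using assms by (auto simp: limit_carrier)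
  let ?n = "i + j + k"
  show thesis
    by (rule that[of "up i ?n x" ?n "up j ?n y" "up k ?n w"])
      (use * in \<open>auto intro: up_closed simp: limit_class_up\<close>)
qed

lemma limit_is_module: "module R L"
proof (rule moduleI)
  show "abelian_group L"
  proof (rule abelian_groupI)
    show "\<zero>\<^bsub>L\<^esub> \<in> carrier L"
    proof -
      interpret A0: module R "A 0" by (rule system_module)
      show ?thesis using limit_carrierI[OF A0.M.zero_closed] limit_zero[of 0] by simp
    qed
    fix X Y assume XY: "X \<in> carrier L" "Y \<in> carrier L"
    obtain n x y where *: "x \<in> carrier (A n)" "y \<in> carrier (A n)"
      "X = limit_class A f n x" "Y = limit_class A f n y"
      using limit_common_level[OF XY XY(1)] by metis
    interpret A: module R "A n" by (rule system_module)
    show "X \<oplus>\<^bsub>L\<^esub> Y \<in> carrier L" using * by (simp add: limit_add limit_carrierI)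
    show "X \<oplus>\<^bsub>L\<^esub> Y = Y \<oplus>\<^bsub>L\<^esub> X" using * by (simp add: limit_add A.M.a_comm)
    show "\<zero>\<^bsub>L\<^esub> \<oplus>\<^bsub>L\<^esub> X = X" using * by (simp add: limit_add limit_zero[of n, symmetric])
    show "\<exists>y\<in>carrier L. y \<oplus>\<^bsub>L\<^esub> X = \<zero>\<^bsub>L\<^esub>"
      using * by (intro bexI[of _ "limit_class A f n (\<ominus>\<^bsub>A n\<^esub> x)"])
        (simp_all add: limit_add limit_zero[of n, symmetric] limit_carrierI A.M.l_neg)
  next
    fix X Y W assume XYW: "X \<in> carrier L" "Y \<in> carrier L" "W \<in> carrier L"
    obtain n x y w where *: "x \<in> carrier (A n)" "y \<in> carrier (A n)" "w \<in> carrier (A n)"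
      "X = limit_class A f n x" "Y = limit_class A f n y" "W = limit_class A f n w"
      using limit_common_level[OF XYW] by metis
    interpret A: module R "A n" by (rule system_module)
    show "X \<oplus>\<^bsub>L\<^esub> Y \<oplus>\<^bsub>L\<^esub> W = X \<oplus>\<^bsub>L\<^esub> (Y \<oplus>\<^bsub>L\<^esub> W)"
      using * by (simp add: limit_add A.M.a_assoc)
  qed
next
  fix r s X Y assume rs: "r \<in> carrier R" "s \<in> carrier R" and XY: "X \<in> carrier L" "Y \<in> carrier L"
  obtain n x y where *: "x \<in> carrier (A n)" "y \<in> carrier (A n)"
    "X = limit_class A f n x" "Y = limit_class A f n y"
    using limit_common_level[OF XY XY(1)] by metis
  interpret A: module R "A n" by (rule system_module)
  show "r \<odot>\<^bsub>L\<^esub> X \<in> carrier L" using * rs by (simp add: limit_smult limit_carrierI)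
  show "(r \<oplus> s) \<odot>\<^bsub>L\<^esub> X = r \<odot>\<^bsub>L\<^esub> X \<oplus>\<^bsub>L\<^esub> s \<odot>\<^bsub>L\<^esub> X"
    using * rs by (simp add: limit_smult limit_add A.smult_l_distr)
  show "r \<odot>\<^bsub>L\<^esub> (X \<oplus>\<^bsub>L\<^esub> Y) = r \<odot>\<^bsub>L\<^esub> X \<oplus>\<^bsub>L\<^esub> r \<odot>\<^bsub>L\<^esub> Y"
    using * rs by (simp add: limit_smult limit_add A.smult_r_distr)
  show "(r \<otimes> s) \<odot>\<^bsub>L\<^esub> X = r \<odot>\<^bsub>L\<^esub> (s \<odot>\<^bsub>L\<^esub> X)"
    using * rs by (simp add: limit_smult A.smult_assoc1)
next
  fix X assume X: "X \<in> carrier L"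
  then obtain n x where *: "x \<in> carrier (A n)" "X = limit_class A f n x" by (auto simp: limit_carrier)
  interpret A: module R "A n" by (rule system_module)
  show "\<one> \<odot>\<^bsub>L\<^esub> X = X" using * by (simp add: limit_smult)
qed (rule is_cring)

end

section \<open>Cochain modules\<close>

lemma Hom_module_simps:
  "carrier (Hom_module R A B) = mod_hom R A B"
  "\<zero>\<^bsub>Hom_module R A B\<^esub> = (\<lambda>x\<in>carrier A. \<zero>\<^bsub>B\<^esub>)"
  "g \<oplus>\<^bsub>Hom_module R A B\<^esub> h = (\<lambda>x\<in>carrier A. g x \<oplus>\<^bsub>B\<^esub> h x)"
  "r \<odot>\<^bsub>Hom_module R A B\<^esub> h = (\<lambda>x\<in>carrier A. r \<odot>\<^bsub>B\<^esub> h x)"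
  by (simp_all add: Hom_module_def)

lemma linear_map_const_zero:
  assumes "module R B" shows "linear_map R A B (\<lambda>x. \<zero>\<^bsub>B\<^esub>)"
proof -
  interpret B: module R B by fact
  show ?thesis by (simp add: linear_map_def)
qed

lemma Hom_module_is_module:
  assumes A: "module R A" and B: "module R B"
  shows "module R (Hom_module R A B)"
proof -
  interpret B: module R B by fact
  have val: "h x \<in> carrier B" if "h \<in> mod_hom R A B" "x \<in> carrier A" for h x
    using that by (auto simp: mod_hom_def)
  have und: "h x = undefined" if "h \<in> mod_hom R A B" "x \<notin> carrier A" for h x
    using that by (auto simp: mod_hom_def PiE_iff extensional_def)
  have lin: "linear_map R A B h" if "h \<in> mod_hom R A B" for h
    using that by (simp add: mod_hom_iff)
  have smult: "(\<lambda>x\<in>carrier A. r \<odot>\<^bsub>B\<^esub> h x) \<in> mod_hom R A B"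
    if "r \<in> carrier R" "h \<in> mod_hom R A B" for r h
    using mod_hom_restrict[OF A linear_map_smult_map[OF B lin[OF that(2)] that(1)]] .
  show ?thesis
  proof (rule moduleI)
    show "abelian_group (Hom_module R A B)"
    proof (rule abelian_groupI)
      fix g h assume gh: "g \<in> carrier (Hom_module R A B)" "h \<in> carrier (Hom_module R A B)"
      then show "g \<oplus>\<^bsub>Hom_module R A B\<^esub> h \<in> carrier (Hom_module R A B)"
        using mod_hom_restrict[OF A linear_map_add_maps[OF B]] lin by (simp add: Hom_module_simps)
      show "g \<oplus>\<^bsub>Hom_module R A B\<^esub> h = h \<oplus>\<^bsub>Hom_module R A B\<^esub> g"
        using gh val by (auto simp: Hom_module_simps fun_eq_iff B.M.a_comm)
      show "\<zero>\<^bsub>Hom_module R A B\<^esub> \<oplus>\<^bsub>Hom_module R A B\<^esub> g = g"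
        using gh val by (auto simp: Hom_module_simps fun_eq_iff intro: und[symmetric])
      show "\<exists>k\<in>carrier (Hom_module R A B). k \<oplus>\<^bsub>Hom_module R A B\<^esub> g = \<zero>\<^bsub>Hom_module R A B\<^esub>"
        using gh val smult[of "\<ominus>\<^bsub>R\<^esub> \<one>\<^bsub>R\<^esub>" g]
        by (intro bexI[of _ "\<lambda>x\<in>carrier A. (\<ominus>\<^bsub>R\<^esub> \<one>\<^bsub>R\<^esub>) \<odot>\<^bsub>B\<^esub> g x"])
          (auto simp: Hom_module_simps fun_eq_iff B.smult_l_minus B.M.l_neg)
    next
      show "\<zero>\<^bsub>Hom_module R A B\<^esub> \<in> carrier (Hom_module R A B)"
        using mod_hom_restrict[OF A linear_map_const_zero[OF B]] by (simp add: Hom_module_simps)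
    next
      fix g h k assume "g \<in> carrier (Hom_module R A B)" "h \<in> carrier (Hom_module R A B)"
        "k \<in> carrier (Hom_module R A B)"
      then show "g \<oplus>\<^bsub>Hom_module R A B\<^esub> h \<oplus>\<^bsub>Hom_module R A B\<^esub> k =
          g \<oplus>\<^bsub>Hom_module R A B\<^esub> (h \<oplus>\<^bsub>Hom_module R A B\<^esub> k)"
        using val by (auto simp: Hom_module_simps fun_eq_iff B.M.a_assoc)
    qed
  qed (use val smult in \<open>auto simp: B.R.is_cring Hom_module_simps fun_eq_iff B.smult_l_distr
      B.smult_r_distr B.smult_assoc1 intro: und[symmetric]\<close>)
qed

section \<open>Ext and local cohomology\<close>

text \<open>
  The bridge from the pairs \<open>W\<close>, \<open>N\<close> to the definitions of Ext and local cohomology, where coefficients are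
  a module \<open>M\<close>, that is \<open>W = M\<close> and \<open>N = 0\<close>, and cochains are extensional.
\<close>

locale tower_coefficients = resolution_tower R \<aa> F \<phi>
  for R :: "('a, 'r) ring_scheme" (structure) and \<aa> and F and \<phi> +
  fixes M :: "('a, 'b, 'm) module_scheme"
  assumes coefficients: "module R M"
begin

sublocale M: module R M by (rule coefficients)

abbreviation C :: "nat \<Rightarrow> nat \<Rightarrow> ('a, (nat \<Rightarrow> 'a) \<Rightarrow> 'b) module" where
  "C n i \<equiv> cochain_module R (F n) i M"
abbreviation Z :: "nat \<Rightarrow> nat \<Rightarrow> ((nat \<Rightarrow> 'a) \<Rightarrow> 'b) set" where
  "Z n i \<equiv> cocycles R (F n) i M"
abbreviation B :: "nat \<Rightarrow> nat \<Rightarrow> ((nat \<Rightarrow> 'a) \<Rightarrow> 'b) set" where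
  "B n i \<equiv> coboundaries R (F n) i M"
abbreviation closed :: "nat \<Rightarrow> nat \<Rightarrow> ((nat \<Rightarrow> 'a) \<Rightarrow> 'b) \<Rightarrow> bool" where
  "closed n i \<equiv> cocycle i n M {\<zero>\<^bsub>M\<^esub>}"
abbreviation exact :: "nat \<Rightarrow> nat \<Rightarrow> ((nat \<Rightarrow> 'a) \<Rightarrow> 'b) \<Rightarrow> bool" where
  "exact n i \<equiv> cobounds i n M {\<zero>\<^bsub>M\<^esub>}"
abbreviation restr :: "nat \<Rightarrow> nat \<Rightarrow> ((nat \<Rightarrow> 'a) \<Rightarrow> 'b) \<Rightarrow> (nat \<Rightarrow> 'a) \<Rightarrow> 'b" where
  "restr n i g \<equiv> restrict g (carrier (T n i))"

lemma cong_mod_zero_iff: "cong_mod M {\<zero>\<^bsub>M\<^esub>} x y \<longleftrightarrow> x \<in> carrier M \<and> x = y"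
  using M.diff_eq_zero M.diff_self by (auto simp: cong_mod_def)

lemma closed_agree:
  assumes "closed n i g" "\<And>z. z \<in> carrier (T n i) \<Longrightarrow> g' z = g z"
  shows "closed n i g'"
proof -
  interpret V: module R "T n i" by (rule res.term_is_module)
  show ?thesis using assms d_closed by (auto simp: cocycle_def linear_map_def)
qed

lemma exact_agree:
  assumes "exact n i g" "\<And>z. z \<in> carrier (T n i) \<Longrightarrow> g' z = g z"
  shows "exact n i g'"
proof (cases i)
  case 0
  then show ?thesis using assms by auto
next
  case (Suc j)
  then show ?thesis using assms unfolding Suc cobounds.simps by metis
qed

lemma closed_add: "closed n i g \<Longrightarrow> closed n i h \<Longrightarrow> closed n i (\<lambda>z. g z \<oplus>\<^bsub>M\<^esub> h z)"
  using linear_map_add_maps[OF coefficients] by (auto simp: cocycle_def)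

lemma closed_smult: "closed n i g \<Longrightarrow> r \<in> carrier R \<Longrightarrow> closed n i (\<lambda>z. r \<odot>\<^bsub>M\<^esub> g z)"
  using linear_map_smult_map[OF coefficients] by (auto simp: cocycle_def)

lemma exact_zero: "(\<And>z. z \<in> carrier (T n i) \<Longrightarrow> g z = \<zero>\<^bsub>M\<^esub>) \<Longrightarrow> exact n i g"
  by (cases i)
    (auto simp: cong_mod_zero_iff intro!: exI[of _ "\<lambda>z. \<zero>\<^bsub>M\<^esub>"] linear_map_const_zero[OF coefficients])

lemma C_is_module: "module R (C n i)"
  unfolding cochain_module_def using res.term_is_module coefficients by (rule Hom_module_is_module)

lemmas C_simps = Hom_module_simps[of R "term_module R (F n) i" M for n i, folded cochain_module_def]

lemma cocycles_iff: "g \<in> Z n i \<longleftrightarrow> g \<in> extensional (carrier (T n i)) \<and> closed n i g"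
proof -
  have "cobdry R (F n) i g = \<zero>\<^bsub>C n (Suc i)\<^esub> \<longleftrightarrow> (\<forall>z\<in>carrier (T n (Suc i)). g (d n i z) = \<zero>\<^bsub>M\<^esub>)"
    by (auto simp: cobdry_def C_simps compose_def fun_eq_iff)
  then show ?thesis
    by (auto simp: cocycles_def a_kernel_def' C_simps mod_hom_iff cocycle_def)
qed

lemma coboundaries_iff:
  "g \<in> B n i \<longleftrightarrow> g \<in> extensional (carrier (T n i)) \<and> linear_map R (T n i) M g \<and> exact n i g"
proof (cases i)
  case 0
  interpret V: module R "T n 0" by (rule res.term_is_module)
  have "g = (\<lambda>x\<in>carrier (T n 0). \<zero>\<^bsub>M\<^esub>) \<longleftrightarrow>
      g \<in> extensional (carrier (T n 0)) \<and> linear_map R (T n 0) M g \<and> (\<forall>z\<in>carrier (T n 0). g z = \<zero>\<^bsub>M\<^esub>)"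
  proof
    assume "g = (\<lambda>x\<in>carrier (T n 0). \<zero>\<^bsub>M\<^esub>)"
    then show "g \<in> extensional (carrier (T n 0)) \<and> linear_map R (T n 0) M g \<and> (\<forall>z\<in>carrier (T n 0). g z = \<zero>\<^bsub>M\<^esub>)"
      by (auto simp: linear_map_def)
  next
    assume "g \<in> extensional (carrier (T n 0)) \<and> linear_map R (T n 0) M g \<and> (\<forall>z\<in>carrier (T n 0). g z = \<zero>\<^bsub>M\<^esub>)"
    then show "g = (\<lambda>x\<in>carrier (T n 0). \<zero>\<^bsub>M\<^esub>)" by (auto simp: fun_eq_iff extensional_def)
  qed
  then show ?thesis unfolding 0 by (simp add: C_simps)
next
  case (Suc j)
  interpret V: module R "T n (Suc j)" by (rule res.term_is_module)
  show ?thesis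
  proof
    assume "g \<in> B n i"
    then obtain h where h: "h \<in> mod_hom R (T n j) M" "g = cobdry R (F n) j h"
      unfolding Suc by (auto simp: C_simps)
    then have lin: "linear_map R (T n j) M h" by (simp add: mod_hom_iff)
    have g: "g = restrict (\<lambda>z. h (d n j z)) (carrier (T n (Suc j)))"
      unfolding h(2) cobdry_def compose_def ..
    have "g \<in> mod_hom R (T n (Suc j)) M"
      unfolding g by (rule mod_hom_restrict[OF res.term_is_module linear_map_compose[OF d_linear lin]])
    moreover have "exact n (Suc j) g"
      unfolding cobounds.simps
      using lin linear_map_closed[OF lin d_closed] by (auto simp: cong_mod_zero_iff g)
    ultimately show "g \<in> extensional (carrier (T n i)) \<and> linear_map R (T n i) M g \<and> exact n i g"
      unfolding Suc by (simp only: mod_hom_iff)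
  next
    assume g: "g \<in> extensional (carrier (T n i)) \<and> linear_map R (T n i) M g \<and> exact n i g"
    then obtain h where lin: "linear_map R (T n j) M h"
      and gh: "\<And>z. z \<in> carrier (T n (Suc j)) \<Longrightarrow> g z = h (d n j z)"
      unfolding Suc by (auto simp: cong_mod_zero_iff)
    have "g = cobdry R (F n) j (restr n j h)"
      using g gh d_closed unfolding Suc cobdry_def compose_def
      by (auto simp: fun_eq_iff extensional_def)
    moreover have "restr n j h \<in> carrier (C n j)"
      unfolding C_simps by (rule mod_hom_restrict[OF res.term_is_module lin])
    ultimately show "g \<in> B n i" unfolding Suc by simp
  qed
qed

lemma cobdry_linear: "linear_map R (C n i) (C n (Suc i)) (cobdry R (F n) i)"
proof -
  have "cobdry R (F n) i g \<in> carrier (C n (Suc i))" if "g \<in> carrier (C n i)" for g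
    using that mod_hom_restrict[OF res.term_is_module linear_map_compose[OF d_linear]]
    unfolding C_simps cobdry_def compose_def mod_hom_iff by blast
  then show ?thesis
    unfolding linear_map_def
    by (auto simp: C_simps cobdry_def compose_def fun_eq_iff d_closed)
qed

lemma Z_submodule: "submodule (Z n i) R (C n i)"
proof -
  have "Z n i = {g \<in> carrier (C n i). cobdry R (F n) i g \<in> {\<zero>\<^bsub>C n (Suc i)\<^esub>}}"
    by (simp add: cocycles_def a_kernel_def')
  then show ?thesis
    using module.submodule_preimage[OF C_is_module C_is_module cobdry_linear
        module.zero_submodule[OF C_is_module]] by simp
qed

lemma exact_imp_closed:
  assumes "linear_map R (T n i) M g" "exact n i g" shows "closed n i g"
proof (cases i)
  case 0
  then show ?thesis using assms d_closed by (auto simp: cocycle_def)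
next
  case (Suc j)
  with assms obtain h where lin: "linear_map R (T n j) M h"
    and gh: "\<And>z. z \<in> carrier (T n (Suc j)) \<Longrightarrow> g z = h (d n j z)"
    by (auto simp: cong_mod_zero_iff)
  have "g (d n i z) = \<zero>\<^bsub>M\<^esub>" if z: "z \<in> carrier (T n (Suc i))" for z
    using gh[OF d_closed] z res.bdry_bdry[of z n j] linear_map_zero[OF res.term_is_module coefficients lin]
    unfolding Suc by simp
  then show ?thesis using assms(1) by (simp add: cocycle_def)
qed

lemma B_submodule: "submodule (B n i) R (C n i)"
proof (cases i)
  case 0
  then show ?thesis using module.zero_submodule[OF C_is_module] by simp
next
  case (Suc j)
  then show ?thesis
    using module.submodule_image[OF C_is_module C_is_module cobdry_linear
        module.carrier_is_submodule[OF C_is_module]] by simp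
qed

lemma B_subset_Z: "B n i \<subseteq> Z n i"
  using exact_imp_closed by (auto simp: coboundaries_iff cocycles_iff)

abbreviation ZM :: "nat \<Rightarrow> nat \<Rightarrow> ('a, (nat \<Rightarrow> 'a) \<Rightarrow> 'b) module" where
  "ZM n i \<equiv> (C n i)\<lparr>carrier := Z n i\<rparr>"

definition E :: "nat \<Rightarrow> nat \<Rightarrow> ('a, ((nat \<Rightarrow> 'a) \<Rightarrow> 'b) set) module" where
  "E n i = quot_module (ZM n i) (B n i)"

text \<open>
  The class in Ext of a cocycle that need not be extensional.
\<close>

definition ext_class :: "nat \<Rightarrow> nat \<Rightarrow> ((nat \<Rightarrow> 'a) \<Rightarrow> 'b) \<Rightarrow> ((nat \<Rightarrow> 'a) \<Rightarrow> 'b) set" where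
  "ext_class n i g = B n i +>\<^bsub>ZM n i\<^esub> restr n i g"

text \<open>
  The map induced on Ext by the projection \<open>R/\<aa>\<^bsup>n+2\<^esup> \<rightarrow> R/\<aa>\<^bsup>n+1\<^esup>\<close>, with the degree as first argument
  so that a direct system results for each degree.
\<close>

definition transition :: "nat \<Rightarrow> nat \<Rightarrow> ((nat \<Rightarrow> 'a) \<Rightarrow> 'b) set \<Rightarrow> ((nat \<Rightarrow> 'a) \<Rightarrow> 'b) set" where
  "transition i n = (\<lambda>X\<in>carrier (E n i).
     \<Union>g\<in>X. B (Suc n) i +>\<^bsub>C (Suc n) i\<^esub> compose (carrier (T (Suc n) i)) g (\<phi> n i))"

lemma ZM_is_module: "module R (ZM n i)"
  using Z_submodule C_is_module by (rule submodule.submodule_is_module)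

lemma B_submodule_ZM: "submodule (B n i) R (ZM n i)"
  by (rule module.submodule_of_submodule[OF C_is_module Z_submodule B_submodule B_subset_Z])

lemma E_is_module: "module R (E n i)"
  unfolding E_def by (rule module.quot_module_is_module[OF ZM_is_module B_submodule_ZM])

lemma restr_closed: "closed n i g \<Longrightarrow> restr n i g \<in> carrier (ZM n i)"
  using closed_agree by (auto simp: cocycles_iff)

lemma E_carrier: "carrier (E n i) = {ext_class n i g | g. closed n i g}"
proof -
  have "carrier (E n i) = (\<lambda>g. B n i +>\<^bsub>ZM n i\<^esub> g) ` Z n i"
    unfolding E_def using module.quot_module_carrier[OF ZM_is_module] by simp
  also have "\<dots> = {ext_class n i g | g. closed n i g}"
  proof (intro equalityI subsetI)
    fix X assume "X \<in> (\<lambda>g. B n i +>\<^bsub>ZM n i\<^esub> g) ` Z n i"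
    then obtain g where g: "g \<in> Z n i" "X = B n i +>\<^bsub>ZM n i\<^esub> g" by blast
    then have "X = ext_class n i g" by (simp add: ext_class_def cocycles_iff extensional_restrict)
    then show "X \<in> {ext_class n i g | g. closed n i g}" using g(1) cocycles_iff by blast
  next
    fix X assume "X \<in> {ext_class n i g | g. closed n i g}"
    then show "X \<in> (\<lambda>g. B n i +>\<^bsub>ZM n i\<^esub> g) ` Z n i"
      using restr_closed by (auto simp: ext_class_def)
  qed
  finally show ?thesis .
qed

lemma ext_class_closed: "closed n i g \<Longrightarrow> ext_class n i g \<in> carrier (E n i)"
  by (auto simp: E_carrier)

lemma ext_class_add:
  assumes "closed n i g" "closed n i h"
  shows "ext_class n i g \<oplus>\<^bsub>E n i\<^esub> ext_class n i h = ext_class n i (\<lambda>z. g z \<oplus>\<^bsub>M\<^esub> h z)"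
proof -
  have "restr n i g \<oplus>\<^bsub>ZM n i\<^esub> restr n i h = restr n i (\<lambda>z. g z \<oplus>\<^bsub>M\<^esub> h z)"
    by (auto simp: C_simps)
  then show ?thesis
    using module.quot_module_add[OF ZM_is_module B_submodule_ZM restr_closed[OF assms(1)] restr_closed[OF assms(2)]]
    by (simp only: E_def ext_class_def)
qed

lemma ext_class_smult:
  assumes "closed n i g" "r \<in> carrier R"
  shows "r \<odot>\<^bsub>E n i\<^esub> ext_class n i g = ext_class n i (\<lambda>z. r \<odot>\<^bsub>M\<^esub> g z)"
proof -
  have "r \<odot>\<^bsub>ZM n i\<^esub> restr n i g = restr n i (\<lambda>z. r \<odot>\<^bsub>M\<^esub> g z)"
    by (auto simp: C_simps)
  then show ?thesis
    using module.quot_module_smult[OF ZM_is_module B_submodule_ZM assms(2) restr_closed[OF assms(1)]]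
    by (simp only: E_def ext_class_def)
qed

lemma ext_class_eq_zero_iff:
  assumes "closed n i g" shows "ext_class n i g = \<zero>\<^bsub>E n i\<^esub> \<longleftrightarrow> exact n i g"
proof -
  interpret ZM: module R "ZM n i" by (rule ZM_is_module)
  have "\<zero>\<^bsub>E n i\<^esub> = B n i +>\<^bsub>ZM n i\<^esub> \<zero>\<^bsub>ZM n i\<^esub>"
    unfolding E_def ZM.quot_module_zero ZM.a_r_coset_zero[OF B_submodule_ZM] ..
  then have "ext_class n i g = \<zero>\<^bsub>E n i\<^esub> \<longleftrightarrow> restr n i g \<in> B n i"
    using ZM.a_r_coset_eq_iff[OF B_submodule_ZM restr_closed[OF assms] ZM.M.zero_closed]
      ZM.cong_mod_zero[OF restr_closed[OF assms]] unfolding ext_class_def by simp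
  also have "\<dots> \<longleftrightarrow> exact n i (restr n i g)"
    using restr_closed[OF assms] by (auto simp: coboundaries_iff cocycles_iff cocycle_def)
  also have "\<dots> \<longleftrightarrow> exact n i g"
    using exact_agree[where g = g and g' = "restr n i g"] exact_agree[where g = "restr n i g" and g' = g]
    by auto
  finally show ?thesis .
qed

lemma pullback_linear:
  "linear_map R (ZM n i) (ZM (Suc n) i) (\<lambda>g. compose (carrier (T (Suc n) i)) g (\<phi> n i))"
proof -
  have "compose (carrier (T (Suc n) i)) g (\<phi> n i) \<in> Z (Suc n) i" if "g \<in> Z n i" for g
  proof -
    have "closed n i g" using that by (simp add: cocycles_iff)
    then have "closed (Suc n) i (\<lambda>z. g (\<phi> n i z))" using cocycle_pull[of i n M _ g 1] by simp
    then show ?thesis using restr_closed by (simp add: compose_def)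
  qed
  then show ?thesis
    unfolding linear_map_def
    by (auto simp: C_simps compose_def fun_eq_iff linear_map_closed[OF \<phi>_linear])
qed

text \<open>
  Composition with the chain map is linear and takes coboundaries to coboundaries, so all
  representatives of a class give the same coset in the union.
\<close>

lemma transition_ext_class:
  assumes g: "closed n i g"
  shows "transition i n (ext_class n i g) = ext_class (Suc n) i (\<lambda>z. g (\<phi> n i z))"
proof -
  interpret ZM: module R "ZM n i" by (rule ZM_is_module)
  interpret ZM': module R "ZM (Suc n) i" by (rule ZM_is_module)
  let ?k = "\<lambda>g. compose (carrier (T (Suc n) i)) g (\<phi> n i)"
  have same: "B (Suc n) i +>\<^bsub>C (Suc n) i\<^esub> h = B (Suc n) i +>\<^bsub>ZM (Suc n) i\<^esub> h" for h
    by (simp add: a_r_coset_def')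
  have "B (Suc n) i +>\<^bsub>ZM (Suc n) i\<^esub> ?k h = B (Suc n) i +>\<^bsub>ZM (Suc n) i\<^esub> ?k (restr n i g)"
    if h: "cong_mod (ZM n i) (B n i) h (restr n i g)" for h
  proof -
    have hZ: "h \<in> carrier (ZM n i)" and gZ: "restr n i g \<in> carrier (ZM n i)"
      and diff: "h \<ominus>\<^bsub>ZM n i\<^esub> restr n i g \<in> B n i"
      using h by (auto simp only: cong_mod_def)
    have "exact n i (h \<ominus>\<^bsub>ZM n i\<^esub> restr n i g)" using diff by (simp add: coboundaries_iff)
    from cobounds_pull[OF this, of 1]
    have "exact (Suc n) i (\<lambda>z. (h \<ominus>\<^bsub>ZM n i\<^esub> restr n i g) (\<phi> n i z))" by simp
    then have "exact (Suc n) i (?k (h \<ominus>\<^bsub>ZM n i\<^esub> restr n i g))"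
      by (rule exact_agree) (simp add: compose_def)
    moreover have "?k (h \<ominus>\<^bsub>ZM n i\<^esub> restr n i g) \<in> Z (Suc n) i"
      using linear_map_closed[OF pullback_linear ZM.M.minus_closed[OF hZ gZ]] by simp
    ultimately have "?k (h \<ominus>\<^bsub>ZM n i\<^esub> restr n i g) \<in> B (Suc n) i"
      by (simp add: coboundaries_iff cocycles_iff cocycle_def)
    then have "cong_mod (ZM (Suc n) i) (B (Suc n) i) (?k h) (?k (restr n i g))"
      unfolding cong_mod_def linear_map_diff[OF ZM_is_module ZM_is_module pullback_linear hZ gZ]
      using linear_map_closed[OF pullback_linear hZ] linear_map_closed[OF pullback_linear gZ] by blast
    then show ?thesis
      using ZM'.a_r_coset_eq_iff[OF B_submodule_ZM] by (auto simp only: cong_mod_def)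
  qed
  then have "(\<Union>h\<in>ext_class n i g. B (Suc n) i +>\<^bsub>ZM (Suc n) i\<^esub> ?k h) =
      B (Suc n) i +>\<^bsub>ZM (Suc n) i\<^esub> ?k (restr n i g)"
    unfolding ext_class_def by (rule ZM.UN_const_coset[OF B_submodule_ZM restr_closed[OF g]])
  moreover have "?k (restr n i g) = restr (Suc n) i (\<lambda>z. g (\<phi> n i z))"
    by (auto simp: compose_def fun_eq_iff linear_map_closed[OF \<phi>_linear])
  ultimately show ?thesis
    using ext_class_closed[OF g] by (simp add: transition_def same ext_class_def)
qed

lemma transition_linear: "linear_map R (E n i) (E (Suc n) i) (transition i n)"
proof -
  have cl: "closed (Suc n) i (\<lambda>z. g (\<phi> n i z))" if "closed n i g" for g
    using cocycle_pull[OF that, of 1] by simp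
  show ?thesis
    unfolding linear_map_def E_carrier
    by (auto simp: transition_ext_class ext_class_add ext_class_smult closed_add closed_smult cl)
qed

end

sublocale tower_coefficients \<subseteq> limit: direct_system R "\<lambda>n. E n i" "transition i" for i
  by (intro direct_system.intro direct_system_axioms.intro is_cring E_is_module transition_linear)

context tower_coefficients
begin

lemma iter_transition_ext_class:
  assumes "closed n i g"
  shows "iter_map (transition i) n k (ext_class n i g) = ext_class (n + k) i (\<lambda>z. g (phi n k i z))"
proof (induction k)
  case (Suc k)
  then show ?case using transition_ext_class[OF cocycle_pull[OF assms]] by simp
qed simp

definition H_class :: "nat \<Rightarrow> nat \<Rightarrow> ((nat \<Rightarrow> 'a) \<Rightarrow> 'b) \<Rightarrow> (nat \<times> ((nat \<Rightarrow> 'a) \<Rightarrow> 'b) set) set" where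
  "H_class i n g = limit_class (\<lambda>n. E n i) (transition i) n (ext_class n i g)"

abbreviation H :: "nat \<Rightarrow> ('a, (nat \<times> ((nat \<Rightarrow> 'a) \<Rightarrow> 'b) set) set) module" where
  "H i \<equiv> direct_limit (\<lambda>n. E n i) (transition i)"

lemma H_carrier: "carrier (H i) = {H_class i n g | n g. closed n i g}"
  unfolding limit.limit_carrier H_class_def by (auto simp: E_carrier)

lemma H_class_add:
  assumes "closed n i g" "closed n i h"
  shows "H_class i n g \<oplus>\<^bsub>H i\<^esub> H_class i n h = H_class i n (\<lambda>z. g z \<oplus>\<^bsub>M\<^esub> h z)"
  unfolding H_class_def using assms by (simp add: limit.limit_add ext_class_closed ext_class_add)

lemma H_class_smult:
  assumes "closed n i g" "r \<in> carrier R"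
  shows "r \<odot>\<^bsub>H i\<^esub> H_class i n g = H_class i n (\<lambda>z. r \<odot>\<^bsub>M\<^esub> g z)"
  unfolding H_class_def using assms by (simp add: limit.limit_smult ext_class_closed ext_class_smult)

lemma H_class_pull:
  assumes "closed n i g"
  shows "H_class i (n + k) (\<lambda>z. g (phi n k i z)) = H_class i n g"
  unfolding H_class_def
  using limit.limit_class_up[OF ext_class_closed[OF assms], of "n + k"] iter_transition_ext_class[OF assms, of k]
  by (simp add: limit.up_def)

lemma H_class_eq_zero_iff:
  assumes "closed n i g"
  shows "H_class i n g = \<zero>\<^bsub>H i\<^esub> \<longleftrightarrow> (\<exists>k. exact (n + k) i (\<lambda>z. g (phi n k i z)))"
  unfolding H_class_def limit.limit_class_eq_zero_iff[OF ext_class_closed[OF assms]]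
    iter_transition_ext_class[OF assms] ext_class_eq_zero_iff[OF cocycle_pull[OF assms]] ..

lemma H_trivial_iff: "carrier (H i) = {\<zero>\<^bsub>H i\<^esub>} \<longleftrightarrow> vanishes i M {\<zero>\<^bsub>M\<^esub>}"
proof -
  interpret H: module R "H i" by (rule limit.limit_is_module)
  have "carrier (H i) = {\<zero>\<^bsub>H i\<^esub>} \<longleftrightarrow> (\<forall>n g. closed n i g \<longrightarrow> H_class i n g = \<zero>\<^bsub>H i\<^esub>)"
  proof
    assume trivial: "carrier (H i) = {\<zero>\<^bsub>H i\<^esub>}"
    show "\<forall>n g. closed n i g \<longrightarrow> H_class i n g = \<zero>\<^bsub>H i\<^esub>"
    proof (intro allI impI)
      fix n g assume "closed n i g"
      then have "H_class i n g \<in> carrier (H i)" unfolding H_carrier by blast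
      then show "H_class i n g = \<zero>\<^bsub>H i\<^esub>" unfolding trivial by simp
    qed
  next
    assume "\<forall>n g. closed n i g \<longrightarrow> H_class i n g = \<zero>\<^bsub>H i\<^esub>"
    then have "carrier (H i) \<subseteq> {\<zero>\<^bsub>H i\<^esub>}" unfolding H_carrier by auto
    then show "carrier (H i) = {\<zero>\<^bsub>H i\<^esub>}" using H.M.zero_closed by blast
  qed
  also have "\<dots> \<longleftrightarrow> vanishes i M {\<zero>\<^bsub>M\<^esub>}"
    unfolding vanishes_def by (intro iff_allI imp_cong refl H_class_eq_zero_iff)
  finally show ?thesis .
qed

end

text \<open>
  Cocycles with values in the module \<open>W/N\<close> lift to maps to \<open>W\<close> because the terms are free, and a map to
  \<open>W\<close> is a cocycle or coboundary modulo \<open>N\<close> exactly if its composite with \<open>W \<rightarrow> W/N\<close> is one.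
\<close>

lemma (in resolution_tower) vanishes_quot_module_iff:
  assumes W: "module R W" "submodule N R W"
  shows "vanishes i (quot_module W N) {\<zero>\<^bsub>quot_module W N\<^esub>} \<longleftrightarrow> vanishes i W N"
proof -
  interpret W: module R W by fact
  let ?Q = "quot_module W N" and ?p = "\<lambda>x. N +>\<^bsub>W\<^esub> x"
  interpret Q: module R ?Q using W(2) by (rule W.quot_module_is_module)
  have p: "linear_map R W ?Q ?p" using W(2) by (rule W.quot_map_linear)
  have p_zero: "?p x = \<zero>\<^bsub>?Q\<^esub> \<longleftrightarrow> x \<in> N" if "x \<in> carrier W" for x
    using W.a_r_coset_eq_iff[OF W(2) that W.M.zero_closed] W.cong_mod_zero[OF that]
      W.a_r_coset_zero[OF W(2)] by (simp add: W.quot_module_zero)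
  have p_cong: "cong_mod ?Q {\<zero>\<^bsub>?Q\<^esub>} (?p x) (?p y) \<longleftrightarrow> cong_mod W N x y"
    if "x \<in> carrier W" "y \<in> carrier W" for x y
    using linear_map_diff[OF W(1) Q.module_axioms p that] p_zero[of "x \<ominus>\<^bsub>W\<^esub> y"] that
      linear_map_closed[OF p] by (simp add: cong_mod_def)
  show ?thesis
  proof
    assume van: "vanishes i ?Q {\<zero>\<^bsub>?Q\<^esub>}"
    show "vanishes i W N"
      unfolding vanishes_def
    proof (intro allI impI)
      fix n g assume g: "cocycle i n W N g"
      then have lin: "linear_map R (T n i) W g" by (simp add: cocycle_def)
      have "cocycle i n ?Q {\<zero>\<^bsub>?Q\<^esub>} (\<lambda>z. ?p (g z))"
        using g linear_map_compose[OF lin p] p_zero linear_map_closed[OF lin d_closed]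
        by (auto simp: cocycle_def)
      then obtain k where k: "cobounds i (n + k) ?Q {\<zero>\<^bsub>?Q\<^esub>} (\<lambda>z. ?p (g (phi n k i z)))"
        using van unfolding vanishes_def by blast
      have gW: "g (phi n k i z) \<in> carrier W" if "z \<in> carrier (T (n + k) i)" for z
        using linear_map_closed[OF lin phi_closed[OF that]] .
      have "cobounds i (n + k) W N (\<lambda>z. g (phi n k i z))"
      proof (cases i)
        case 0
        then show ?thesis using k p_zero gW by auto
      next
        case (Suc j)
        obtain h where h: "linear_map R (T (n + k) j) ?Q h"
          and gh: "\<And>z. z \<in> carrier (T (n + k) (Suc j)) \<Longrightarrow>
            cong_mod ?Q {\<zero>\<^bsub>?Q\<^esub>} (?p (g (phi n k i z))) (h (d (n + k) j z))"
          using k unfolding Suc cobounds.simps by blast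
        obtain h' where h': "linear_map R (T (n + k) j) W h'"
          and hh': "\<And>z. z \<in> carrier (T (n + k) j) \<Longrightarrow> ?p (h' z) = h z"
        proof (rule res.term_linear_lift[OF W(1) p h])
          fix f assume "f \<in> carrier (T (n + k) j)"
          then show "h f \<in> ?p ` carrier W"
            using linear_map_closed[OF h] by (simp add: W.quot_module_carrier)
        qed blast
        have "cong_mod W N (g (phi n k i z)) (h' (d (n + k) j z))"
          if z: "z \<in> carrier (T (n + k) (Suc j))" for z
        proof -
          have "cong_mod ?Q {\<zero>\<^bsub>?Q\<^esub>} (?p (g (phi n k i z))) (?p (h' (d (n + k) j z)))"
            using gh[OF z] hh'[OF d_closed[OF z]] by simp
          then show ?thesis
            using p_cong gW z Suc linear_map_closed[OF h' d_closed[OF z]] by blast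
        qed
        then show ?thesis unfolding Suc cobounds.simps using h' Suc by blast
      qed
      then show "\<exists>k. cobounds i (n + k) W N (\<lambda>z. g (phi n k i z))" ..
    qed
  next
    assume van: "vanishes i W N"
    show "vanishes i ?Q {\<zero>\<^bsub>?Q\<^esub>}"
      unfolding vanishes_def
    proof (intro allI impI)
      fix n g assume g: "cocycle i n ?Q {\<zero>\<^bsub>?Q\<^esub>} g"
      then have lin: "linear_map R (T n i) ?Q g" by (simp add: cocycle_def)
      obtain g' where g': "linear_map R (T n i) W g'"
        and gg': "\<And>z. z \<in> carrier (T n i) \<Longrightarrow> ?p (g' z) = g z"
      proof (rule res.term_linear_lift[OF W(1) p lin])
        fix f assume "f \<in> carrier (T n i)"
        then show "g f \<in> ?p ` carrier W"
          using linear_map_closed[OF lin] by (simp add: W.quot_module_carrier)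
      qed blast
      have "g' (d n i z) \<in> N" if z: "z \<in> carrier (T n (Suc i))" for z
        using gg'[OF d_closed[OF z]] p_zero[OF linear_map_closed[OF g' d_closed[OF z]]] g z
        by (simp add: cocycle_def)
      then have "cocycle i n W N g'" using g' by (simp add: cocycle_def)
      then obtain k where k: "cobounds i (n + k) W N (\<lambda>z. g' (phi n k i z))"
        using van unfolding vanishes_def by blast
      have "cobounds i (n + k) ?Q {\<zero>\<^bsub>?Q\<^esub>} (\<lambda>z. ?p (g' (phi n k i z)))"
        using p_zero W.submodule_closed[OF W(2)] by (intro cobounds_map[OF W(1) Q.module_axioms p _ k]) auto
      then have "cobounds i (n + k) ?Q {\<zero>\<^bsub>?Q\<^esub>} (\<lambda>z. g (phi n k i z))"
      proof (rule cobounds_cong_mod[OF Q.module_axioms Q.zero_submodule])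
        fix z assume "z \<in> carrier (T (n + k) i)"
        then show "cong_mod ?Q {\<zero>\<^bsub>?Q\<^esub>} (g (phi n k i z)) (?p (g' (phi n k i z)))"
          using gg'[OF phi_closed] Q.cong_mod_refl[OF Q.zero_submodule] linear_map_closed[OF lin phi_closed]
          by simp
      qed
      then show "\<exists>k. cobounds i (n + k) ?Q {\<zero>\<^bsub>?Q\<^esub>} (\<lambda>z. g (phi n k i z))" ..
    qed
  qed
qed

section \<open>The tower of chosen resolutions\<close>

definition chosen_lift ::
  "('a, 'r) ring_scheme \<Rightarrow> 'a set \<Rightarrow> nat \<Rightarrow> nat \<Rightarrow> (nat \<Rightarrow> 'a) \<Rightarrow> nat \<Rightarrow> 'a" where
  "chosen_lift R \<aa> n = (SOME \<phi>. is_chain_lift R (chosen_resolution R (power_quot R \<aa> (Suc n)))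
     (chosen_resolution R (power_quot R \<aa> n)) (power_quot_proj R \<aa> n) \<phi>)"

text \<open>
  The choices made in the definition of Ext do pick resolutions and lifts, as these exist over a
  Noetherian ring.
\<close>

lemma (in noetherian_cring) chosen_tower:
  assumes "ideal \<aa> R"
  shows "resolution_tower R \<aa> (\<lambda>n. chosen_resolution R (power_quot R \<aa> n)) (chosen_lift R \<aa>)"
proof (intro resolution_tower.intro resolution_tower_axioms.intro)
  let ?A = "\<lambda>n. \<aa> \<up> Suc n"
  have A: "ideal (?A n) R" for n using assms by (rule ideal_power_is_ideal)
  have res: "is_free_resolution R (power_quot R \<aa> n) (chosen_resolution R (power_quot R \<aa> n))" for n
    unfolding chosen_resolution_def power_quot_def using cyclic_resolution_exists[OF A] by (rule someI_ex)
  have free: "free_resolution R (power_quot R \<aa> n) (chosen_resolution R (power_quot R \<aa> n))" for n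
  proof (intro free_resolution.intro free_resolution_axioms.intro)
    show "module R (power_quot R \<aa> n)" unfolding power_quot_def using A by (rule cyclic_module_is_module)
  qed (rule is_cring, rule res)
  show "noetherian_cring R" ..
  show "ideal \<aa> R" by fact
  show "is_free_resolution R (power_quot R \<aa> n) (chosen_resolution R (power_quot R \<aa> n))" for n
    by (rule res)
  have "linear_map R (power_quot R \<aa> (Suc n)) (power_quot R \<aa> n) (power_quot_proj R \<aa> n)" for n
    unfolding power_quot_def power_quot_proj_def
    by (rule cyclic_proj_linear[OF A A ideal_power_Suc_subset[OF assms]])
  from chain_lift_exists[OF free free this]
  show "is_chain_lift R (chosen_resolution R (power_quot R \<aa> (Suc n)))
      (chosen_resolution R (power_quot R \<aa> n)) (power_quot_proj R \<aa> n) (chosen_lift R \<aa> n)" for n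
    unfolding chosen_lift_def by (rule someI_ex)
qed

lemma (in noetherian_cring) chosen_tower_coefficients:
  assumes "ideal \<aa> R" "module R M"
  shows "tower_coefficients R \<aa> (\<lambda>n. chosen_resolution R (power_quot R \<aa> n)) (chosen_lift R \<aa>) M"
  by (intro tower_coefficients.intro tower_coefficients_axioms.intro chosen_tower assms)

lemma (in noetherian_cring) local_cohomology_eq_limit:
  assumes "ideal \<aa> R" "module R M"
  shows "local_cohomology R \<aa> i M =
    direct_limit
      (\<lambda>n. tower_coefficients.E R (\<lambda>n. chosen_resolution R (power_quot R \<aa> n)) M n i)
      (tower_coefficients.transition R (\<lambda>n. chosen_resolution R (power_quot R \<aa> n)) (chosen_lift R \<aa>) M i)"
proof -
  interpret t: tower_coefficients R \<aa> "\<lambda>n. chosen_resolution R (power_quot R \<aa> n)" "chosen_lift R \<aa>" M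
    using assms by (rule chosen_tower_coefficients)
  have E: "Ext R i (power_quot R \<aa> n) M = t.E n i" for n
    by (simp add: Ext_def t.E_def Let_def)
  have "Ext_map R i (power_quot R \<aa> (Suc n)) (power_quot R \<aa> n) (power_quot_proj R \<aa> n) M = t.transition i n"
    for n
    unfolding Ext_map_def t.transition_def chosen_lift_def Let_def E ..
  with E show ?thesis unfolding local_cohomology_def by simp
qed


section \<open>Attached primes\<close>

lemma (in module) annihilator_ideal: "ideal (annihilator R M) R"
  using colon_ideal[OF zero_submodule] by (simp add: annihilator_def)

lemma (in module) annihilator_quot_module:
  assumes "submodule N R M"
  shows "annihilator R (quot_module M N) = {r \<in> carrier R. \<forall>x\<in>carrier M. r \<odot>\<^bsub>M\<^esub> x \<in> N}"
proof -
  have "N +>\<^bsub>M\<^esub> x = N \<longleftrightarrow> x \<in> N" if "x \<in> carrier M" for x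
    using a_r_coset_eq_iff[OF assms that M.zero_closed] a_r_coset_zero[OF assms] cong_mod_zero[OF that] by simp
  then have "r \<odot>\<^bsub>quot_module M N\<^esub> (N +>\<^bsub>M\<^esub> x) = N \<longleftrightarrow> r \<odot>\<^bsub>M\<^esub> x \<in> N"
    if "r \<in> carrier R" "x \<in> carrier M" for r x
    using that by (simp only: quot_module_smult[OF assms] smult_closed)
  then show ?thesis
    unfolding annihilator_def quot_module_carrier quot_module_zero by auto
qed

context tower_coefficients
begin

text \<open>
  Vanishing of \<open>H\<^sup>c(M/\<pp>M)\<close> and right exactness of \<open>H\<^sup>c\<close> give \<open>H\<^sup>c(M) = \<pp>H\<^sup>c(M)\<close>, which lies in every submodule
  \<open>D\<close> with \<open>\<pp>H\<^sup>c(M) \<subseteq> D\<close>. The elements of \<open>H c\<close> are followed through cocycles representing them.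
\<close>

lemma H_subset_submodule:
  assumes D: "submodule D R (H c)"
    and \<pp>: "ideal \<pp> R" and \<pp>_mult: "\<And>r X. r \<in> \<pp> \<Longrightarrow> X \<in> carrier (H c) \<Longrightarrow> r \<odot>\<^bsub>H c\<^esub> X \<in> D"
    and above: "\<And>K. submodule K R M \<Longrightarrow> vanishes (Suc c) (M\<lparr>carrier := K\<rparr>) {\<zero>\<^bsub>M\<^esub>}"
    and quotient: "\<And>N. submodule N R M \<Longrightarrow> (\<And>r w. r \<in> \<pp> \<Longrightarrow> w \<in> carrier M \<Longrightarrow> r \<odot>\<^bsub>M\<^esub> w \<in> N) \<Longrightarrow>
      vanishes c M N"
  shows "carrier (H c) \<subseteq> D"
proof
  interpret H: module R "H c" by (rule limit.limit_is_module)
  obtain S where S: "finite S" "S \<subseteq> carrier R" "\<pp> = Idl S" using finetely_gen[OF \<pp>] by blast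
  obtain xs where xs: "set xs = S" using finite_list[OF S(1)] by blast
  have xsR: "set xs \<subseteq> carrier R" and \<pp>_xs: "\<pp> = Idl (set xs)" using S xs by auto
  have xs_\<pp>: "set xs \<subseteq> \<pp>" using genideal_self[OF xsR] \<pp>_xs by simp
  have N: "submodule (multiples M xs) R M" using xsR by (rule M.multiples_submodule)
  have van: "vanishes c M (multiples M xs)"
    using N M.smult_multiples[OF xsR] unfolding \<pp>_xs by (intro quotient) (simp_all add: \<pp>_xs)
  have H_class_H: "H_class c n g \<in> carrier (H c)" if "closed n c g" for n g
    using that unfolding H_carrier by blast
  fix X assume "X \<in> carrier (H c)"
  then obtain n g where g: "closed n c g" "X = H_class c n g" unfolding H_carrier by blast
  have "cocycle c n M (multiples M xs) g"
    using g(1) M.submodule_zero[OF N] by (auto simp: cocycle_def)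
  then obtain k where k: "cobounds c (n + k) M (multiples M xs) (\<lambda>z. g (phi n k c z))"
    using van unfolding vanishes_def by blast
  have "H_class c (n + k) (\<lambda>z. g (phi n k c z)) \<in> D"
  proof (rule cocycle_in_multiples[OF coefficients xsR above, where P = "\<lambda>n g. H_class c n g \<in> D"])
    fix n g assume g: "closed n c g" "exact n c g"
    have "H_class c n g = \<zero>\<^bsub>H c\<^esub>"
      using H_class_eq_zero_iff[OF g(1)] cobounds_pull[OF g(2), of 0] by blast
    then show "H_class c n g \<in> D" using H.submodule_zero[OF D] by simp
  next
    fix n g x assume x: "x \<in> set xs" and g: "closed n c g"
    then have "x \<odot>\<^bsub>H c\<^esub> H_class c n g \<in> D" using \<pp>_mult xs_\<pp> H_class_H by blast
    then show "H_class c n (\<lambda>z. x \<odot>\<^bsub>M\<^esub> g z) \<in> D" using H_class_smult[OF g] x xsR by auto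
  next
    fix n g h assume g: "closed n c g" and h: "closed n c h"
      and *: "H_class c n (\<lambda>z. g z \<ominus>\<^bsub>M\<^esub> h z) \<in> D" "H_class c n h \<in> D"
    have gh: "closed n c (\<lambda>z. g z \<ominus>\<^bsub>M\<^esub> h z)"
      using g h linear_map_diff_maps[OF coefficients] by (auto simp: cocycle_def M.diff_self)
    have eq: "g z \<ominus>\<^bsub>M\<^esub> h z \<oplus>\<^bsub>M\<^esub> h z = g z" if "z \<in> carrier (T n c)" for z
      using g h that M.add_diff_cancel'(1) by (auto simp: cocycle_def linear_map_def)
    have "ext_class n c (\<lambda>z. g z \<ominus>\<^bsub>M\<^esub> h z \<oplus>\<^bsub>M\<^esub> h z) = ext_class n c g"
      unfolding ext_class_def using eq by (metis (no_types, lifting) restrict_ext)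
    then have "H_class c n g = H_class c n (\<lambda>z. g z \<ominus>\<^bsub>M\<^esub> h z) \<oplus>\<^bsub>H c\<^esub> H_class c n h"
      unfolding H_class_add[OF gh h] by (simp add: H_class_def)
    then show "H_class c n g \<in> D" using H.submodule_add[OF D] * by simp
  next
    fix n k g assume "closed n c g" "H_class c (n + k) (\<lambda>z. g (phi n k c z)) \<in> D"
    then show "H_class c n g \<in> D" by (simp add: H_class_pull)
  next
    show "closed (n + k) c (\<lambda>z. g (phi n k c z))" using g(1) by (rule cocycle_pull)
    show "cobounds c (n + k) M (multiples M xs) (\<lambda>z. g (phi n k c z))" by (rule k)
  qed
  then show "X \<in> D" using H_class_pull[OF g(1)] g(2) by simp
qed

end

theorem proposition1p4:
  fixes R :: "('a, 'r) ring_scheme"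
    and \<aa> :: "'a set"
    and M :: "('a, 'b, 'm) module_scheme"
    and c :: nat
  assumes "cring R" and "noetherian_ring R" and "\<one>\<^bsub>R\<^esub> \<noteq> \<zero>\<^bsub>R\<^esub>"
    and "ideal \<aa> R"
    and "Module.module R M" and "carrier M \<noteq> {\<zero>\<^bsub>M\<^esub>}"
    and "cd R \<aa> M = cd R \<aa> (cyclic_module R (annihilator R M))"
    and "cd R \<aa> M = ereal (real c)"
  shows "attached_primes R (local_cohomology R \<aa> c M) \<subseteq>
    {\<pp> \<in> primes_containing R (annihilator R M).
       cd R \<aa> (cyclic_module R \<pp>) = cd R \<aa> M}"
proof
  fix \<pp> assume att: "\<pp> \<in> attached_primes R (local_cohomology R \<aa> c M)"
  interpret R: noetherian_cring R by (intro noetherian_cring.intro assms)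
  interpret tM: tower_coefficients R \<aa> "\<lambda>n. chosen_resolution R (power_quot R \<aa> n)" "chosen_lift R \<aa>" M
    using assms(4,5) by (rule R.chosen_tower_coefficients)
  interpret H: module R "tM.H c" by (rule tM.limit.limit_is_module)
  \<comment> \<open>The same tower of resolutions serves for all coefficient modules.\<close>
  have trivial_iff: "carrier (local_cohomology R \<aa> i (cyclic_module R J)) =
      {\<zero>\<^bsub>local_cohomology R \<aa> i (cyclic_module R J)\<^esub>} \<longleftrightarrow> tM.vanishes i (self_module R) J"
    if J: "ideal J R" for i J
  proof -
    have cyc: "module R (cyclic_module R J)" using J by (rule R.cyclic_module_is_module)
    interpret t: tower_coefficients R \<aa> "\<lambda>n. chosen_resolution R (power_quot R \<aa> n)" "chosen_lift R \<aa>"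
      "cyclic_module R J"
      using assms(4) cyc by (rule R.chosen_tower_coefficients)
    have "submodule J R (self_module R)" using J R.submodule_self_iff_ideal by blast
    then show ?thesis
      unfolding R.local_cohomology_eq_limit[OF assms(4) cyc] t.H_trivial_iff
      by (rule tM.vanishes_quot_module_iff[OF R.self_module_is_module])
  qed
  have van_above: "tM.vanishes i (self_module R) J"
    if J: "ideal J R" and le: "cd R \<aa> (cyclic_module R J) \<le> ereal (real l)" and i: "l < i" for i l J
  proof (rule ccontr)
    assume "\<not> tM.vanishes i (self_module R) J"
    then have "ereal (real i) \<le> cd R \<aa> (cyclic_module R J)"
      unfolding cd_def using trivial_iff[OF J] by (intro SUP_upper) simp
    then show False using le i by (meson ereal_less_eq(3) le_less_trans of_nat_le_iff order_trans not_le)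
  qed
  let ?J = "annihilator R M"
  have J: "ideal ?J R" by (rule tM.M.annihilator_ideal)
  have van_J: "tM.vanishes i (self_module R) ?J" if "Suc c \<le> i" for i
    using that assms(7,8) by (intro van_above[OF J, of c]) auto
  from att obtain D where prime: "primeideal \<pp> R" and D: "submodule D R (tM.H c)"
    and \<pp>_eq: "\<pp> = annihilator R (quot_module (tM.H c) D)"
    unfolding attached_primes_def R.local_cohomology_eq_limit[OF assms(4,5)] by blast
  interpret \<pp>: primeideal \<pp> R by (rule prime)
  have \<pp>: "\<pp> = {r \<in> carrier R. \<forall>X\<in>carrier (tM.H c). r \<odot>\<^bsub>tM.H c\<^esub> X \<in> D}"
    unfolding \<pp>_eq using D by (rule H.annihilator_quot_module)
  have J\<pp>: "?J \<subseteq> \<pp>"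
  proof
    fix r assume r: "r \<in> ?J"
    then have rR: "r \<in> carrier R" by (simp add: annihilator_def)
    have "r \<odot>\<^bsub>tM.H c\<^esub> X \<in> D" if X: "X \<in> carrier (tM.H c)" for X
    proof -
      obtain n g where g: "tM.closed n c g" "X = tM.H_class c n g"
        using X unfolding tM.H_carrier by blast
      have zero: "tM.exact (n + 0) c (\<lambda>z. r \<odot>\<^bsub>M\<^esub> g (tM.phi n 0 c z))"
        using r g(1) by (intro tM.exact_zero) (simp add: annihilator_def tM.cocycle_def linear_map_def)
      have "tM.H_class c n (\<lambda>z. r \<odot>\<^bsub>M\<^esub> g z) = \<zero>\<^bsub>tM.H c\<^esub>"
        using tM.H_class_eq_zero_iff[OF tM.closed_smult[OF g(1) rR]] zero by blast
      then show ?thesis using tM.H_class_smult[OF g(1) rR] g(2) H.submodule_zero[OF D] by simp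
    qed
    then show "r \<in> \<pp>" using rR \<pp> by blast
  qed
  have van_\<pp>: "tM.vanishes i (self_module R) \<pp>" if "Suc c \<le> i" for i
  proof (rule tM.vanishes_of_cyclic[OF J van_J that R.self_module_is_module])
    show "submodule \<pp> R (self_module R)" using \<pp>.is_ideal R.submodule_self_iff_ideal by blast
    fix r w assume "r \<in> ?J" "w \<in> carrier (self_module R)"
    then show "r \<odot>\<^bsub>self_module R\<^esub> w \<in> \<pp>" using J\<pp> \<pp>.I_r_closed by auto
  qed
  \<comment> \<open>All nonzero degrees are at most \<open>c\<close>, so the dimension is \<open>c\<close> as soon as degree \<open>c\<close> itself is nonzero.\<close>
  have cd_le: "cd R \<aa> (cyclic_module R \<pp>) \<le> ereal (real c)"
    unfolding cd_def
  proof (rule SUP_least)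
    fix i assume "i \<in> {i. carrier (local_cohomology R \<aa> i (cyclic_module R \<pp>)) \<noteq>
      {\<zero>\<^bsub>local_cohomology R \<aa> i (cyclic_module R \<pp>)\<^esub>}}"
    then have "\<not> tM.vanishes i (self_module R) \<pp>" using trivial_iff[OF \<pp>.is_ideal] by simp
    then have "\<not> Suc c \<le> i" using van_\<pp> by blast
    then show "ereal (real i) \<le> ereal (real c)" by simp
  qed
  have "\<not> tM.vanishes c (self_module R) \<pp>"
  proof
    assume van_c: "tM.vanishes c (self_module R) \<pp>"
    have van: "tM.vanishes i (self_module R) \<pp>" if "c \<le> i" for i
      using that van_c van_\<pp> by (cases "i = c") auto
    have sub: "carrier (tM.H c) \<subseteq> D"
    proof (rule tM.H_subset_submodule[OF D \<pp>.is_ideal])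
      show "r \<odot>\<^bsub>tM.H c\<^esub> X \<in> D" if "r \<in> \<pp>" "X \<in> carrier (tM.H c)" for r X
        using that \<pp> by blast
      show "tM.vanishes (Suc c) (M\<lparr>carrier := K\<rparr>) {\<zero>\<^bsub>M\<^esub>}" if K: "submodule K R M" for K
      proof (rule tM.vanishes_of_cyclic[OF J van_J order_refl])
        show "module R (M\<lparr>carrier := K\<rparr>)" using K assms(5) by (rule submodule.submodule_is_module)
        show "submodule {\<zero>\<^bsub>M\<^esub>} R (M\<lparr>carrier := K\<rparr>)"
          using tM.M.submodule_zero[OF K]
          by (intro tM.M.submodule_of_submodule[OF K tM.M.zero_submodule]) simp
        fix r w assume "r \<in> ?J" "w \<in> carrier (M\<lparr>carrier := K\<rparr>)"
        then show "r \<odot>\<^bsub>M\<lparr>carrier := K\<rparr>\<^esub> w \<in> {\<zero>\<^bsub>M\<^esub>}"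
          using tM.M.submodule_closed[OF K] by (simp add: annihilator_def)
      qed simp_all
      show "tM.vanishes c M N"
        if "submodule N R M" "\<And>r w. r \<in> \<pp> \<Longrightarrow> w \<in> carrier M \<Longrightarrow> r \<odot>\<^bsub>M\<^esub> w \<in> N" for N
        by (rule tM.vanishes_of_cyclic[OF \<pp>.is_ideal van order_refl assms(5) that])
    qed
    have "\<one>\<^bsub>R\<^esub> \<odot>\<^bsub>tM.H c\<^esub> X \<in> D" if "X \<in> carrier (tM.H c)" for X
      using H.smult_one[OF that] subsetD[OF sub that] by simp
    then have "\<one>\<^bsub>R\<^esub> \<in> \<pp>" unfolding \<pp> by simp
    then show False using \<pp>.I_notcarr \<pp>.one_imp_carrier by simp
  qed
  then have "ereal (real c) \<le> cd R \<aa> (cyclic_module R \<pp>)"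
    unfolding cd_def using trivial_iff[OF \<pp>.is_ideal] by (intro SUP_upper) simp
  then have "cd R \<aa> (cyclic_module R \<pp>) = cd R \<aa> M"
    using cd_le assms(8) by simp
  then show "\<pp> \<in> {\<pp> \<in> primes_containing R (annihilator R M).
      cd R \<aa> (cyclic_module R \<pp>) = cd R \<aa> M}"
    using prime J\<pp> by (simp add: primes_containing_def)
qed

end
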